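(* Let $j,k,r,n$ be positive integers with $j,k\ge2$. Let $\mathcal{G}_{j,k,r}$ be the multigraph whose vertices are the $r\times(k-1)$ integer matrices $A=(A_{i\ell})$ with $j>A_{i,1}\ge A_{i,2}\ge\dots\ge A_{i,k-1}\ge0$ for each $i\in[r]$, and in which the number $e(A,A')$ of undirected edges between $A$ and $A'$ is: $1$ if $A-A'=\pm E_{i\ell}$ or $A-A'=E_{i\ell}-E_{i'\ell'}$ for some $(i,\ell)\ne(i',\ell')$, where $E_{i\ell}$ is the matrix with $1$ in position $(i,\ell)$ and $0$ elsewhere; $1+d_1+\dots+d_r$ loops if $A=A'$, where $d_i$ is the number of distinct entries in row $i$ of $A$ that are less than $j-1$; and $0$ otherwise. Then the number $\mathrm{NCN}_{j,k}(n,r)$ of $r$-colored partitions $\Lambda$ of $[n]$ with $\mathrm{cr}(\Lambda)<j$ and $\mathrm{ne}(\Lambda)<k$ equals the number of $(n-1)$-step walks in $\mathcal{G}_{j,k,r}$ beginning and ending at the zero matrix (walks being sequences of edges, with parallel edges and loops counted as distinct).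
   Context: For a partition $P$ of $[n]=\{1,\dots,n\}$, $\mathrm{Arc}(P)$ is the set of pairs $(i,j)$ with $i,j$ in the same block and $j$ the least element of that block greater than $i$. A $k$-crossing is a sequence of arcs with $i_1<\dots<i_k<j_1<\dots<j_k$, a $k$-nesting one with $i_1<\dots<i_k<j_k<\dots<j_1$. An $r$-colored partition is $\Lambda=(P,\varphi)$ with $\varphi:\mathrm{Arc}(P)\to[r]$; $\mathrm{cr}(\Lambda)$ ($\mathrm{ne}(\Lambda)$) is the largest $k$ such that $P$ has a $k$-crossing ($k$-nesting) whose arcs all have the same color. *)

theory Defs
  imports
    "HOL-Library.Disjoint_Sets"
    "HOL-Library.FuncSet"
    "Jordan_Normal_Form.Matrix"
begin

definition arcs :: "nat set set \<Rightarrow> (nat \<times> nat) set" where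
  "arcs P = {(a, b). \<exists>B\<in>P. a \<in> B \<and> b \<in> B \<and> a < b \<and> (\<forall>m\<in>B. a < m \<longrightarrow> b \<le> m)}"

text \<open>A sequence of arcs (i1,j1), ..., (im,jm) is a crossing iff the list
  i1, ..., im, j1, ..., jm is strictly increasing, and a nesting iff
  i1, ..., im, jm, ..., j1 is.\<close>

definition is_crossing :: "nat set set \<Rightarrow> (nat \<times> nat) list \<Rightarrow> bool" where
  "is_crossing P as \<longleftrightarrow> set as \<subseteq> arcs P \<and> sorted_wrt (<) (map fst as @ map snd as)"

definition is_nesting :: "nat set set \<Rightarrow> (nat \<times> nat) list \<Rightarrow> bool" where
  "is_nesting P as \<longleftrightarrow> set as \<subseteq> arcs P \<and> sorted_wrt (<) (map fst as @ rev (map snd as))"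

type_synonym coloring = "nat \<times> nat \<Rightarrow> nat"

definition colored_partitions :: "nat \<Rightarrow> nat \<Rightarrow> (nat set set \<times> coloring) set" where
  "colored_partitions n r = (SIGMA P:{P. partition_on {1..n} P}. arcs P \<rightarrow>\<^sub>E {1..r})"

definition monochromatic :: "coloring \<Rightarrow> (nat \<times> nat) list \<Rightarrow> bool" where
  "monochromatic \<phi> as \<longleftrightarrow> (\<exists>c. \<forall>a\<in>set as. \<phi> a = c)"

text \<open>The empty sequence is a 0-crossing and a 0-nesting, so both maxima range over
  nonempty sets; they are 0 exactly when the partition has no arcs.\<close>

definition cr :: "nat set set \<times> coloring \<Rightarrow> nat" where
  "cr \<Lambda> = Max {length as | as. is_crossing (fst \<Lambda>) as \<and> monochromatic (snd \<Lambda>) as}"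

definition ne :: "nat set set \<times> coloring \<Rightarrow> nat" where
  "ne \<Lambda> = Max {length as | as. is_nesting (fst \<Lambda>) as \<and> monochromatic (snd \<Lambda>) as}"

definition NCN :: "nat \<Rightarrow> nat \<Rightarrow> nat \<Rightarrow> nat \<Rightarrow> nat" where
  "NCN j k n r = card {\<Lambda> \<in> colored_partitions n r. cr \<Lambda> < j \<and> ne \<Lambda> < k}"

text \<open>Undirected multigraphs: an edge with endpoints u and v has the endpoint set {u, v},
  which is a singleton for a loop.\<close>

record ('v, 'e) multigraph =
  verts :: "'v set"
  edges :: "'e set"
  ends :: "'e \<Rightarrow> 'v set"

fun walk :: "('v, 'e) multigraph \<Rightarrow> 'v \<Rightarrow> 'e list \<Rightarrow> 'v \<Rightarrow> bool" where
  "walk G u [] v \<longleftrightarrow> u \<in> verts G \<and> u = v"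
| "walk G u (e # es) v \<longleftrightarrow>
     u \<in> verts G \<and> e \<in> edges G \<and> (\<exists>w. ends G e = {u, w} \<and> walk G w es v)"

definition elem_mat :: "nat \<Rightarrow> nat \<Rightarrow> nat \<Rightarrow> nat \<Rightarrow> int mat" where
  "elem_mat nr nc i l = mat nr nc (\<lambda>p. if p = (i, l) then 1 else 0)"

text \<open>Rows and columns are numbered from 0, so the columns are 0, ..., k - 2;
  everything below is meant for k at least 2.\<close>

definition G_verts :: "nat \<Rightarrow> nat \<Rightarrow> nat \<Rightarrow> int mat set" where
  "G_verts j k r = {A \<in> carrier_mat r (k - 1). \<forall>i<r.
     int j > A $$ (i, 0) \<and> (\<forall>l. l + 1 < k - 1 \<longrightarrow> A $$ (i, l) \<ge> A $$ (i, l + 1)) \<and>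
     A $$ (i, k - 2) \<ge> 0}"

definition G_adj :: "nat \<Rightarrow> nat \<Rightarrow> int mat \<Rightarrow> int mat \<Rightarrow> bool" where
  "G_adj k r A A' \<longleftrightarrow>
     (\<exists>i<r. \<exists>l<k - 1. A - A' = elem_mat r (k - 1) i l \<or> A - A' = - elem_mat r (k - 1) i l) \<or>
     (\<exists>i<r. \<exists>l<k - 1. \<exists>i'<r. \<exists>l'<k - 1. (i, l) \<noteq> (i', l') \<and>
        A - A' = elem_mat r (k - 1) i l - elem_mat r (k - 1) i' l')"

definition G_mult :: "nat \<Rightarrow> nat \<Rightarrow> nat \<Rightarrow> int mat \<Rightarrow> int mat \<Rightarrow> nat" where
  "G_mult j k r A A' =
     (if A = A' then 1 + (\<Sum>i<r. card {A $$ (i, l) | l. l < k - 1 \<and> A $$ (i, l) < int j - 1})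
      else if G_adj k r A A' then 1 else 0)"

lemma G_adj_sym:
  assumes "A \<in> carrier_mat r (k - 1)" "A' \<in> carrier_mat r (k - 1)" "G_adj k r A A'"
  shows "G_adj k r A' A"
proof -
  have eq: "A' - A = - (A - A')"
    using assms(1,2) by (intro eq_matI) auto
  have neg: "- (elem_mat r (k - 1) i l - elem_mat r (k - 1) i' l')
      = elem_mat r (k - 1) i' l' - elem_mat r (k - 1) i l" for i l i' l'
    by (intro eq_matI) (auto simp: elem_mat_def)
  show ?thesis
    using assms(3) unfolding G_adj_def eq by (metis neg uminus_uminus_mat)
qed

lemma G_mult_sym:
  assumes "A \<in> G_verts j k r" "A' \<in> G_verts j k r"
  shows "G_mult j k r A A' = G_mult j k r A' A"
  using assms G_adj_sym[of A r k A'] G_adj_sym[of A' r k A]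
  by (auto simp: G_mult_def G_verts_def)

text \<open>The edges between A and A' are the pairs ({A, A'}, t) with t below their number;
  this is well defined because the number of edges is symmetric in A and A'.\<close>

definition G_graph :: "nat \<Rightarrow> nat \<Rightarrow> nat \<Rightarrow> (int mat, int mat set \<times> nat) multigraph" where
  "G_graph j k r =
     \<lparr> verts = G_verts j k r,
       edges = {({A, A'}, t) | A A' t. A \<in> G_verts j k r \<and> A' \<in> G_verts j k r \<and>
                  t < G_mult j k r A A'},
       ends = fst \<rparr>"

end

theory Submission
  imports Defs "HOL-Library.Sublist"
begin

text \<open>At each time t list, for every colour, the openers at most t of the arcs with closer greater
  than t, in decreasing order of the closers. Going from t to t - 1 deletes the greatest possible
  entry t, if present, and then possibly appends the opener of the arc closing at t. Under row
  insertion the first operation removes a corner and the second adds a box, and both can be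
  reversed once the shapes are known, so arc diagrams correspond to sequences of families of Young
  diagrams in which one box may be removed and then one box may be added at each time. By
  Schensted's theorem the bounds on crossings and nestings say that all these shapes fit into a
  rectangle with j - 1 rows and k - 1 columns. Regrouping the steps (n times: remove, then add;
  the first and the last half step are forced) gives n - 1 steps of the form: add at most one
  box, then remove at most one box. The number of intermediate shapes of such a step is the
  edge multiplicity in the graph.\<close>

section \<open>Row insertion\<close>

text \<open>A crossing or nesting has all its openers before all its closers, so at the time of its
  last opener all of its arcs are open; hence it is enough to inspect the open arcs of each time.
  With closers listed in decreasing order, a nesting is an increasing and a crossing a decreasing
  sequence of openers, which gives at most k - 1 columns and at most j - 1 rows. Row lengths and
  column lengths both matter. Knuth moves serve both, since they preserve the greatest lengths of
  increasing and of decreasing subsequences. There is no recording tableau. The words leading to a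
  given state are counted by recursion on their length; each half step is a bijection onto the
  neighbouring shapes, so the count depends on the shape of the state only. A half step changes one
  box in the whole family of colours, not one box for each colour. Therefore an edge can change two
  different rows of the matrix, but never more than two entries.\<close>

definition bump :: "nat set \<Rightarrow> nat \<Rightarrow> nat option" where
  "bump R x = (if \<exists>y\<in>R. x < y then Some (LEAST y. y \<in> R \<and> x < y) else None)"

definition row_insert :: "nat set \<Rightarrow> nat \<Rightarrow> nat set" where
  "row_insert R x = insert x (R - set_option (bump R x))"

text \<open>The recursion is on the index of the row to be computed, with the rows below as a
  shifted family. This needs no bound on the number of rows; such a bound enters only as an
  induction parameter.\<close>

primrec tab_insert :: "(nat \<Rightarrow> nat set) \<Rightarrow> nat \<Rightarrow> nat \<Rightarrow> nat set" where
  "tab_insert T x 0 = row_insert (T 0) x"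
| "tab_insert T x (Suc a) =
     (case bump (T 0) x of None \<Rightarrow> T (Suc a) | Some y \<Rightarrow> tab_insert (\<lambda>a. T (Suc a)) y a)"

text \<open>A tableau is given by the sets of entries of its rows. That columns increase is expressed by
  comparing, for every threshold v, the numbers of entries at most v of adjacent rows.\<close>

definition tableau :: "(nat \<Rightarrow> nat set) \<Rightarrow> bool" where
  "tableau T \<longleftrightarrow> finite (\<Union>(range T)) \<and> disjoint_family_on T UNIV \<and>
     (\<forall>a v. card (T (Suc a) \<inter> {..v}) \<le> card (T a \<inter> {..v}))"

section \<open>Bumping in one row\<close>

lemma bump_NoneD: "bump R x = None \<Longrightarrow> y \<in> R \<Longrightarrow> y \<le> x"
  by (auto simp: bump_def split: if_splits)

lemma bump_SomeD:
  assumes "bump R x = Some y"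
  shows "y \<in> R" "x < y" "\<And>z. z \<in> R \<Longrightarrow> z \<le> x \<or> y \<le> z"
proof -
  from assms have ex: "\<exists>y. y \<in> R \<and> x < y" and y: "y = (LEAST y. y \<in> R \<and> x < y)"
    by (auto simp: bump_def split: if_splits)
  show "y \<in> R" "x < y" using LeastI_ex[OF ex] y by auto
  fix z assume "z \<in> R" then show "z \<le> x \<or> y \<le> z"
    using y Least_le[of "\<lambda>y. y \<in> R \<and> x < y" z] by fastforce
qed

lemma bump_NoneI: "(\<And>y. y \<in> R \<Longrightarrow> y \<le> x) \<Longrightarrow> bump R x = None"
  by (force simp: bump_def)

lemma bump_SomeI:
  assumes "y \<in> R" "x < y" "\<And>z. z \<in> R \<Longrightarrow> z \<le> x \<or> y \<le> z"
  shows "bump R x = Some y"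
proof (cases "bump R x")
  case None
  then show ?thesis using assms(1,2) bump_NoneD leD by blast
next
  case (Some z)
  note z = bump_SomeD[OF Some]
  have "y \<le> z" "z \<le> y" using assms(2) assms(3)[OF z(1)] z(2) z(3)[OF assms(1)] by auto
  then show ?thesis using Some by simp
qed

lemma row_insert_None: "bump R x = None \<Longrightarrow> row_insert R x = insert x R"
  by (simp add: row_insert_def)

lemma row_insert_Some: "bump R x = Some y \<Longrightarrow> row_insert R x = insert x (R - {y})"
  by (simp add: row_insert_def)

text \<open>From \<open>x\<close> up to the bumped entry the count is one higher; from the bumped
  entry on, gain and loss cancel. Counts up to a threshold are what the column condition
  compares.\<close>

lemma card_row_insert:
  assumes "finite R" "x \<notin> R"
  shows "card (row_insert R x \<inter> {..v}) =
    card (R \<inter> {..v}) + (if x \<le> v \<and> (\<forall>y. bump R x = Some y \<longrightarrow> v < y) then 1 else 0)"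
proof (cases "bump R x")
  case None
  then show ?thesis using assms by (auto simp: row_insert_None)
next
  case (Some y)
  note y = bump_SomeD[OF Some]
  have eq: "row_insert R x = insert x (R - {y})" using Some by (rule row_insert_Some)
  consider "v < x" | "x \<le> v" "v < y" | "y \<le> v" "x \<le> v" using y by linarith
  then show ?thesis
  proof cases
    case 1
    then have "row_insert R x \<inter> {..v} = R \<inter> {..v}" using y eq by auto
    then show ?thesis using 1 by simp
  next
    case 2
    then have "row_insert R x \<inter> {..v} = insert x (R \<inter> {..v})" using y eq by auto
    then show ?thesis using 2 Some assms by simp
  next
    case 3
    then have *: "row_insert R x \<inter> {..v} = insert x (R \<inter> {..v} - {y})" using y eq by auto
    have "card (insert x (R \<inter> {..v} - {y})) = Suc (card (R \<inter> {..v} - {y}))"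
      using assms by simp
    also have "\<dots> = card (R \<inter> {..v})"
      using 3 y assms by (intro card_Suc_Diff1) auto
    finally show ?thesis using * 3 Some by simp
  qed
qed

lemma card_row_insert_all:
  assumes "finite R" "x \<notin> R"
  shows "card (row_insert R x) = card R + (if bump R x = None then 1 else 0)"
proof (cases "bump R x")
  case None
  then show ?thesis using assms by (simp add: row_insert_None)
next
  case (Some y)
  then show ?thesis using assms bump_SomeD[OF Some] card_Suc_Diff1[of R y]
    by (simp add: row_insert_Some)
qed

section \<open>Tableaux by their first row\<close>

lemma tableau_finite: "tableau T \<Longrightarrow> finite (T a)"
  unfolding tableau_def by (meson UNIV_I UN_upper finite_subset)

lemma tableau_shift: "tableau T \<Longrightarrow> tableau (\<lambda>a. T (Suc a))"
  unfolding tableau_def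
  by (auto simp: disjoint_family_on_def intro: finite_subset[of "\<Union>(range (\<lambda>a. T (Suc a)))" "\<Union>(range T)"])

lemma UNIV_nat_eq0: "(UNIV :: nat set) = insert 0 (range Suc)"
  by (metis UNIV_eq_I insert_iff not0_implies_Suc rangeI)

lemma UN_shift: "\<Union>(range T) = T (0::nat) \<union> \<Union>(range (\<lambda>a. T (Suc a)))"
proof -
  have "range T = insert (T 0) (range (\<lambda>a. T (Suc a)))"
    using UNIV_nat_eq0 by (metis image_insert image_image)
  then show ?thesis by simp
qed

text \<open>Splitting off row 0 lets the inductions on the number of nonempty rows pass to the
  shifted family.\<close>

lemma tableau_rec:
  "tableau T \<longleftrightarrow> finite (T 0) \<and> T 0 \<inter> \<Union>(range (\<lambda>a. T (Suc a))) = {} \<and>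
    (\<forall>v. card (T 1 \<inter> {..v}) \<le> card (T 0 \<inter> {..v})) \<and> tableau (\<lambda>a. T (Suc a))"
proof
  assume T: "tableau T"
  then have "T 0 \<inter> T (Suc a) = {}" for a
    unfolding tableau_def disjoint_family_on_def by blast
  then show "finite (T 0) \<and> T 0 \<inter> \<Union>(range (\<lambda>a. T (Suc a))) = {} \<and>
    (\<forall>v. card (T 1 \<inter> {..v}) \<le> card (T 0 \<inter> {..v})) \<and> tableau (\<lambda>a. T (Suc a))"
    using T tableau_shift[OF T] tableau_finite[OF T] by (auto simp: tableau_def)
next
  assume *: "finite (T 0) \<and> T 0 \<inter> \<Union>(range (\<lambda>a. T (Suc a))) = {} \<and>
    (\<forall>v. card (T 1 \<inter> {..v}) \<le> card (T 0 \<inter> {..v})) \<and> tableau (\<lambda>a. T (Suc a))"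
  have "finite (\<Union>(range T))" using * by (subst UN_shift) (auto simp: tableau_def)
  moreover have "T a \<inter> T b = {}" if "a \<noteq> b" for a b
  proof (cases a; cases b)
    fix a' b' assume "a = Suc a'" "b = Suc b'"
    with that have "a' \<noteq> b'" by simp
    then have "T (Suc a') \<inter> T (Suc b') = {}"
      using * unfolding tableau_def disjoint_family_on_def by blast
    with \<open>a = Suc a'\<close> \<open>b = Suc b'\<close> show ?thesis by simp
  qed (use * that in auto)
  moreover have "card (T (Suc a) \<inter> {..v}) \<le> card (T a \<inter> {..v})" for a v
    using * by (cases a) (auto simp: tableau_def)
  ultimately show "tableau T" unfolding tableau_def disjoint_family_on_def by blast
qed

lemma tableau_empty: "tableau (\<lambda>_. {})"
  by (simp add: tableau_def disjoint_family_on_def)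

text \<open>Disjoint nonempty rows are distinct subsets of one finite set, so there are finitely
  many. The bound \<open>N\<close> is the parameter of the inductions on tableaux.\<close>

lemma finite_family_eventually_empty:
  fixes T :: "nat \<Rightarrow> nat set"
  assumes "finite (\<Union>(range T))" "disjoint_family_on T UNIV"
  obtains N where "\<And>a. a \<ge> N \<Longrightarrow> T a = {}"
proof -
  let ?A = "{a. T a \<noteq> {}}"
  have "inj_on T ?A" using assms(2)
    unfolding inj_on_def disjoint_family_on_def by blast
  moreover have "finite (T ` ?A)"
    by (rule finite_subset[OF _ finite_Pow_iff[THEN iffD2, OF assms(1)]]) auto
  ultimately have "finite ?A" using finite_imageD by blast
  then obtain N where "\<forall>a\<in>?A. a < N" using finite_nat_set_iff_bounded by blast
  then show ?thesis using that[of N] by (metis (mono_tags, lifting) leD mem_Collect_eq)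
qed

lemma tableau_eventually_empty:
  assumes "tableau T"
  obtains N where "\<And>a. a \<ge> N \<Longrightarrow> T a = {}"
  using assms finite_family_eventually_empty unfolding tableau_def by metis

section \<open>Row insertion yields a tableau with one more box\<close>

lemma tab_insert_shift_None:
  "bump (T 0) x = None \<Longrightarrow> (\<lambda>a. tab_insert T x (Suc a)) = (\<lambda>a. T (Suc a))"
  by auto

lemma tab_insert_shift_Some:
  "bump (T 0) x = Some y \<Longrightarrow> (\<lambda>a. tab_insert T x (Suc a)) = tab_insert (\<lambda>a. T (Suc a)) y"
  by auto

text \<open>An insertion occupies at most one new row, so the bound grows by one.\<close>

lemma tab_insert_eventually:
  "(\<And>a. a \<ge> N \<Longrightarrow> T a = {}) \<Longrightarrow> a > N \<Longrightarrow> tab_insert T x a = {}"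
proof (induction N arbitrary: T x a)
  case 0
  then have "bump (T 0) x = None" by (intro bump_NoneI) auto
  then show ?case using 0 by (cases a) auto
next
  case (Suc N)
  then obtain a' where a: "a = Suc a'" "a' > N" by (cases a) auto
  then show ?case using Suc.prems Suc.IH[of "\<lambda>a. T (Suc a)" a'] by (auto split: option.splits)
qed

text \<open>A bumped entry y was counted in the upper row from the threshold y on, so there the lower
  row had at least one entry less and can take y.\<close>

lemma tableau_insert_aux:
  assumes "\<And>a. a \<ge> N \<Longrightarrow> T a = {}" "tableau T" "x \<notin> \<Union>(range T)"
  shows "tableau (tab_insert T x) \<and> \<Union>(range (tab_insert T x)) = insert x (\<Union>(range T))"
  using assms
proof (induction N arbitrary: T x)
  case 0
  then have T: "T = (\<lambda>_. {})" by auto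
  have b: "bump (T 0) x = None" using T by (intro bump_NoneI) auto
  have e: "(\<lambda>a. T (Suc a)) = (\<lambda>_. {})" using T by auto
  have U: "\<Union>(range T) = {}" using T by auto
  show ?case
    unfolding tableau_rec[of "tab_insert T x"] UN_shift[of "tab_insert T x"]
      tab_insert_shift_None[of T x, OF b] e U
    using b by (simp add: T row_insert_None tableau_empty)
next
  case (Suc N)
  let ?T' = "tab_insert T x"
  have T: "finite (T 0)" "T 0 \<inter> \<Union>(range (\<lambda>a. T (Suc a))) = {}"
    "\<And>v. card (T 1 \<inter> {..v}) \<le> card (T 0 \<inter> {..v})" "tableau (\<lambda>a. T (Suc a))"
    using Suc.prems(2) unfolding tableau_rec[of T] by auto
  have x: "x \<notin> T 0" "x \<notin> \<Union>(range (\<lambda>a. T (Suc a)))" using Suc.prems(3) by (auto simp: UN_shift[of T])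
  have fin1: "finite (T 1)" using T(4) tableau_finite by fastforce
  show ?case
  proof (cases "bump (T 0) x")
    case None
    have "card (T 1 \<inter> {..v}) \<le> card (row_insert (T 0) x \<inter> {..v})" for v
      using T(3)[of v] card_row_insert[OF T(1) x(1), of v] by simp
    then have "tableau ?T'"
      unfolding tableau_rec[of ?T'] tab_insert_shift_None[of T x, OF None]
      using T x None by (auto simp: row_insert_None)
    then show ?thesis
      using None by (simp add: UN_shift[of T] UN_shift[of ?T'] tab_insert_shift_None
          row_insert_None)
  next
    case (Some y)
    note y = bump_SomeD[OF Some]
    have y': "y \<notin> \<Union>(range (\<lambda>a. T (Suc a)))" using y T(2) by blast
    have "T (Suc a) = {}" if "a \<ge> N" for a using Suc.prems(1) that by simp
    then have IH: "tableau (tab_insert (\<lambda>a. T (Suc a)) y)"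
      "\<Union>(range (tab_insert (\<lambda>a. T (Suc a)) y)) = insert y (\<Union>(range (\<lambda>a. T (Suc a))))"
      using Suc.IH[of "\<lambda>a. T (Suc a)" y] T(4) y' by auto
    have "card (row_insert (T 1) y \<inter> {..v}) \<le> card (row_insert (T 0) x \<inter> {..v})" for v
    proof -
      have c1: "card (row_insert (T 1) y \<inter> {..v}) = card (T 1 \<inter> {..v}) +
        (if y \<le> v \<and> (\<forall>z. bump (T 1) y = Some z \<longrightarrow> v < z) then 1 else 0)"
        using card_row_insert[OF fin1, of y v] y' by auto
      show ?thesis
      proof (cases "y \<le> v \<and> (\<forall>z. bump (T 1) y = Some z \<longrightarrow> v < z)")
        case True
        \<comment> \<open>Row 1 has no entry from \<open>y\<close> to \<open>v\<close>: it does not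
          contain \<open>y\<close>, and either it has no entry above \<open>y\<close> or the least
          such entry exceeds \<open>v\<close>.\<close>
        have "T 1 \<inter> {..v} \<subseteq> T 1 \<inter> {..y - 1}"
        proof
          fix z assume z: "z \<in> T 1 \<inter> {..v}"
          have "z \<noteq> y" using z y' by auto
          moreover have "z \<le> y"
          proof (cases "bump (T 1) y")
            case None
            then show ?thesis using bump_NoneD z by blast
          next
            case (Some u)
            then have "v < u" using True by blast
            then show ?thesis using bump_SomeD(3)[OF Some, of z] z by auto
          qed
          ultimately show "z \<in> T 1 \<inter> {..y - 1}" using z by auto
        qed
        then have "card (T 1 \<inter> {..v}) \<le> card (T 1 \<inter> {..y - 1})"
          using fin1 by (intro card_mono) auto
        also have "\<dots> \<le> card (T 0 \<inter> {..y - 1})" by (rule T(3))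
        \<comment> \<open>The inequality is strict because \<open>y\<close> itself lies in row
          0.\<close>
        also have "\<dots> < card (T 0 \<inter> {..v})"
        proof (rule psubset_card_mono)
          show "T 0 \<inter> {..y - 1} \<subset> T 0 \<inter> {..v}" using y True by force
        qed (use T in auto)
        finally show ?thesis using c1 True card_row_insert[OF T(1) x(1), of v] by simp
      next
        case False
        then show ?thesis using c1 T(3)[of v] card_row_insert[OF T(1) x(1), of v] by auto
      qed
    qed
    moreover have "row_insert (T 0) x \<inter> insert y (\<Union>(range (\<lambda>a. T (Suc a)))) = {}"
      using T(2) x y by (auto simp: row_insert_Some[OF Some])
    ultimately have "tableau ?T'"
      unfolding tableau_rec[of ?T'] tab_insert_shift_Some[of T x, OF Some]
      using T IH Some by (auto simp: row_insert_def)
    moreover have "\<Union>(range ?T') = insert x (\<Union>(range T))"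
      unfolding UN_shift[of ?T'] tab_insert_shift_Some[of T x, OF Some] UN_shift[of T] IH(2)
      using y by (auto simp: row_insert_Some[OF Some])
    ultimately show ?thesis by blast
  qed
qed

lemma tableau_insert:
  assumes "tableau T" "x \<notin> \<Union>(range T)"
  shows "tableau (tab_insert T x)" "\<Union>(range (tab_insert T x)) = insert x (\<Union>(range T))"
proof -
  obtain N where "\<And>a. a \<ge> N \<Longrightarrow> T a = {}" using tableau_eventually_empty assms(1) by blast
  from tableau_insert_aux[OF this assms] show "tableau (tab_insert T x)"
    "\<Union>(range (tab_insert T x)) = insert x (\<Union>(range T))" by auto
qed

text \<open>A row from which an entry is bumped keeps its size, so only the row \<open>a\<close>
  where the bumping path ends grows.\<close>

lemma card_tab_insert_aux:
  assumes "\<And>a. a \<ge> N \<Longrightarrow> T a = {}" "tableau T" "x \<notin> \<Union>(range T)"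
  shows "\<exists>a. \<forall>b. card (tab_insert T x b) = card (T b) + (if b = a then 1 else 0)"
  using assms
proof (induction N arbitrary: T x)
  case 0
  then have T: "T = (\<lambda>_. {})" by auto
  have b: "bump (T 0) x = None" using T by (intro bump_NoneI) auto
  have "card (tab_insert T x b) = card (T b) + (if b = 0 then 1 else 0)" for b
    using b T by (cases b) (auto simp: row_insert_None)
  then show ?case by blast
next
  case (Suc N)
  have T: "finite (T 0)" "T 0 \<inter> \<Union>(range (\<lambda>a. T (Suc a))) = {}" "tableau (\<lambda>a. T (Suc a))"
    using Suc.prems(2) unfolding tableau_rec[of T] by auto
  have x: "x \<notin> T 0" using Suc.prems(3) by (auto simp: UN_shift[of T])
  show ?case
  proof (cases "bump (T 0) x")
    case None
    have "card (tab_insert T x b) = card (T b) + (if b = 0 then 1 else 0)" for b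
      using None T x by (cases b) (auto simp: row_insert_None)
    then show ?thesis by blast
  next
    case (Some y)
    note y = bump_SomeD[OF Some]
    have "T (Suc a) = {}" if "a \<ge> N" for a using Suc.prems(1) that by simp
    moreover have y': "y \<notin> \<Union>(range (\<lambda>a. T (Suc a)))" using y T(2) by blast
    ultimately obtain a where
      a: "\<And>b. card (tab_insert (\<lambda>a. T (Suc a)) y b) = card (T (Suc b)) + (if b = a then 1 else 0)"
      using Suc.IH[of "\<lambda>a. T (Suc a)" y] T(3) by auto
    have "card (row_insert (T 0) x) = card (T 0)"
      unfolding row_insert_Some[OF Some] using T x y
      by (metis DiffD1 card_Suc_Diff1 card_insert_disjoint finite_Diff)
    then have "card (tab_insert T x b) = card (T b) + (if b = Suc a then 1 else 0)" for b
      using a[of "b - 1"] Some by (cases b) auto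
    then show ?thesis by blast
  qed
qed

lemma card_tab_insert:
  assumes "tableau T" "x \<notin> \<Union>(range T)"
  obtains a where "\<And>b. card (tab_insert T x b) = card (T b) + (if b = a then 1 else 0)"
proof -
  obtain N where "\<And>a. a \<ge> N \<Longrightarrow> T a = {}" using tableau_eventually_empty assms(1) by blast
  from card_tab_insert_aux[OF this assms] that show ?thesis by blast
qed

section \<open>Inverting row insertion\<close>

text \<open>Row 0 grows precisely if nothing is bumped. As the shapes agree before and after, either
  both insertions bump or neither does. In the second case \<open>x\<close> and \<open>y\<close> are
  both the maximum of the common new row. In the first case induction on the lower rows shows that
  the bumped entries agree.\<close>

lemma tab_insert_inj_aux:
  assumes "\<And>a. a \<ge> N \<Longrightarrow> T a = {}" "tableau T" "tableau U"
    "x \<notin> \<Union>(range T)" "y \<notin> \<Union>(range U)"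
    "tab_insert T x = tab_insert U y" "\<And>a. card (T a) = card (U a)"
  shows "T = U \<and> x = y"
  using assms
proof (induction N arbitrary: T U x y)
  case 0
  have T: "T = (\<lambda>_. {})" using 0(1) by auto
  have "U a = {}" for a using 0(7)[of a] T tableau_finite[OF 0(3), of a] by simp
  then have U: "U = (\<lambda>_. {})" by auto
  have "tab_insert T x 0 = tab_insert U y 0" by (simp only: 0(6))
  then show ?case by (simp add: T U row_insert_def)
next
  case (Suc N)
  have fin: "finite (T 0)" "finite (U 0)" using Suc.prems tableau_finite by auto
  have xy: "x \<notin> T 0" "y \<notin> U 0" using Suc.prems by auto
  have r0: "row_insert (T 0) x = row_insert (U 0) y"
    using fun_cong[OF Suc.prems(6), of 0] by simp
  have iff: "bump (T 0) x = None \<longleftrightarrow> bump (U 0) y = None"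
    using card_row_insert_all[OF fin(1) xy(1)] card_row_insert_all[OF fin(2) xy(2)] r0 Suc.prems(7)[of 0]
    by (auto split: if_splits)
  show ?case
  proof (cases "bump (T 0) x")
    case None
    then have N: "bump (U 0) y = None" using iff by simp
    have eq: "insert x (T 0) = insert y (U 0)" using r0 None N by (simp add: row_insert_None)
    have "x = y"
    proof (rule antisym)
      show "x \<le> y" using eq bump_NoneD[OF N] by (metis insertE insertI1 order_refl)
      show "y \<le> x" using eq bump_NoneD[OF None] by (metis insertE insertI1 order_refl)
    qed
    moreover have "T 0 = U 0" using eq xy \<open>x = y\<close> by (simp add: insert_ident)
    moreover have "T (Suc a) = U (Suc a)" for a
      using fun_cong[OF Suc.prems(6), of "Suc a"] None N by simp
    ultimately show ?thesis using not0_implies_Suc by (metis ext)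
  next
    case (Some p)
    then obtain q where q: "bump (U 0) y = Some q" using iff by auto
    note P = bump_SomeD[OF Some] and Q = bump_SomeD[OF q]
    have "tableau (\<lambda>a. T (Suc a))" "tableau (\<lambda>a. U (Suc a))"
      using Suc.prems tableau_shift by auto
    moreover have "p \<notin> \<Union>(range (\<lambda>a. T (Suc a)))" "q \<notin> \<Union>(range (\<lambda>a. U (Suc a)))"
      using P Q Suc.prems(2,3) unfolding tableau_rec[of T] tableau_rec[of U] by blast+
    moreover have "tab_insert (\<lambda>a. T (Suc a)) p = tab_insert (\<lambda>a. U (Suc a)) q"
      using fun_cong[OF Suc.prems(6), of "Suc _"] Some q by auto
    ultimately have "(\<lambda>a. T (Suc a)) = (\<lambda>a. U (Suc a)) \<and> p = q"
      using Suc.prems(1,7) by (intro Suc.IH) auto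
    then have sh: "\<And>a. T (Suc a) = U (Suc a)" and pq: "p = q" by meson+
    have eq: "insert x (T 0 - {p}) = insert y (U 0 - {p})"
      using r0 by (simp add: row_insert_Some[OF Some] row_insert_Some[OF q] pq)
    \<comment> \<open>Both are the greatest entry of the common new row below
      \<open>p\<close>.\<close>
    have "x = y"
    proof (rule antisym)
      have "x \<in> insert y (U 0 - {p})" using eq by blast
      then show "x \<le> y" using Q(3)[of x] P(2) pq by auto
      have "y \<in> insert x (T 0 - {p})" using eq by blast
      then show "y \<le> x" using P(3)[of y] Q(2) pq by auto
    qed
    moreover have "T 0 - {p} = U 0 - {p}" using eq xy \<open>x = y\<close> by (simp add: insert_ident)
    then have "T 0 = U 0" using P(1) Q(1) pq by (metis insert_Diff)
    ultimately show ?thesis using sh not0_implies_Suc by (metis ext)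
  qed
qed

lemma tab_insert_inj:
  assumes "tableau T" "tableau U" "x \<notin> \<Union>(range T)" "y \<notin> \<Union>(range U)"
    "tab_insert T x = tab_insert U y" "\<And>a. card (T a) = card (U a)"
  shows "T = U" "x = y"
proof -
  obtain N where "\<And>a. a \<ge> N \<Longrightarrow> T a = {}" using tableau_eventually_empty assms(1) by blast
  from tab_insert_inj_aux[OF this assms] show "T = U" "x = y" by auto
qed

text \<open>Reverse bumping: the assumption makes the last box of row \<open>a\<close> a corner. Its
  entry is taken out, and in each higher row the entry \<open>y\<close> coming from below replaces
  the greatest entry less than \<open>y\<close>, which moves on; the entry leaving row 0 is
  \<open>x\<close>.\<close>

lemma tab_insert_surj:
  assumes "tableau T'" "card (T' (Suc a)) < card (T' a)"
  shows "\<exists>T x. tableau T \<and> x \<notin> \<Union>(range T) \<and> tab_insert T x = T' \<and>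
    (\<forall>b. card (T' b) = card (T b) + (if b = a then 1 else 0))"
  using assms
proof (induction a arbitrary: T')
  case 0
  have T': "finite (T' 0)" "T' 0 \<inter> \<Union>(range (\<lambda>a. T' (Suc a))) = {}"
    "\<And>v. card (T' 1 \<inter> {..v}) \<le> card (T' 0 \<inter> {..v})" "tableau (\<lambda>a. T' (Suc a))"
    using 0(1) unfolding tableau_rec[of T'] by auto
  define x where "x = Max (T' 0)"
  have ne: "T' 0 \<noteq> {}" using 0(2) by auto
  have x: "x \<in> T' 0" "\<And>y. y \<in> T' 0 \<Longrightarrow> y \<le> x" using ne T'(1) by (auto simp: x_def)
  define T where "T = T'(0 := T' 0 - {x})"
  have sh: "(\<lambda>a. T (Suc a)) = (\<lambda>a. T' (Suc a))" by (simp add: T_def)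
  have b: "bump (T 0) x = None" using x by (intro bump_NoneI) (auto simp: T_def)
  \<comment> \<open>Only thresholds from \<open>x\<close> on notice the removal. There all of both
    rows is counted, and row 1 is strictly shorter than row 0.\<close>
  have "card (T' 1 \<inter> {..v}) \<le> card ((T' 0 - {x}) \<inter> {..v})" for v
  proof (cases "x \<le> v")
    case True
    then have "(T' 0 - {x}) \<inter> {..v} = T' 0 - {x}" using x by force
    moreover have "card (T' 1 \<inter> {..v}) \<le> card (T' 1)"
      using tableau_finite[OF 0(1)] by (intro card_mono) auto
    ultimately show ?thesis using 0(2) x(1) T'(1) by simp
  next
    case False
    then have "(T' 0 - {x}) \<inter> {..v} = T' 0 \<inter> {..v}" by auto
    then show ?thesis using T'(3) by simp
  qed
  then have "tableau T" using T' by (subst tableau_rec) (auto simp: T_def)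
  moreover have "x \<notin> \<Union>(range T)" using T'(2) x(1)
    by (subst UN_shift, subst sh) (auto simp: T_def)
  moreover have "tab_insert T x = T'"
  proof
    fix a show "tab_insert T x a = T' a"
      using b x(1) by (cases a) (auto simp: row_insert_None T_def)
  qed
  moreover have "card (T' b) = card (T b) + (if b = 0 then 1 else 0)" for b
    using x(1) T'(1) card_Suc_Diff1[of "T' 0" x] by (auto simp: T_def)
  ultimately show ?case by blast
next
  case (Suc a)
  have T': "finite (T' 0)" "T' 0 \<inter> \<Union>(range (\<lambda>a. T' (Suc a))) = {}"
    "\<And>v. card (T' 1 \<inter> {..v}) \<le> card (T' 0 \<inter> {..v})" "tableau (\<lambda>a. T' (Suc a))"
    using Suc.prems(1) unfolding tableau_rec[of T'] by auto
  have fin1: "finite (T' 1)" using tableau_finite[OF Suc.prems(1)] .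
  from Suc.IH[of "\<lambda>a. T' (Suc a)"] T'(4) Suc.prems(2) obtain U y where
    U: "tableau U" "y \<notin> \<Union>(range U)" "tab_insert U y = (\<lambda>a. T' (Suc a))"
    "\<And>b. card (T' (Suc b)) = card (U b) + (if b = a then 1 else 0)" by auto
  have T'1: "T' 1 = row_insert (U 0) y" using fun_cong[OF U(3), of 0] by simp
  then have y1: "y \<in> T' 1" by (simp add: row_insert_def)
  then have y0: "y \<notin> T' 0" using T'(2) by force
  have ent: "\<Union>(range (\<lambda>a. T' (Suc a))) = insert y (\<Union>(range U))"
    using tableau_insert(2)[OF U(1,2)] U(3) by simp
  have U0: "card (U 0 \<inter> {..v}) \<le> card (T' 1 \<inter> {..v})" for v
    using card_row_insert[OF tableau_finite[OF U(1)], of y 0 v] U(2) T'1 by simp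
  define X where "X = T' 0 \<inter> {..<y}"
  have Xle: "T' 0 \<inter> {..y} = X" using y0 by (auto simp: X_def nat_less_le)
  \<comment> \<open>Since \<open>y\<close> lies in row 1, the column condition at the threshold
    \<open>y\<close> provides an entry of row 0 below \<open>y\<close>.\<close>
  have "0 < card (T' 1 \<inter> {..y})" using y1 fin1 by (subst card_gt_0_iff) auto
  then have "0 < card X" using T'(3)[of y] Xle by simp
  then have Xne: "X \<noteq> {}" "finite X" by (simp_all add: card_gt_0_iff)
  define x where "x = Max X"
  have x: "x \<in> T' 0" "x < y" "\<And>z. z \<in> T' 0 \<Longrightarrow> z < y \<Longrightarrow> z \<le> x"
    using Max_in[OF Xne(2,1)] Xne(2) by (auto simp: x_def X_def)
  define T where "T = (\<lambda>b. case b of 0 \<Rightarrow> insert y (T' 0 - {x}) | Suc b \<Rightarrow> U b)"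
  have T0: "T 0 = insert y (T' 0 - {x})" and sh: "(\<lambda>b. T (Suc b)) = U"
    by (simp_all add: T_def)
  have TS: "T (Suc b) = U b" for b by (simp add: T_def)
  have b: "bump (T 0) x = Some y"
    using x by (intro bump_SomeI) (auto simp: T0 not_less)
  have "card (U 0 \<inter> {..v}) \<le> card (T 0 \<inter> {..v})" for v
  proof -
    have cT: "card (T' 0 \<inter> {..v}) =
        card (T 0 \<inter> {..v}) + (if x \<le> v \<and> (\<forall>z. bump (T 0) x = Some z \<longrightarrow> v < z) then 1 else 0)"
    proof -
      have "T' 0 = row_insert (T 0) x" using row_insert_Some[OF b] x(1) y0 by (auto simp: T0)
      then show ?thesis using card_row_insert[of "T 0" x v] T'(1) x(2) by (simp add: T0)
    qed
    show ?thesis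
    proof (cases "x \<le> v \<and> v < y")
      case True
      \<comment> \<open>For these thresholds row 0 of \<open>T\<close> has one entry less than row 0
        of \<open>T'\<close>. This is made up for by \<open>y\<close>, which row 1 of
        \<open>T'\<close> still has beyond \<open>v\<close>, whereas row 0 of \<open>T'\<close> has
        nothing from \<open>v\<close> to \<open>y\<close> that is not counted already.\<close>
      have "card (T' 1 \<inter> {..v}) < card (T' 1 \<inter> {..y})"
        using True y1 fin1 by (intro psubset_card_mono) force+
      also have "\<dots> \<le> card X" using T'(3)[of y] Xle by simp
      also have "X = T' 0 \<inter> {..v}" using True x by (force simp: X_def)
      finally show ?thesis using cT True b U0[of v] by simp
    next
      case False
      then show ?thesis using cT b U0[of v] T'(3)[of v] by (simp split: if_splits)
    qed
  qed
  then have "tableau T"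
    using T'(1,2) U(1,2) x ent by (subst tableau_rec) (auto simp: T0 TS)
  moreover have "x \<notin> \<Union>(range T)"
    using x(1,2) T'(2) ent by (subst UN_shift, subst sh) (auto simp: T0)
  moreover have "tab_insert T x = T'"
  proof
    fix b' show "tab_insert T x b' = T' b'"
    proof (cases b')
      case 0
      then show ?thesis using row_insert_Some[OF b] x(1) y0 by (auto simp: T0)
    next
      case (Suc c)
      then show ?thesis using b fun_cong[OF U(3), of c] sh by simp
    qed
  qed
  moreover have "card (T' b) = card (T b) + (if b = Suc a then 1 else 0)" for b
  proof (cases b)
    case 0
    then show ?thesis using T0 x(1) y0 T'(1) card_Suc_Diff1[of "T' 0" x] by simp
  next
    case (Suc c)
    then show ?thesis using U(4)[of c] fun_cong[OF sh, of c] by simp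
  qed
  ultimately show ?case by blast
qed

section \<open>Deleting the greatest entry\<close>

lemma tab_insert_greatest:
  assumes "\<And>y. y \<in> T 0 \<Longrightarrow> y \<le> m"
  shows "tab_insert T m = T(0 := insert m (T 0))"
proof
  fix a
  have "bump (T 0) m = None" using assms by (rule bump_NoneI)
  then show "tab_insert T m a = (T(0 := insert m (T 0))) a" by (cases a) (auto simp: row_insert_None)
qed

text \<open>The greatest entry bumps nothing: driven out of a row, it settles at the end of the
  next. So it has no influence on where the other entries go.\<close>

lemma tab_insert_delete_greatest:
  assumes "tableau T" "\<And>a y. y \<in> T a \<Longrightarrow> y \<le> m" "x < m" "x \<notin> \<Union>(range T)"
  shows "tab_insert T x a - {m} = tab_insert (\<lambda>a. T a - {m}) x a"
  using assms
proof (induction a arbitrary: T x)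
  case 0
  show ?case
  proof (cases "bump (T 0) x")
    case None
    then have "bump (T 0 - {m}) x = None" using bump_NoneD by (intro bump_NoneI) auto
    then show ?thesis using None 0 by (auto simp: row_insert_None)
  next
    case (Some y)
    note y = bump_SomeD[OF Some]
    show ?thesis
    proof (cases "y = m")
      case True
      then have "bump (T 0 - {m}) x = None" using y 0(2) by (intro bump_NoneI) force
      then show ?thesis using Some True 0 by (auto simp: row_insert_None row_insert_Some)
    next
      case False
      then have "bump (T 0 - {m}) x = Some y" using y by (intro bump_SomeI) auto
      then show ?thesis using Some 0 by (auto simp: row_insert_Some)
    qed
  qed
next
  case (Suc a)
  show ?case
  proof (cases "bump (T 0) x")
    case None
    then have "bump (T 0 - {m}) x = None" using bump_NoneD by (intro bump_NoneI) auto
    then show ?thesis using None by simp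
  next
    case (Some y)
    note y = bump_SomeD[OF Some]
    have T: "T 0 \<inter> \<Union>(range (\<lambda>a. T (Suc a))) = {}" "tableau (\<lambda>a. T (Suc a))"
      using Suc.prems(1) unfolding tableau_rec[of T] by auto
    show ?thesis
    proof (cases "y = m")
      case True
      then have "bump (T 0 - {m}) x = None" using y Suc.prems(2) by (intro bump_NoneI) force
      moreover have "tab_insert (\<lambda>a. T (Suc a)) m a - {m} = T (Suc a) - {m}"
        using Suc.prems(2) by (subst tab_insert_greatest) auto
      ultimately show ?thesis using Some True by simp
    next
      case False
      then have "bump (T 0 - {m}) x = Some y" using y by (intro bump_SomeI) auto
      moreover have "y < m" using False y Suc.prems(2) by (simp add: order.strict_iff_order)
      moreover have "y \<notin> \<Union>(range (\<lambda>a. T (Suc a)))" using T y by blast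
      ultimately show ?thesis
        using Some Suc.IH[of "\<lambda>a. T (Suc a)" y] T(2) Suc.prems(2) by simp
    qed
  qed
qed

section \<open>Knuth equivalence and Schensted's theorem\<close>

inductive knuth :: "nat list \<Rightarrow> nat list \<Rightarrow> bool" where
  knuth_refl: "knuth w w"
| knuth_sym: "knuth v w \<Longrightarrow> knuth w v"
| knuth_trans: "knuth u v \<Longrightarrow> knuth v w \<Longrightarrow> knuth u w"
| knuth_yxz: "x < y \<Longrightarrow> y < z \<Longrightarrow> knuth (u @ [y, x, z] @ v) (u @ [y, z, x] @ v)"
| knuth_xzy: "x < y \<Longrightarrow> y < z \<Longrightarrow> knuth (u @ [x, z, y] @ v) (u @ [z, x, y] @ v)"

text \<open>The length is exact, but by \<open>has_chain_mono\<close> every shorter length occurs as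
  well, so this says that the longest \<open>R\<close>-chain has at least \<open>m\<close>
  letters.\<close>

definition has_chain :: "(nat \<Rightarrow> nat \<Rightarrow> bool) \<Rightarrow> nat \<Rightarrow> nat list \<Rightarrow> bool" where
  "has_chain R m w \<longleftrightarrow> (\<exists>s. subseq s w \<and> sorted_wrt R s \<and> length s = m)"

text \<open>A chain meets the window \<open>p\<close> in a chain \<open>s\<close>. It is enough to
  find in \<open>q\<close> a chain of the same length that fits between all neighbours between which
  \<open>s\<close> fits.\<close>

lemma has_chain_replace_middle:
  assumes "has_chain R m (u @ p @ v)"
    and "\<And>s. subseq s p \<Longrightarrow> sorted_wrt R s \<Longrightarrow>
      \<exists>t. subseq t q \<and> sorted_wrt R t \<and> length t = length s \<and>
        (\<forall>e. (\<forall>x\<in>set s. R e x) \<longrightarrow> (\<forall>x\<in>set t. R e x)) \<and>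
        (\<forall>e. (\<forall>x\<in>set s. R x e) \<longrightarrow> (\<forall>x\<in>set t. R x e))"
  shows "has_chain R m (u @ q @ v)"
proof -
  obtain s where s: "subseq s (u @ p @ v)" "sorted_wrt R s" "length s = m"
    using assms(1) by (auto simp: has_chain_def)
  obtain s1 s' where s': "s = s1 @ s'" "subseq s1 u" "subseq s' (p @ v)"
    using s(1) by (auto elim: subseq_appendE)
  obtain s2 s3 where s3: "s' = s2 @ s3" "subseq s2 p" "subseq s3 v"
    using s'(3) by (auto elim: subseq_appendE)
  have sw: "sorted_wrt R s1" "sorted_wrt R s2" "sorted_wrt R s3"
    "\<forall>e\<in>set s1. \<forall>x\<in>set s2. R e x" "\<forall>e\<in>set s3. \<forall>x\<in>set s2. R x e"
    "\<forall>e\<in>set s1. \<forall>x\<in>set s3. R e x"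
    using s(2) s' s3 by (auto simp: sorted_wrt_append)
  from assms(2)[OF s3(2) sw(2)] obtain t where t: "subseq t q" "sorted_wrt R t"
    "length t = length s2" "\<forall>e. (\<forall>x\<in>set s2. R e x) \<longrightarrow> (\<forall>x\<in>set t. R e x)"
    "\<forall>e. (\<forall>x\<in>set s2. R x e) \<longrightarrow> (\<forall>x\<in>set t. R x e)" by blast
  have st: "\<forall>e\<in>set s1. \<forall>x\<in>set t. R e x" "\<forall>x\<in>set t. \<forall>e\<in>set s3. R x e"
    using t(4,5) sw(4,5) by blast+
  have "subseq (s1 @ t @ s3) (u @ q @ v)"
    using s'(2) t(1) s3(3) by (intro list_emb_append_mono)
  moreover have "sorted_wrt R (s1 @ t @ s3)"
    using sw(1,3,6) t(2) st by (simp add: sorted_wrt_append ball_Un)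
  moreover have "length (s1 @ t @ s3) = m" using s(3) s'(1) s3(1) t(3) by simp
  ultimately show ?thesis unfolding has_chain_def by blast
qed

lemma subseq3_cases:
  assumes "subseq s [a, b, c]"
  shows "s \<in> {[], [a], [b], [c], [a, b], [a, c], [b, c], [a, b, c]}"
proof -
  have "s \<in> set (subseqs [a, b, c])" using assms by (simp only: in_set_subseqs)
  then show ?thesis by (auto simp: Let_def simp del: in_set_subseqs)
qed

text \<open>The only increasing pair of a window that a move can destroy is formed by
  \<open>x\<close> and \<open>z\<close>. Replacing the one of them that has changed sides with the
  other by \<open>y\<close>, which lies between them, repairs the chain.\<close>

lemma knuth_inc:
  "knuth v w \<Longrightarrow> has_chain (<) m v \<longleftrightarrow> has_chain (<) m w"
proof (induction rule: knuth.induct)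
  case (knuth_yxz x y z u v)
  show ?case
  proof
    assume "has_chain (<) m (u @ [y, x, z] @ v)"
    then show "has_chain (<) m (u @ [y, z, x] @ v)"
    proof (rule has_chain_replace_middle)
      fix s :: "nat list" assume s: "subseq s [y, x, z]" "sorted_wrt (<) s"
      show "\<exists>t. subseq t [y, z, x] \<and> sorted_wrt (<) t \<and> length t = length s \<and>
        (\<forall>e. (\<forall>x\<in>set s. e < x) \<longrightarrow> (\<forall>x\<in>set t. e < x)) \<and>
        (\<forall>e. (\<forall>x\<in>set s. x < e) \<longrightarrow> (\<forall>x\<in>set t. x < e))"
        using subseq3_cases[OF s(1)] s(2) knuth_yxz
        by (intro exI[of _ "if s = [x, z] then [y, z] else s"]) auto
    qed
  next
    assume "has_chain (<) m (u @ [y, z, x] @ v)"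
    then show "has_chain (<) m (u @ [y, x, z] @ v)"
    proof (rule has_chain_replace_middle)
      fix s :: "nat list" assume s: "subseq s [y, z, x]" "sorted_wrt (<) s"
      show "\<exists>t. subseq t [y, x, z] \<and> sorted_wrt (<) t \<and> length t = length s \<and>
        (\<forall>e. (\<forall>x\<in>set s. e < x) \<longrightarrow> (\<forall>x\<in>set t. e < x)) \<and>
        (\<forall>e. (\<forall>x\<in>set s. x < e) \<longrightarrow> (\<forall>x\<in>set t. x < e))"
        using subseq3_cases[OF s(1)] s(2) knuth_yxz
        by (intro exI[of _ s]) auto
    qed
  qed
next
  case (knuth_xzy x y z u v)
  show ?case
  proof
    assume "has_chain (<) m (u @ [x, z, y] @ v)"
    then show "has_chain (<) m (u @ [z, x, y] @ v)"
    proof (rule has_chain_replace_middle)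
      fix s :: "nat list" assume s: "subseq s [x, z, y]" "sorted_wrt (<) s"
      show "\<exists>t. subseq t [z, x, y] \<and> sorted_wrt (<) t \<and> length t = length s \<and>
        (\<forall>e. (\<forall>x\<in>set s. e < x) \<longrightarrow> (\<forall>x\<in>set t. e < x)) \<and>
        (\<forall>e. (\<forall>x\<in>set s. x < e) \<longrightarrow> (\<forall>x\<in>set t. x < e))"
        using subseq3_cases[OF s(1)] s(2) knuth_xzy
        by (intro exI[of _ "if s = [x, z] then [x, y] else s"]) auto
    qed
  next
    assume "has_chain (<) m (u @ [z, x, y] @ v)"
    then show "has_chain (<) m (u @ [x, z, y] @ v)"
    proof (rule has_chain_replace_middle)
      fix s :: "nat list" assume s: "subseq s [z, x, y]" "sorted_wrt (<) s"
      show "\<exists>t. subseq t [x, z, y] \<and> sorted_wrt (<) t \<and> length t = length s \<and>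
        (\<forall>e. (\<forall>x\<in>set s. e < x) \<longrightarrow> (\<forall>x\<in>set t. e < x)) \<and>
        (\<forall>e. (\<forall>x\<in>set s. x < e) \<longrightarrow> (\<forall>x\<in>set t. x < e))"
        using subseq3_cases[OF s(1)] s(2) knuth_xzy
        by (intro exI[of _ s]) auto
    qed
  qed
qed auto

text \<open>Here the pair at risk is \<open>z\<close>, \<open>x\<close>, which exists only after the
  move; in the original window \<open>y\<close> takes the place of one of its letters.\<close>

lemma knuth_dec:
  "knuth v w \<Longrightarrow> has_chain (>) m v \<longleftrightarrow> has_chain (>) m w"
proof (induction rule: knuth.induct)
  case (knuth_yxz x y z u v)
  show ?case
  proof
    assume "has_chain (>) m (u @ [y, x, z] @ v)"
    then show "has_chain (>) m (u @ [y, z, x] @ v)"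
    proof (rule has_chain_replace_middle)
      fix s :: "nat list" assume s: "subseq s [y, x, z]" "sorted_wrt (>) s"
      show "\<exists>t. subseq t [y, z, x] \<and> sorted_wrt (>) t \<and> length t = length s \<and>
        (\<forall>e. (\<forall>x\<in>set s. e > x) \<longrightarrow> (\<forall>x\<in>set t. e > x)) \<and>
        (\<forall>e. (\<forall>x\<in>set s. x > e) \<longrightarrow> (\<forall>x\<in>set t. x > e))"
        using subseq3_cases[OF s(1)] s(2) knuth_yxz
        by (intro exI[of _ s]) auto
    qed
  next
    assume "has_chain (>) m (u @ [y, z, x] @ v)"
    then show "has_chain (>) m (u @ [y, x, z] @ v)"
    proof (rule has_chain_replace_middle)
      fix s :: "nat list" assume s: "subseq s [y, z, x]" "sorted_wrt (>) s"
      show "\<exists>t. subseq t [y, x, z] \<and> sorted_wrt (>) t \<and> length t = length s \<and>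
        (\<forall>e. (\<forall>x\<in>set s. e > x) \<longrightarrow> (\<forall>x\<in>set t. e > x)) \<and>
        (\<forall>e. (\<forall>x\<in>set s. x > e) \<longrightarrow> (\<forall>x\<in>set t. x > e))"
        using subseq3_cases[OF s(1)] s(2) knuth_yxz
        by (intro exI[of _ "if s = [z, x] then [y, x] else s"]) auto
    qed
  qed
next
  case (knuth_xzy x y z u v)
  show ?case
  proof
    assume "has_chain (>) m (u @ [x, z, y] @ v)"
    then show "has_chain (>) m (u @ [z, x, y] @ v)"
    proof (rule has_chain_replace_middle)
      fix s :: "nat list" assume s: "subseq s [x, z, y]" "sorted_wrt (>) s"
      show "\<exists>t. subseq t [z, x, y] \<and> sorted_wrt (>) t \<and> length t = length s \<and>
        (\<forall>e. (\<forall>x\<in>set s. e > x) \<longrightarrow> (\<forall>x\<in>set t. e > x)) \<and>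
        (\<forall>e. (\<forall>x\<in>set s. x > e) \<longrightarrow> (\<forall>x\<in>set t. x > e))"
        using subseq3_cases[OF s(1)] s(2) knuth_xzy
        by (intro exI[of _ s]) auto
    qed
  next
    assume "has_chain (>) m (u @ [z, x, y] @ v)"
    then show "has_chain (>) m (u @ [x, z, y] @ v)"
    proof (rule has_chain_replace_middle)
      fix s :: "nat list" assume s: "subseq s [z, x, y]" "sorted_wrt (>) s"
      show "\<exists>t. subseq t [x, z, y] \<and> sorted_wrt (>) t \<and> length t = length s \<and>
        (\<forall>e. (\<forall>x\<in>set s. e > x) \<longrightarrow> (\<forall>x\<in>set t. e > x)) \<and>
        (\<forall>e. (\<forall>x\<in>set s. x > e) \<longrightarrow> (\<forall>x\<in>set t. x > e))"
        using subseq3_cases[OF s(1)] s(2) knuth_xzy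
        by (intro exI[of _ "if s = [z, x] then [z, y] else s"]) auto
    qed
  qed
qed auto

section \<open>Row insertion as a sequence of Knuth moves\<close>

lemma knuth_append: "knuth v w \<Longrightarrow> knuth (p @ v @ q) (p @ w @ q)"
proof (induction rule: knuth.induct)
  case (knuth_yxz x y z u v)
  then show ?case using knuth.knuth_yxz[of x y z "p @ u" "v @ q"] by simp
next
  case (knuth_xzy x y z u v)
  then show ?case using knuth.knuth_xzy[of x y z "p @ u" "v @ q"] by simp
next
  case (knuth_trans u v w)
  then show ?case using knuth.knuth_trans by blast
qed (simp_all add: knuth.knuth_refl knuth.knuth_sym)

text \<open>The letter \<open>x\<close> passes the letters of \<open>v\<close> one at a time from
  the right. The letter \<open>p\<close> in front of the passed letter \<open>b\<close> is the
  witness: x < p < b.\<close>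

lemma knuth_slide_left:
  assumes "\<forall>b\<in>set v. z < b" "sorted_wrt (<) v" "x < z"
  shows "knuth (z # v @ [x]) (z # x # v)"
  using assms
proof (induction v rule: rev_induct)
  case (snoc b v)
  define p where "p = last (z # v)"
  have p: "z # v = butlast (z # v) @ [p]" by (simp add: p_def)
  have "p \<in> set (z # v)" unfolding p_def by (intro last_in_set) simp
  then have "x < p" "p < b" using snoc.prems by (auto simp: sorted_wrt_append)
  then have "knuth (butlast (z # v) @ [p, b, x] @ []) (butlast (z # v) @ [p, x, b] @ [])"
    by (intro knuth_sym[OF knuth_yxz])
  then have 1: "knuth (z # (v @ [b]) @ [x]) ((z # v) @ [x, b])"
    using p by (metis append.assoc append_Cons append_Nil append_Nil2)
  have "knuth (z # v @ [x]) (z # x # v)" using snoc by (auto simp: sorted_wrt_append)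
  from knuth_append[OF this, of "[]" "[b]"] have "knuth ((z # v) @ [x, b]) (z # x # v @ [b])" by simp
  with 1 have "knuth (z # (v @ [b]) @ [x]) (z # x # v @ [b])" by (rule knuth_trans)
  then show ?case .
qed (auto intro: knuth_refl)

text \<open>The letter \<open>z\<close> passes the letters of \<open>u\<close> from the right. The
  letter behind \<open>z\<close> is the witness, and each passed letter is the witness for the next
  move.\<close>

lemma knuth_slide_front:
  assumes "\<forall>a\<in>set u. a < x" "sorted_wrt (<) u" "x < z"
  shows "knuth (u @ z # x # v) (z # u @ x # v)"
  using assms
proof (induction u arbitrary: x v rule: rev_induct)
  case (snoc q u)
  have "knuth (u @ [q, z, x] @ v) (u @ [z, q, x] @ v)"
    using snoc.prems by (intro knuth_xzy) auto
  moreover have "knuth (u @ z # q # x # v) (z # u @ q # x # v)"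
    using snoc.prems by (intro snoc.IH) (auto simp: sorted_wrt_append)
  ultimately have "knuth (u @ [q, z, x] @ v) (z # u @ q # x # v)"
    using knuth_trans by simp
  then show ?case by simp
qed (auto intro: knuth_refl)

text \<open>The row is \<open>u\<close>, \<open>y\<close>, \<open>v\<close> with \<open>u\<close>
  below \<open>x\<close> and \<open>v\<close> above \<open>y\<close>. First \<open>x\<close> slides
  left over \<open>v\<close> to the place behind \<open>y\<close>, then \<open>y\<close> slides out
  to the front over \<open>u\<close>.\<close>

lemma knuth_row_insert:
  assumes "finite R" "x \<notin> R" "bump R x = Some y"
  shows "knuth (sorted_list_of_set R @ [x]) (y # sorted_list_of_set (row_insert R x))"
proof -
  note y = bump_SomeD[OF assms(3)]
  define u where "u = sorted_list_of_set (R \<inter> {..<x})"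
  define v where "v = sorted_list_of_set (R \<inter> {y<..})"
  have u: "set u = R \<inter> {..<x}" "sorted_wrt (<) u" and v: "set v = R \<inter> {y<..}" "sorted_wrt (<) v"
    using assms(1) by (auto simp: u_def v_def)
  have nx: "z = y \<or> z < x \<or> y < z" if "z \<in> R" for z
    using y(3)[OF that] that assms(2) by (metis nat_less_le)
  have R: "sorted_list_of_set R = u @ y # v"
  proof (rule sorted_list_of_set_unique[THEN iffD1, OF assms(1)], intro conjI)
    show "sorted_wrt (<) (u @ y # v)" using u v y by (auto simp: sorted_wrt_append)
    show "set (u @ y # v) = R" using u v y nx by auto
    then have "card R = card (set (u @ y # v))" by simp
    also have "\<dots> = length (u @ y # v)"
      using \<open>sorted_wrt (<) (u @ y # v)\<close> strict_sorted_iff distinct_card by blast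
    finally show "length (u @ y # v) = card R" by simp
  qed
  have R': "sorted_list_of_set (row_insert R x) = u @ x # v"
  proof (rule sorted_list_of_set_unique[THEN iffD1], goal_cases)
    case 1 show ?case using assms(1) by (simp add: row_insert_def)
  next
    case 2
    have s: "sorted_wrt (<) (u @ x # v)" using u v y by (auto simp: sorted_wrt_append)
    have S: "set (u @ x # v) = row_insert R x"
      using u v y nx by (auto simp: row_insert_Some[OF assms(3)])
    then have "card (row_insert R x) = length (u @ x # v)"
      using s strict_sorted_iff distinct_card by metis
    with s S show ?case by simp
  qed
  have "knuth (y # v @ [x]) (y # x # v)" using v y(2) by (intro knuth_slide_left) auto
  from knuth_append[OF this, of u "[]"] have "knuth (u @ y # v @ [x]) (u @ y # x # v)" by simp
  moreover have "knuth (u @ y # x # v) (y # u @ x # v)"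
    using u y(2) by (intro knuth_slide_front) auto
  ultimately have "knuth (u @ y # v @ [x]) (y # u @ x # v)" by (rule knuth_trans)
  then show ?thesis using R R' by simp
qed

text \<open>The reading word takes the last row first and row 0 at the end, so that a letter
  appended on the right meets row 0.\<close>

primrec row_word :: "(nat \<Rightarrow> nat set) \<Rightarrow> nat \<Rightarrow> nat list" where
  "row_word T 0 = []"
| "row_word T (Suc N) = row_word (\<lambda>a. T (Suc a)) N @ sorted_list_of_set (T 0)"

lemma row_word_Suc: "T N = {} \<Longrightarrow> row_word T (Suc N) = row_word T N"
  by (induction N arbitrary: T) auto

text \<open>Row 0 releases the bumped entry on its left, which is the right end of the word of the
  lower rows; there the induction hypothesis inserts it.\<close>

lemma knuth_tab_insert:
  assumes "\<And>a. a \<ge> N \<Longrightarrow> T a = {}" "tableau T" "x \<notin> \<Union>(range T)"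
  shows "knuth (row_word T N @ [x]) (row_word (tab_insert T x) (Suc N))"
  using assms
proof (induction N arbitrary: T x)
  case 0
  then have T: "T = (\<lambda>_. {})" by auto
  then show ?case by (simp add: row_insert_def knuth_refl)
next
  case (Suc N)
  have T: "finite (T 0)" "T 0 \<inter> \<Union>(range (\<lambda>a. T (Suc a))) = {}" "tableau (\<lambda>a. T (Suc a))"
    using Suc.prems(2) unfolding tableau_rec[of T] by auto
  have x: "x \<notin> T 0" "x \<notin> \<Union>(range (\<lambda>a. T (Suc a)))"
    using Suc.prems(3) by (auto simp: UN_shift[of T])
  show ?case
  proof (cases "bump (T 0) x")
    case None
    have "sorted_list_of_set (insert x (T 0)) = sorted_list_of_set (T 0) @ [x]"
    proof (rule sorted_list_of_set_unique[THEN iffD1], goal_cases)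
      case 2
      have "y < x" if "y \<in> T 0" for y
        using bump_NoneD[OF None that] that x(1) by (metis nat_less_le)
      then show ?case using T(1) x(1) by (auto simp: sorted_wrt_append)
    qed (use T in simp)
    moreover have "row_word (\<lambda>a. T (Suc a)) (Suc N) = row_word (\<lambda>a. T (Suc a)) N"
      using Suc.prems(1) by (intro row_word_Suc) auto
    ultimately show ?thesis using None
      unfolding row_word.simps(2)[of "tab_insert T x"] tab_insert_shift_None[of T x, OF None]
      by (simp add: row_insert_None knuth_refl del: row_word.simps(2)) (simp add: knuth_refl)
  next
    case (Some y)
    note y = bump_SomeD[OF Some]
    have "knuth (row_word (\<lambda>a. T (Suc a)) N @ [y]) (row_word (tab_insert (\<lambda>a. T (Suc a)) y) (Suc N))"
      using Suc.prems(1) T y by (intro Suc.IH) auto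
    from knuth_append[OF this, of "[]" "sorted_list_of_set (row_insert (T 0) x)"]
    have 1: "knuth (row_word (\<lambda>a. T (Suc a)) N @ y # sorted_list_of_set (row_insert (T 0) x))
      (row_word (tab_insert T x) (Suc (Suc N)))"
      unfolding row_word.simps(2)[of "tab_insert T x"] tab_insert_shift_Some[of T x, OF Some]
      by (simp del: row_word.simps(2))
    have "knuth (row_word T (Suc N) @ [x])
      (row_word (\<lambda>a. T (Suc a)) N @ y # sorted_list_of_set (row_insert (T 0) x))"
      using knuth_append[OF knuth_row_insert[OF T(1) x(1) Some], of "row_word (\<lambda>a. T (Suc a)) N" "[]"]
      by simp
    with 1 show ?thesis by (rule knuth_trans[rotated])
  qed
qed

section \<open>Monotone subsequences of reading words\<close>

lemma tableau_card_mono: "tableau T \<Longrightarrow> a \<le> b \<Longrightarrow> card (T b) \<le> card (T a)"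
proof (induction b)
  case (Suc b)
  show ?case
  proof (cases "a = Suc b")
    case False
    define v where "v = Max (insert 0 (T (Suc b) \<union> T b))"
    have fin: "finite (T (Suc b))" "finite (T b)" using Suc.prems tableau_finite by auto
    then have "\<And>x. x \<in> T (Suc b) \<union> T b \<Longrightarrow> x \<le> v" unfolding v_def by (intro Max_ge) auto
    then have "T (Suc b) \<inter> {..v} = T (Suc b)" "T b \<inter> {..v} = T b" by auto
    moreover have "card (T (Suc b) \<inter> {..v}) \<le> card (T b \<inter> {..v})"
      using Suc.prems by (auto simp: tableau_def)
    ultimately show ?thesis using Suc False by simp
  qed simp
qed simp

lemma tableau_nonempty_mono: "tableau T \<Longrightarrow> a \<le> b \<Longrightarrow> T b \<noteq> {} \<Longrightarrow> T a \<noteq> {}"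
  using tableau_card_mono[of T a b] tableau_finite[of T b] by (auto simp: card_gt_0_iff)

lemma subseq_set: "subseq xs ys \<Longrightarrow> set xs \<subseteq> set ys"
  by (induction rule: list_emb.induct) auto

lemma sorted_wrt_subseq: "subseq xs ys \<Longrightarrow> sorted_wrt R ys \<Longrightarrow> sorted_wrt R xs"
proof (induction rule: list_emb.induct)
  case (list_emb_Cons2 x y xs ys)
  then show ?case using subseq_set[of xs ys] by auto
qed auto

lemma has_chain_mono: "has_chain R m w \<Longrightarrow> l \<le> m \<Longrightarrow> has_chain R l w"
proof -
  assume "has_chain R m w" "l \<le> m"
  then obtain s where s: "subseq s w" "sorted_wrt R s" "length s = m"
    by (auto simp: has_chain_def)
  have "subseq (take l s) w"
    using s(1) subseq_order.trans[OF prefix_imp_subseq[OF take_is_prefix]] by blast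
  then show ?thesis unfolding has_chain_def using s \<open>l \<le> m\<close>
    by (intro exI[of _ "take l s"]) (auto intro: sorted_wrt_take)
qed

text \<open>Let \<open>u\<close> be the last letter taken from the lower rows. By induction their
  letters are at most as many as the entries up to \<open>u\<close> of row 1, hence of row 0, and
  the letters taken from row 0 exceed \<open>u\<close>. The threshold \<open>v\<close> is there to
  make this induction possible.\<close>

lemma row_word_inc_bound:
  assumes "tableau T" "subseq s (row_word T N)" "sorted_wrt (<) s" "\<forall>x\<in>set s. x \<le> v"
  shows "length s \<le> card (T 0 \<inter> {..v})"
  using assms
proof (induction N arbitrary: T s v)
  case (Suc N)
  have fin: "finite (T 0)" using Suc.prems tableau_finite by auto
  obtain s1 s0 where s: "s = s1 @ s0" "subseq s1 (row_word (\<lambda>a. T (Suc a)) N)"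
    "subseq s0 (sorted_list_of_set (T 0))"
    using Suc.prems(2) by (auto elim: subseq_appendE)
  have s0: "set s0 \<subseteq> T 0" using subseq_set[OF s(3)] fin by simp
  have sw: "sorted_wrt (<) s1" "sorted_wrt (<) s0" "\<forall>x\<in>set s1. \<forall>y\<in>set s0. x < y"
    using Suc.prems(3) s(1) by (auto simp: sorted_wrt_append)
  have l0: "length s0 = card (set s0)" using sw(2) strict_sorted_iff distinct_card by metis
  show ?case
  proof (cases "s1 = []")
    case True
    have "card (set s0) \<le> card (T 0 \<inter> {..v})"
      using s0 Suc.prems(4) s(1) fin by (intro card_mono) auto
    then show ?thesis using True s(1) l0 by simp
  next
    case False
    define u where "u = last s1"
    have u: "u \<in> set s1" using False by (simp add: u_def)
    have "s1 = butlast s1 @ [u]" using False by (simp add: u_def)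
    then have "sorted_wrt (<) (butlast s1 @ [u])" "set s1 = set (butlast s1 @ [u])"
      using sw(1) by metis+
    then have "\<forall>x\<in>set s1. x \<le> u" by (auto simp: sorted_wrt_append)
    then have "length s1 \<le> card (T 1 \<inter> {..u})"
      using Suc.IH[of "\<lambda>a. T (Suc a)" s1 u] s(2) sw(1) tableau_shift[OF Suc.prems(1)] by simp
    also have "\<dots> \<le> card (T 0 \<inter> {..u})"
      using Suc.prems(1) unfolding tableau_rec[of T] by blast
    finally have "length s \<le> card (T 0 \<inter> {..u}) + card (set s0)" using s(1) l0 by simp
    also have "\<dots> = card (T 0 \<inter> {..u} \<union> set s0)"
      using sw(3) u fin by (intro card_Un_disjoint[symmetric]) force+
    also have "\<dots> \<le> card (T 0 \<inter> {..v})"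
    proof (rule card_mono)
      have "u \<le> v" "\<forall>x\<in>set s0. x \<le> v" using Suc.prems(4) s(1) u by auto
      then show "T 0 \<inter> {..u} \<union> set s0 \<subseteq> T 0 \<inter> {..v}" using s0 by auto
    qed (use fin in simp)
    finally show ?thesis .
  qed
qed (auto dest: list_emb_Nil2)

text \<open>Each row is read in increasing order, so a decreasing subsequence takes at most one
  letter from it.\<close>

lemma row_word_dec_bound:
  assumes "tableau T" "subseq s (row_word T N)" "sorted_wrt (>) s" "length s = Suc m"
  shows "T m \<noteq> {}"
  using assms
proof (induction N arbitrary: T s m)
  case (Suc N)
  have fin: "finite (T 0)" using Suc.prems tableau_finite by auto
  obtain s1 s0 where s: "s = s1 @ s0" "subseq s1 (row_word (\<lambda>a. T (Suc a)) N)"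
    "subseq s0 (sorted_list_of_set (T 0))"
    using Suc.prems(2) by (auto elim: subseq_appendE)
  have s0: "set s0 \<subseteq> T 0" using subseq_set[OF s(3)] fin by simp
  have sw: "sorted_wrt (>) s1" "sorted_wrt (>) s0"
    using Suc.prems(3) s(1) by (auto simp: sorted_wrt_append)
  have inc: "sorted_wrt (<) s0"
    using s(3) by (metis sorted_wrt_subseq strict_sorted_list_of_set)
  have "length s0 \<le> 1"
  proof (cases s0)
    case (Cons x xs)
    then show ?thesis using sw(2) inc by (cases xs) auto
  qed simp
  show ?case
  proof (cases "length s1")
    case 0
    then have "m = 0" "s0 \<noteq> []" using s(1) Suc.prems(4) \<open>length s0 \<le> 1\<close> by auto
    then show ?thesis using s0 by (cases s0) auto
  next
    case (Suc l)
    then have "T (Suc l) \<noteq> {}"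
      using Suc.IH[of "\<lambda>a. T (Suc a)" s1 l] s(2) sw(1) tableau_shift[OF Suc.prems(1)] by simp
    moreover have "m \<le> Suc l" using Suc s(1) Suc.prems(4) \<open>length s0 \<le> 1\<close> by simp
    ultimately show ?thesis using tableau_nonempty_mono Suc.prems(1) by blast
  qed
qed (auto dest: list_emb_Nil2)

text \<open>The first column, read from below, is such a subsequence: the minima of the rows
  decrease towards row 0. The last conjunct is what lets the minimum of the next higher row be
  appended.\<close>

lemma row_word_dec_ex:
  assumes "tableau T" "T m \<noteq> {}" "m < N"
  shows "\<exists>s. subseq s (row_word T N) \<and> sorted_wrt (>) s \<and> length s = Suc m \<and>
    (\<forall>x\<in>set s. Min (T 0) \<le> x)"
  using assms
proof (induction m arbitrary: T N)
  case 0
  then obtain N' where N: "N = Suc N'" by (cases N) auto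
  have fin: "finite (T 0)" using 0 tableau_finite by auto
  then have "Min (T 0) \<in> set (sorted_list_of_set (T 0))" using 0 by simp
  then have "subseq [Min (T 0)] (row_word T N)" unfolding N by (simp add: subseq_singleton_left)
  then show ?case by (intro exI[of _ "[Min (T 0)]"]) simp
next
  case (Suc m)
  then obtain N' where N: "N = Suc N'" "m < N'" by (cases N) auto
  have fin: "finite (T 0)" "finite (T 1)" using Suc tableau_finite by auto
  have ne: "T 0 \<noteq> {}" "T 1 \<noteq> {}"
    using tableau_nonempty_mono[OF Suc.prems(1), of _ "Suc m"] Suc.prems(2) by auto
  from Suc.IH[of "\<lambda>a. T (Suc a)" N'] Suc.prems N(2) tableau_shift obtain s where
    s: "subseq s (row_word (\<lambda>a. T (Suc a)) N')" "sorted_wrt (>) s" "length s = Suc m"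
    "\<forall>x\<in>set s. Min (T 1) \<le> x" by auto
  have "Min (T 1) \<in> T 1 \<inter> {..Min (T 1)}" using Min_in[OF fin(2) ne(2)] by simp
  then have "0 < card (T 1 \<inter> {..Min (T 1)})" using fin by (subst card_gt_0_iff) blast
  also have "\<dots> \<le> card (T 0 \<inter> {..Min (T 1)})"
    using Suc.prems(1) unfolding tableau_rec[of T] by blast
  finally obtain z where z: "z \<in> T 0" "z \<le> Min (T 1)" by (auto simp: card_gt_0_iff)
  have "T 0 \<inter> T 1 = {}" using Suc.prems(1) unfolding tableau_def disjoint_family_on_def by force
  then have "z \<noteq> Min (T 1)" using z(1) Min_in[OF fin(2) ne(2)] by auto
  moreover have "Min (T 0) \<le> z" using z(1) fin by simp
  ultimately have lt: "Min (T 0) < Min (T 1)" using z(2) by simp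
  have "subseq (s @ [Min (T 0)]) (row_word T N)"
    unfolding N(1) row_word.simps using s(1) fin ne
    by (intro list_emb_append_mono) (auto simp: subseq_singleton_left)
  moreover have "sorted_wrt (>) (s @ [Min (T 0)])"
    using s(2,4) lt by (auto simp: sorted_wrt_append)
  moreover have "length (s @ [Min (T 0)]) = Suc (Suc m)" using s(3) by simp
  moreover have "\<forall>x\<in>set (s @ [Min (T 0)]). Min (T 0) \<le> x" using s(4) lt by force
  ultimately show ?case by blast
qed

section \<open>Schensted's theorem\<close>

definition insertion_tableau :: "nat list \<Rightarrow> nat \<Rightarrow> nat set" where
  "insertion_tableau w = foldl tab_insert (\<lambda>_. {}) w"

lemma insertion_tableau_snoc:
  "insertion_tableau (w @ [x]) = tab_insert (insertion_tableau w) x"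
  by (simp add: insertion_tableau_def)

lemma insertion_tableau_aux:
  "distinct w \<Longrightarrow> tableau (insertion_tableau w) \<and> \<Union>(range (insertion_tableau w)) = set w \<and>
    (\<exists>N. (\<forall>a\<ge>N. insertion_tableau w a = {}) \<and> knuth w (row_word (insertion_tableau w) N))"
proof (induction w rule: rev_induct)
  case Nil
  have "row_word (\<lambda>_. {}) 0 = []" by simp
  then show ?case using tableau_empty knuth_refl[of "[]"]
    by (auto simp: insertion_tableau_def intro!: exI[of _ 0])
next
  case (snoc x w)
  let ?T = "insertion_tableau w"
  have IH: "tableau ?T" "\<Union>(range ?T) = set w" using snoc by auto
  obtain N where N: "\<And>a. a \<ge> N \<Longrightarrow> ?T a = {}" "knuth w (row_word ?T N)" using snoc by auto
  have x: "x \<notin> \<Union>(range ?T)" using IH snoc.prems by simp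
  have "knuth (w @ [x]) (row_word ?T N @ [x])" using knuth_append[OF N(2), of "[]" "[x]"] by simp
  then have "knuth (w @ [x]) (row_word (tab_insert ?T x) (Suc N))"
    using knuth_tab_insert[OF N(1) IH(1) x] by (rule knuth_trans)
  moreover have "\<forall>a\<ge>Suc N. tab_insert ?T x a = {}" using tab_insert_eventually[of N ?T] N(1) by simp
  ultimately show ?case using tableau_insert[OF IH(1) x] IH(2)
    unfolding insertion_tableau_snoc by (intro conjI exI[of _ "Suc N"]) (simp_all del: row_word.simps)
qed

lemma tableau_insertion_tableau: "distinct w \<Longrightarrow> tableau (insertion_tableau w)"
  and entries_insertion_tableau: "distinct w \<Longrightarrow> \<Union>(range (insertion_tableau w)) = set w"
  using insertion_tableau_aux by auto

text \<open>Knuth equivalence replaces the word by the reading word of its tableau, where row 0 is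
  an increasing subsequence of the greatest possible length.\<close>

lemma schensted_inc:
  assumes "distinct w"
  shows "has_chain (<) m w \<longleftrightarrow> m \<le> card (insertion_tableau w 0)"
proof -
  let ?T = "insertion_tableau w"
  obtain N where T: "tableau ?T" and N: "\<forall>a\<ge>N. ?T a = {}" "knuth w (row_word ?T N)"
    using insertion_tableau_aux[OF assms] by blast
  have fin: "finite (?T 0)" using T tableau_finite by blast
  have "m \<le> card (?T 0)" if "has_chain (<) m (row_word ?T N)"
  proof -
    obtain s where s: "subseq s (row_word ?T N)" "sorted_wrt (<) s" "length s = m"
      using \<open>has_chain (<) m (row_word ?T N)\<close> by (auto simp: has_chain_def)
    have "length s \<le> card (?T 0 \<inter> {..Max (insert 0 (set s))})"
      using s by (intro row_word_inc_bound[OF T s(1,2)]) auto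
    also have "\<dots> \<le> card (?T 0)" using fin by (intro card_mono) auto
    finally show ?thesis using s(3) by simp
  qed
  moreover have "has_chain (<) m (row_word ?T N)" if "m \<le> card (?T 0)"
  proof (cases N)
    case 0
    then show ?thesis using that N(1) by (auto simp: has_chain_def)
  next
    case (Suc N')
    have "has_chain (<) (card (?T 0)) (row_word ?T N)"
      unfolding has_chain_def Suc using fin
      by (intro exI[of _ "sorted_list_of_set (?T 0)"]) auto
    then show ?thesis using has_chain_mono that by blast
  qed
  ultimately show ?thesis using knuth_inc[OF N(2)] by blast
qed

text \<open>Rows are numbered from 0, so a nonempty row \<open>m\<close> means at least
  \<open>Suc m\<close> rows.\<close>

lemma schensted_dec:
  assumes "distinct w"
  shows "has_chain (>) (Suc m) w \<longleftrightarrow> insertion_tableau w m \<noteq> {}"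
proof -
  let ?T = "insertion_tableau w"
  obtain N where T: "tableau ?T" and N: "\<forall>a\<ge>N. ?T a = {}" "knuth w (row_word ?T N)"
    using insertion_tableau_aux[OF assms] by blast
  have "has_chain (>) (Suc m) (row_word ?T N) \<longleftrightarrow> ?T m \<noteq> {}"
    using row_word_dec_bound[OF T, of _ N m] row_word_dec_ex[OF T, of m N] N(1)
    unfolding has_chain_def by (metis not_less)
  then show ?thesis using knuth_dec[OF N(2)] by blast
qed

text \<open>Deletion can therefore act on the tableau alone, without the word it came from.\<close>

lemma insertion_tableau_delete_greatest:
  assumes "distinct w" "\<forall>x\<in>set w. x \<le> m"
  shows "insertion_tableau (filter (\<lambda>x. x \<noteq> m) w) a = insertion_tableau w a - {m}"
  using assms
proof (induction w arbitrary: a rule: rev_induct)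
  case Nil
  then show ?case by (simp add: insertion_tableau_def)
next
  case (snoc x w)
  let ?T = "insertion_tableau w"
  have T: "tableau ?T" "\<Union>(range ?T) = set w"
    using snoc.prems tableau_insertion_tableau entries_insertion_tableau by auto
  have le: "y \<le> m" if "y \<in> ?T b" for y b using that T(2) snoc.prems(2) by auto
  show ?case
  proof (cases "x = m")
    case True
    then have "m \<notin> set w" using snoc.prems by simp
    then have "filter (\<lambda>x. x \<noteq> m) w = w" "\<And>a. m \<notin> ?T a" using T(2) by (auto intro: filter_True)
    then show ?thesis using True le
      by (auto simp: insertion_tableau_snoc tab_insert_greatest)
  next
    case False
    then have "x < m" using snoc.prems(2) by (simp add: nat_less_le)
    moreover have "insertion_tableau (filter (\<lambda>x. x \<noteq> m) w) = (\<lambda>a. ?T a - {m})"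
      using snoc by auto
    ultimately show ?thesis
      using tab_insert_delete_greatest[of ?T m x a, OF T(1) le] False T(2) snoc.prems(1)
      by (simp add: insertion_tableau_snoc)
  qed
qed

section \<open>Words of insertions and vacillating sequences of shapes\<close>

text \<open>Families of Young diagrams indexed by colours, as sets of boxes (colour, row, column).\<close>

definition young :: "nat \<Rightarrow> nat \<Rightarrow> nat \<Rightarrow> (nat \<times> nat \<times> nat) set set" where
  "young r p q = {S. S \<subseteq> {..<r} \<times> {..<p} \<times> {..<q} \<and>
     (\<forall>c a b a' b'. (c, a, b) \<in> S \<longrightarrow> a' \<le> a \<longrightarrow> b' \<le> b \<longrightarrow> (c, a', b') \<in> S)}"

definition le_one :: "'a set \<Rightarrow> 'a set \<Rightarrow> bool" where
  "le_one S S' \<longleftrightarrow> S' = S \<or> (\<exists>x. x \<notin> S \<and> S' = insert x S)"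

text \<open>Counts the shape sequences over \<open>m\<close> further times that start with
  \<open>S\<close> and end empty. They are read against the direction of the insertions:
  \<open>S2\<close> loses at most one box and becomes \<open>S1\<close>, which gains at most one box
  and becomes \<open>S\<close>.\<close>

primrec vac_count :: "nat \<Rightarrow> nat \<Rightarrow> nat \<Rightarrow> nat \<Rightarrow> (nat \<times> nat \<times> nat) set \<Rightarrow> nat" where
  "vac_count r p q 0 S = of_bool (S = {})"
| "vac_count r p q (Suc m) S =
     (\<Sum>S1\<in>{S1 \<in> young r p q. le_one S1 S}. \<Sum>S2\<in>{S2 \<in> young r p q. le_one S1 S2}. vac_count r p q m S2)"

definition shape :: "(nat \<Rightarrow> nat \<Rightarrow> nat set) \<Rightarrow> (nat \<times> nat \<times> nat) set" where
  "shape Q = {(c, a, b). b < card (Q c a)}"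

definition delete_entry :: "nat \<Rightarrow> (nat \<Rightarrow> nat \<Rightarrow> nat set) \<Rightarrow> nat \<Rightarrow> nat \<Rightarrow> nat set" where
  "delete_entry m Q = (\<lambda>c a. Q c a - {m})"

definition insert_choice ::
    "(nat \<times> nat) option \<Rightarrow> (nat \<Rightarrow> nat \<Rightarrow> nat set) \<Rightarrow> nat \<Rightarrow> nat \<Rightarrow> nat set" where
  "insert_choice d Q = (case d of None \<Rightarrow> Q | Some (c, i) \<Rightarrow> Q(c := tab_insert (Q c) i))"

text \<open>The opener must be new to all colours since an element opens at most one arc. The arc
  closes at t + 1, whence \<open>i \<le> t\<close>.\<close>

definition choice_ok :: "nat \<Rightarrow> nat \<Rightarrow> (nat \<times> nat) option \<Rightarrow> (nat \<Rightarrow> nat \<Rightarrow> nat set) \<Rightarrow> bool" where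
  "choice_ok r t d Q \<longleftrightarrow>
     (\<forall>c i. d = Some (c, i) \<longrightarrow> c < r \<and> 1 \<le> i \<and> i \<le> t \<and> (\<forall>c a. i \<notin> Q c a))"

text \<open>The bound \<open>t\<close> on the entries makes \<open>Suc t\<close> the greatest
  possible entry when it is deleted, and leaves only the empty state at time 0.\<close>

definition tab_state :: "nat \<Rightarrow> nat \<Rightarrow> nat \<Rightarrow> nat \<Rightarrow> (nat \<Rightarrow> nat \<Rightarrow> nat set) \<Rightarrow> bool" where
  "tab_state r p q t Q \<longleftrightarrow> (\<forall>c. tableau (Q c)) \<and>
     (\<forall>c c' a a'. c \<noteq> c' \<longrightarrow> Q c a \<inter> Q c' a' = {}) \<and> (\<forall>c a. Q c a \<subseteq> {1..t}) \<and>
     shape Q \<subseteq> {..<r} \<times> {..<p} \<times> {..<q}"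

text \<open>The list holds the choices for the times t + 1, t + 2, ...: the colour and the opener of
  the arc closing at that time, if there is one. Time runs backwards.\<close>

primrec word_state :: "nat \<Rightarrow> (nat \<times> nat) option list \<Rightarrow> nat \<Rightarrow> nat \<Rightarrow> nat set" where
  "word_state t [] = (\<lambda>_ _. {})"
| "word_state t (d # ds) = insert_choice d (delete_entry (Suc t) (word_state (Suc t) ds))"

text \<open>The rectangle is demanded after insertions only; a deletion makes the shape
  smaller.\<close>

primrec word_ok :: "nat \<Rightarrow> nat \<Rightarrow> nat \<Rightarrow> nat \<Rightarrow> (nat \<times> nat) option list \<Rightarrow> bool" where
  "word_ok r p q t [] = True"
| "word_ok r p q t (d # ds) \<longleftrightarrow> word_ok r p q (Suc t) ds \<and>
     choice_ok r t d (word_state (Suc t) ds) \<and>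
     shape (word_state t (d # ds)) \<subseteq> {..<r} \<times> {..<p} \<times> {..<q}"

section \<open>Shapes and states under the two half steps\<close>

lemma finite_young: "finite (young r p q)"
  by (rule finite_subset[of _ "Pow ({..<r} \<times> {..<p} \<times> {..<q})"]) (auto simp: young_def)

lemma young_down: "S \<in> young r p q \<Longrightarrow> (c, a, b) \<in> S \<Longrightarrow> a' \<le> a \<Longrightarrow> b' \<le> b \<Longrightarrow> (c, a', b') \<in> S"
  unfolding young_def by blast

lemma shape_young:
  assumes "tab_state r p q t Q"
  shows "shape Q \<in> young r p q"
proof -
  have "(c, a', b') \<in> shape Q" if "(c, a, b) \<in> shape Q" "a' \<le> a" "b' \<le> b" for c a b a' b'
    using that tableau_card_mono[of "Q c" a' a] assms by (auto simp: shape_def tab_state_def)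
  then show ?thesis using assms unfolding young_def tab_state_def by blast
qed

lemma shape_eq_iff: "shape Q = shape Q' \<longleftrightarrow> (\<forall>c a. card (Q c a) = card (Q' c a))"
proof
  assume eq: "shape Q = shape Q'"
  have "{..<card (Q c a)} = {..<card (Q' c a)}" for c a
    using eq by (auto simp: shape_def set_eq_iff)
  then show "\<forall>c a. card (Q c a) = card (Q' c a)" by simp
qed (simp add: shape_def)

lemma shape_insert:
  assumes "\<And>c' b. card (Q c' b) = card (U c' b) + (if c' = c \<and> b = a then 1 else 0)"
  shows "shape Q = insert (c, a, card (U c a)) (shape U)"
  using assms by (auto simp: shape_def less_Suc_eq split: if_splits)

text \<open>Without the greatest entry \<open>m\<close>, a count up to \<open>v\<close> is a count
  up to the smaller of \<open>v\<close> and m - 1 in the old tableau. For m = 0 that subtraction is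
  truncated, hence the separate case.\<close>

lemma tableau_delete_greatest:
  assumes "tableau T" "\<And>a x. x \<in> T a \<Longrightarrow> x \<le> m"
  shows "tableau (\<lambda>a. T a - {m})"
proof -
  have "card ((T (Suc a) - {m}) \<inter> {..v}) \<le> card ((T a - {m}) \<inter> {..v})" for a v
  proof (cases "m = 0")
    case True
    then have "T (Suc a) - {m} = {}" using assms(2) by fastforce
    then show ?thesis by (simp only: Int_empty_left card.empty le0)
  next
    case False
    then have "(T b - {m}) \<inter> {..v} = T b \<inter> {..min v (m - 1)}" for b
      using assms(2)[of _ b] by force
    then show ?thesis using assms(1) by (simp add: tableau_def)
  qed
  moreover have "finite (\<Union>a. T a - {m})"
    by (rule finite_subset[of _ "\<Union>(range T)"]) (use assms in \<open>auto simp: tableau_def\<close>)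
  ultimately show ?thesis using assms(1) unfolding tableau_def disjoint_family_on_def by blast
qed

text \<open>Thresholds below \<open>m\<close> do not see the new entry; from \<open>m\<close> on
  whole rows are counted, and row \<open>a\<close> was strictly shorter than the row above.\<close>

lemma tableau_add_greatest:
  assumes "tableau T" "\<And>b x. x \<in> T b \<Longrightarrow> x < m" "a = 0 \<or> card (T a) < card (T (a - 1))"
  shows "tableau (T(a := insert m (T a)))"
proof -
  let ?T = "T(a := insert m (T a))"
  have fin: "\<And>b. finite (T b)" using assms(1) tableau_finite by blast
  have "card (?T (Suc b) \<inter> {..v}) \<le> card (?T b \<inter> {..v})" for b v
  proof (cases "v < m")
    case True
    then have "?T c \<inter> {..v} = T c \<inter> {..v}" for c by auto
    then show ?thesis using assms(1) by (simp add: tableau_def)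
  next
    case False
    have le: "T c \<inter> {..v} = T c" for c using False assms(2)[of _ c] by force
    have full: "?T c \<inter> {..v} = ?T c" for c using False le[of c] by auto
    have "m \<notin> T a" using assms(2)[of m a] by blast
    then have "card (?T c \<inter> {..v}) = card (T c) + (if c = a then 1 else 0)" for c
      unfolding full using fin[of a] by (cases "c = a") simp_all
    then show ?thesis using assms(3) tableau_card_mono[OF assms(1), of b "Suc b"] by auto
  qed
  moreover have "\<Union>(range ?T) \<subseteq> insert m (\<Union>(range T))" by (auto split: if_splits)
  then have "finite (\<Union>(range ?T))" using assms(1) finite_subset by (auto simp: tableau_def)
  moreover have "disjoint_family_on ?T UNIV"
    unfolding disjoint_family_on_def
  proof (intro ballI impI)
    fix b c :: nat assume "b \<noteq> c"
    moreover from this have "T b \<inter> T c = {}"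
      using assms(1) unfolding tableau_def disjoint_family_on_def by blast
    moreover have "m \<notin> T b" "m \<notin> T c" using assms(2)[of m] by blast+
    ultimately show "?T b \<inter> ?T c = {}" by auto
  qed
  ultimately show ?thesis by (simp add: tableau_def)
qed

lemma tab_state_delete:
  assumes "tab_state r p q (Suc t) Q"
  shows "tab_state r p q t (delete_entry (Suc t) Q)"
proof -
  have sub: "Q c a \<subseteq> {1..Suc t}" for c a using assms by (simp add: tab_state_def)
  have "tableau (delete_entry (Suc t) Q c)" for c
    unfolding delete_entry_def
    by (rule tableau_delete_greatest) (use assms sub in \<open>force simp: tab_state_def\<close>)+
  moreover have "delete_entry (Suc t) Q c a \<subseteq> {1..t}" for c a
    using sub[of c a] by (force simp: delete_entry_def)
  moreover have "shape (delete_entry (Suc t) Q) \<subseteq> shape Q"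
    using sub by (auto simp: shape_def delete_entry_def intro: order.strict_trans2 card_Diff1_le)
  ultimately show ?thesis using assms unfolding tab_state_def delete_entry_def by blast
qed

lemma tab_state_insert:
  assumes "tab_state r p q t U" "choice_ok r t d U"
    "shape (insert_choice d U) \<subseteq> {..<r} \<times> {..<p} \<times> {..<q}"
  shows "tab_state r p q t (insert_choice d U)"
proof (cases d)
  case None
  then show ?thesis using assms by (simp add: insert_choice_def)
next
  case (Some ci)
  then obtain c i where d: "d = Some (c, i)" by (cases ci) auto
  have ok: "1 \<le> i" "i \<le> t" "\<And>c a. i \<notin> U c a" using assms(2) d by (auto simp: choice_ok_def)
  have T: "tableau (tab_insert (U c) i)" "\<Union>(range (tab_insert (U c) i)) = insert i (\<Union>(range (U c)))"
    using tableau_insert[of "U c" i] ok(3) assms(1) by (auto simp: tab_state_def)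
  have mem: "x = i \<or> (\<exists>a. x \<in> U c a)" if "x \<in> tab_insert (U c) i a" for x a using T(2) that by blast
  let ?Q = "insert_choice d U"
  have Q: "?Q = U(c := tab_insert (U c) i)" by (simp add: insert_choice_def d)
  have dis: "x \<notin> U c' a'" if "c' \<noteq> c" "x \<in> tab_insert (U c) i a" for c' a a' x
    using mem[OF that(2)] ok(3) assms(1) that(1) unfolding tab_state_def by blast
  have "?Q c1 a1 \<inter> ?Q c2 a2 = {}" if "c1 \<noteq> c2" for c1 c2 a1 a2
  proof -
    have "U c1 a1 \<inter> U c2 a2 = {}" using that assms(1) by (simp add: tab_state_def)
    then show ?thesis using that dis[of c2 _ a1 a2] dis[of c1 _ a2 a1] unfolding Q by auto
  qed
  moreover have "?Q c' a \<subseteq> {1..t}" for c' a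
  proof
    fix x assume "x \<in> ?Q c' a"
    then have "x = i \<or> (\<exists>c a. x \<in> U c a)" using mem[of x a] unfolding Q by (auto split: if_splits)
    moreover have "\<And>c a. U c a \<subseteq> {1..t}" using assms(1) by (simp add: tab_state_def)
    moreover have "i \<in> {1..t}" using ok by simp
    ultimately show "x \<in> {1..t}" by blast
  qed
  moreover have "tableau (?Q c')" for c' using T(1) assms(1) unfolding Q tab_state_def by simp
  ultimately show ?thesis using assms(3) unfolding tab_state_def by blast
qed

lemma word_state_tab_state: "word_ok r p q t ds \<Longrightarrow> tab_state r p q t (word_state t ds)"
proof (induction ds arbitrary: t)
  case Nil
  have "shape (\<lambda>_ _. {}) = {}" by (simp add: shape_def)
  then show ?case by (simp add: tab_state_def tableau_empty)
next
  case (Cons d ds)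
  let ?U = "delete_entry (Suc t) (word_state (Suc t) ds)"
  have "tab_state r p q t ?U" using Cons by (intro tab_state_delete) auto
  moreover have "choice_ok r t d ?U" using Cons.prems by (auto simp: choice_ok_def delete_entry_def)
  ultimately show ?case using Cons.prems tab_state_insert by simp
qed

section \<open>Half steps are determined by the shapes\<close>

text \<open>Given \<open>Q\<close>, the state before an insertion is determined by its shape. An
  unchanged shape means that nothing was inserted; otherwise the missing box is a corner, where
  reverse bumping yields the tableau, and its place tells the colour.\<close>

lemma bij_insert:
  assumes Q: "tab_state r p q t Q"
  shows "bij_betw (\<lambda>(d, U). shape U)
    {(d, U). tab_state r p q t U \<and> choice_ok r t d U \<and> insert_choice d U = Q}
    {S \<in> young r p q. le_one S (shape Q)}"
proof -
  define A where "A = {(d, U). tab_state r p q t U \<and> choice_ok r t d U \<and> insert_choice d U = Q}"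
  have A_iff: "(d, U) \<in> A \<longleftrightarrow> tab_state r p q t U \<and> choice_ok r t d U \<and> insert_choice d U = Q" for d U
    by (simp add: A_def)
  have grow: "\<exists>a. \<forall>b. card (Q c b) = card (U c b) + (if b = a then 1 else 0)"
    and other: "\<And>c'. c' \<noteq> c \<Longrightarrow> Q c' = U c'" and tab: "Q c = tab_insert (U c) i"
    and fresh: "i \<notin> \<Union>(range (U c))" and TU: "tableau (U c)"
    if "(Some (c, i), U) \<in> A" for c i U
  proof -
    have U: "tableau (U c)" "i \<notin> \<Union>(range (U c))" "Q = U(c := tab_insert (U c) i)"
      using that by (auto simp: A_iff tab_state_def choice_ok_def insert_choice_def)
    show "\<exists>a. \<forall>b. card (Q c b) = card (U c b) + (if b = a then 1 else 0)"
      using card_tab_insert[OF U(1,2)] U(3) by (metis fun_upd_same)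
    show "\<And>c'. c' \<noteq> c \<Longrightarrow> Q c' = U c'" "Q c = tab_insert (U c) i" using U(3) by auto
    show "i \<notin> \<Union>(range (U c))" "tableau (U c)" using U by auto
  qed
  have none: "U = Q" if "(None, U) \<in> A" for U using that by (simp add: A_iff insert_choice_def)
  have inj: "inj_on (\<lambda>(d, U). shape U) A"
  proof (rule inj_onI)
    fix x y assume xy: "x \<in> A" "y \<in> A" "(\<lambda>(d, U). shape U) x = (\<lambda>(d, U). shape U) y"
    obtain d U d' U' where x: "x = (d, U)" and y: "y = (d', U')" by (cases x; cases y) auto
    have mem: "(d, U) \<in> A" "(d', U') \<in> A" using xy(1,2) unfolding x y .
    have "shape U = shape U'" using xy(3) by (simp add: x y)
    then have card: "card (U c a) = card (U' c a)" for c a by (simp add: shape_eq_iff)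
    have "d = d' \<and> U = U'"
    proof (cases d; cases d')
      assume "d = None" "d' = None"
      then show ?thesis using none[of U] none[of U'] mem by simp
    next
      fix ci' assume d: "d = None" "d' = Some ci'"
      have m: "(Some (fst ci', snd ci'), U') \<in> A" using mem(2) d(2) by simp
      have "U = Q" using none[of U] mem(1)[unfolded d(1)] by blast
      then have "\<not> (\<forall>b. card (Q c b) = card (U' c b) + (if b = a then 1 else 0))" for c a
        using card by (metis Suc_eq_plus1 n_not_Suc_n)
      then show ?thesis using grow[OF m] by blast
    next
      fix ci assume d: "d = Some ci" "d' = None"
      have m: "(Some (fst ci, snd ci), U) \<in> A" using mem(1) d(1) by simp
      have "U' = Q" using none[of U'] mem(2)[unfolded d(2)] by blast
      then have "\<not> (\<forall>b. card (Q c b) = card (U c b) + (if b = a then 1 else 0))" for c a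
        using card by (metis Suc_eq_plus1 n_not_Suc_n)
      then show ?thesis using grow[OF m] by blast
    next
      fix ci ci' assume d: "d = Some ci" "d' = Some ci'"
      obtain c i c' i' where ci: "ci = (c, i)" "ci' = (c', i')" by (cases ci; cases ci') auto
      have m: "(Some (c, i), U) \<in> A" "(Some (c', i'), U') \<in> A" using mem d ci by auto
      \<comment> \<open>Otherwise the second insertion leaves colour \<open>c\<close> alone, so that
        \<open>Q c\<close> has the row lengths of \<open>U c\<close>, although the first insertion
        added a box there.\<close>
      have c: "c = c'"
      proof (rule ccontr)
        assume "c \<noteq> c'"
        then have "Q c = U' c" using other[OF m(2)] by simp
        then have "\<not> (\<forall>b. card (Q c b) = card (U c b) + (if b = a then 1 else 0))" for a
          using card by (metis Suc_eq_plus1 n_not_Suc_n)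
        then show False using grow[OF m(1)] by blast
      qed
      have "U c = U' c \<and> i = i'"
        using tab_insert_inj[of "U c" "U' c" i i'] TU[OF m(1)] TU[OF m(2)] fresh[OF m(1)]
          fresh[OF m(2)] tab[OF m(1)] tab[OF m(2)] card c by simp
      moreover have "U c' = U' c'" if "c' \<noteq> c" for c'
        using other[OF m(1) that] other[OF m(2)] that c by simp
      ultimately show ?thesis using c d ci by (metis ext)
    qed
    then show "x = y" using x y by simp
  qed
  have into: "shape U \<in> young r p q \<and> le_one (shape U) (shape Q)" if "(d, U) \<in> A" for d U
  proof
    show "shape U \<in> young r p q" using that by (auto simp: A_iff intro: shape_young)
    show "le_one (shape U) (shape Q)"
    proof (cases d)
      case None
      then have "U = Q" using none[of U] that by simp
      then show ?thesis by (simp add: le_one_def)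
    next
      case (Some ci)
      then obtain c i where "d = Some (c, i)" by (cases ci) auto
      then have m: "(Some (c, i), U) \<in> A" using that by simp
      obtain a where a: "\<And>b. card (Q c b) = card (U c b) + (if b = a then 1 else 0)"
        using grow[OF m] by blast
      have "card (Q c' b) = card (U c' b) + (if c' = c \<and> b = a then 1 else 0)" for c' b
        using other[OF m, of c'] a[of b] by (cases "c' = c") auto
      then have "shape Q = insert (c, a, card (U c a)) (shape U)" by (rule shape_insert)
      moreover have "(c, a, card (U c a)) \<notin> shape U" by (simp add: shape_def)
      ultimately show ?thesis unfolding le_one_def by blast
    qed
  qed
  have surj: "\<exists>d U. (d, U) \<in> A \<and> shape U = S" if S: "S \<in> young r p q" "le_one S (shape Q)" for S
  proof (cases "S = shape Q")
    case True
    then have "(None, Q) \<in> A" using Q by (simp add: A_iff choice_ok_def insert_choice_def)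
    then show ?thesis using True by blast
  next
    case False
    then obtain c a b where new: "(c, a, b) \<notin> S" "shape Q = insert (c, a, b) S"
      using S(2) unfolding le_one_def by auto
    \<comment> \<open>As \<open>S\<close> is a diagram without this box, it has no box to the right
      of it or below it; hence the box is a corner of \<open>shape Q\<close>.\<close>
    have "(c, a, b) \<in> shape Q" "(c, a, Suc b) \<notin> shape Q" "(c, Suc a, b) \<notin> shape Q"
      using new young_down[OF S(1), of c a "Suc b" a b] young_down[OF S(1), of c "Suc a" b a b] by auto
    then have b: "card (Q c a) = Suc b" "card (Q c (Suc a)) < card (Q c a)"
      by (auto simp: shape_def)
    have TQ: "tableau (Q c)" using Q by (simp add: tab_state_def)
    obtain T i where T: "tableau T" "i \<notin> \<Union>(range T)" "tab_insert T i = Q c"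
      "\<And>b. card (Q c b) = card (T b) + (if b = a then 1 else 0)"
      using tab_insert_surj[OF TQ b(2)] by blast
    have ent: "\<Union>(range (Q c)) = insert i (\<Union>(range T))" using tableau_insert(2)[OF T(1,2)] T(3) by simp
    define U where "U = Q(c := T)"
    have "card (Q c' b) = card (U c' b) + (if c' = c \<and> b = a then 1 else 0)" for c' b
      using T(4)[of b] by (auto simp: U_def)
    then have "shape Q = insert (c, a, card (U c a)) (shape U)" by (rule shape_insert)
    moreover have "card (U c a) = b" using T(4)[of a] b(1) by (simp add: U_def)
    moreover have "(c, a, card (U c a)) \<notin> shape U" by (simp add: shape_def)
    ultimately have shU: "shape U = S" using new by (metis Diff_insert_absorb)
    have sub: "\<exists>a'. x \<in> Q c' a'" if "x \<in> U c' a" for x c' a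
      using that ent by (auto simp: U_def split: if_splits)
    have dis: "Q c1 a1 \<inter> Q c2 a2 = {}" if "c1 \<noteq> c2" for c1 c2 a1 a2
      using that Q by (simp add: tab_state_def)
    have "U c1 a1 \<inter> U c2 a2 = {}" if "c1 \<noteq> c2" for c1 c2 a1 a2
      using sub dis[OF that] by blast
    moreover have "U c' a' \<subseteq> {1..t}" for c' a'
      using sub Q unfolding tab_state_def by blast
    moreover have "tableau (U c')" for c' using T(1) Q by (simp add: U_def tab_state_def)
    moreover have "shape U \<subseteq> {..<r} \<times> {..<p} \<times> {..<q}" using shU S(1) by (simp add: young_def)
    ultimately have "tab_state r p q t U" unfolding tab_state_def by auto
    moreover have "choice_ok r t (Some (c, i)) U"
    proof -
      obtain a' where i: "i \<in> Q c a'" using ent by blast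
      have "i \<in> {1..t}" using i Q unfolding tab_state_def by blast
      moreover have "c < r" using Q \<open>(c, a, b) \<in> shape Q\<close> unfolding tab_state_def by blast
      moreover have "i \<notin> U c' a''" for c' a''
        using T(2) dis[of c' c a'' a'] i by (auto simp: U_def)
      ultimately show ?thesis by (auto simp: choice_ok_def)
    qed
    moreover have "insert_choice (Some (c, i)) U = Q" using T(3) by (auto simp: insert_choice_def U_def)
    ultimately have "(Some (c, i), U) \<in> A" by (simp add: A_iff)
    then show ?thesis using shU by (intro exI conjI)
  qed
  show ?thesis unfolding A_def[symmetric] bij_betw_def
  proof (intro conjI inj subset_antisym subsetI)
    fix S assume "S \<in> (\<lambda>(d, U). shape U) ` A"
    then show "S \<in> {S \<in> young r p q. le_one S (shape Q)}" using into by auto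
  next
    fix S assume "S \<in> {S \<in> young r p q. le_one S (shape Q)}"
    then show "S \<in> (\<lambda>(d, U). shape U) ` A" using surj[of S] by (force simp: image_iff)
  qed
qed

text \<open>The entry \<open>Suc t\<close> exceeds all entries of \<open>U\<close>, so it can only
  stand at the end of a row; the larger shape tells whether it is present and in which row.\<close>

lemma bij_delete:
  assumes U: "tab_state r p q t U"
  shows "bij_betw shape {Q. tab_state r p q (Suc t) Q \<and> delete_entry (Suc t) Q = U}
    {S \<in> young r p q. le_one (shape U) S}"
proof -
  let ?B = "{Q. tab_state r p q (Suc t) Q \<and> delete_entry (Suc t) Q = U}"
  have subU: "U c a \<subseteq> {1..t}" for c a using U by (simp add: tab_state_def)
  have finQ: "finite (Q c a)" if "Q \<in> ?B" for Q c a
    using that tableau_finite by (auto simp: tab_state_def)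
  have QU: "Q c a = (if Suc t \<in> Q c a then insert (Suc t) (U c a) else U c a)" if "Q \<in> ?B" for Q c a
    using that by (auto simp: delete_entry_def)
  have card: "card (Q c a) = card (U c a) + (if Suc t \<in> Q c a then 1 else 0)" if "Q \<in> ?B" for Q c a
  proof -
    have "Suc t \<notin> U c a" "finite (U c a)" using subU[of c a] finite_subset by auto
    then show ?thesis using QU[OF that, of c a] by auto
  qed
  have inj: "inj_on shape ?B"
  proof (rule inj_onI)
    fix Q Q' assume m: "Q \<in> ?B" "Q' \<in> ?B" and eq: "shape Q = shape Q'"
    have "Q c a = Q' c a" for c a
    proof -
      have "card (Q c a) = card (Q' c a)" using eq by (simp add: shape_eq_iff)
      then have "Suc t \<in> Q c a \<longleftrightarrow> Suc t \<in> Q' c a"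
        using card[OF m(1), of c a] card[OF m(2), of c a] by (auto split: if_splits)
      then show ?thesis using QU[OF m(1), of c a] QU[OF m(2), of c a] by simp
    qed
    then show "Q = Q'" by blast
  qed
  have into: "shape Q \<in> young r p q \<and> le_one (shape U) (shape Q)" if m: "Q \<in> ?B" for Q
  proof
    show "shape Q \<in> young r p q" using m by (auto intro: shape_young)
    show "le_one (shape U) (shape Q)"
    proof (cases "\<exists>c a. Suc t \<in> Q c a")
      case True
      then obtain c a where ca: "Suc t \<in> Q c a" by blast
      have uniq: "c' = c \<and> a' = a" if "Suc t \<in> Q c' a'" for c' a'
      proof -
        have "c' = c" using that ca m unfolding tab_state_def by blast
        moreover have "tableau (Q c)" using m by (simp add: tab_state_def)
        then have "a' = a" using that ca \<open>c' = c\<close> unfolding tableau_def disjoint_family_on_def by blast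
        ultimately show ?thesis by simp
      qed
      have "card (Q c' b) = card (U c' b) + (if c' = c \<and> b = a then 1 else 0)" for c' b
      proof (cases "Suc t \<in> Q c' b")
        case True
        then show ?thesis using card[OF m, of c' b] uniq[OF True] by simp
      next
        case False
        then have "\<not> (c' = c \<and> b = a)" using ca by blast
        then show ?thesis using card[OF m, of c' b] False by simp
      qed
      then have "shape Q = insert (c, a, card (U c a)) (shape U)" by (rule shape_insert)
      moreover have "(c, a, card (U c a)) \<notin> shape U" by (simp add: shape_def)
      ultimately show ?thesis unfolding le_one_def by blast
    next
      case False
      then have "shape Q = shape U" using card[OF m] by (simp add: shape_eq_iff)
      then show ?thesis by (simp add: le_one_def)
    qed
  qed
  have surj: "\<exists>Q\<in>?B. shape Q = S" if S: "S \<in> young r p q" "le_one (shape U) S" for S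
  proof (cases "S = shape U")
    case True
    have sub': "U c a \<subseteq> {1..Suc t}" for c a using subU[of c a] by force
    have "Suc t \<notin> U c a" for c a using subU[of c a] by auto
    then have "U \<in> ?B" using U sub' by (auto simp: tab_state_def delete_entry_def)
    then show ?thesis using True by blast
  next
    case False
    then obtain c a b where new: "(c, a, b) \<notin> shape U" "S = insert (c, a, b) (shape U)"
      using S(2) unfolding le_one_def by auto
    \<comment> \<open>A diagram has no gaps, so the new box is the first free place of its
      row.\<close>
    have "(c, a, card (U c a)) \<in> S"
      using young_down[OF S(1), of c a b a "card (U c a)"] new by (auto simp: shape_def)
    then have b: "b = card (U c a)" using new by (auto simp: shape_def)
    have add: "a = 0 \<or> card (U c a) < card (U c (a - 1))"
    proof (cases a)
      case (Suc a')
      then have "(c, a', b) \<in> shape U" using young_down[OF S(1), of c a b a' b] new by auto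
      then show ?thesis using Suc b by (simp add: shape_def)
    qed simp
    define Q where "Q = U(c := (U c)(a := insert (Suc t) (U c a)))"
    have fresh: "Suc t \<notin> U c a" for c a using subU[of c a] by auto
    have "tableau ((U c)(a := insert (Suc t) (U c a)))"
    proof (rule tableau_add_greatest[OF _ _ add])
      show "tableau (U c)" using U by (simp add: tab_state_def)
      show "x < Suc t" if "x \<in> U c b" for b x using that subU[of c b] by auto
    qed
    then have "tableau (Q c')" for c' using U by (simp add: Q_def tab_state_def)
    moreover have "Q c1 a1 \<inter> Q c2 a2 = {}" if "c1 \<noteq> c2" for c1 c2 a1 a2
    proof -
      have "U c1 a1 \<inter> U c2 a2 = {}" using U that by (simp add: tab_state_def)
      then show ?thesis using that fresh by (auto simp: Q_def)
    qed
    moreover have "Q c' a' \<subseteq> {1..Suc t}" for c' a' 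
    proof -
      have "U c' a' \<subseteq> {1..Suc t}" "U c a \<subseteq> {1..Suc t}"
        using subU[of c' a'] subU[of c a] by fastforce+
      then show ?thesis by (auto simp: Q_def)
    qed
    moreover have shQ: "shape Q = S"
    proof -
      have "finite (U c a)" using subU finite_subset by blast
      then have "card (Q c' b) = card (U c' b) + (if c' = c \<and> b = a then 1 else 0)" for c' b
        using fresh[of c a] by (auto simp: Q_def)
      then have "shape Q = insert (c, a, card (U c a)) (shape U)" by (rule shape_insert)
      then show ?thesis using new b by simp
    qed
    moreover have "S \<subseteq> {..<r} \<times> {..<p} \<times> {..<q}" using S(1) by (simp add: young_def)
    ultimately have "tab_state r p q (Suc t) Q" unfolding tab_state_def by blast
    moreover have "delete_entry (Suc t) Q = U"
      using fresh by (auto simp: delete_entry_def Q_def fun_eq_iff)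
    ultimately show ?thesis using shQ by blast
  qed
  show ?thesis unfolding bij_betw_def
  proof (intro conjI inj subset_antisym subsetI)
    fix S assume "S \<in> shape ` ?B"
    then show "S \<in> {S \<in> young r p q. le_one (shape U) S}" using into by auto
  next
    fix S assume "S \<in> {S \<in> young r p q. le_one (shape U) S}"
    then show "S \<in> shape ` ?B" using surj[of S] by force
  qed
qed

text \<open>Peeling off the first choice of a word undoes an insertion and then a deletion. By the
  two bijections both are choices of neighbouring shapes, so the recursion for words is that of
  \<open>vac_count\<close>.\<close>

lemma card_words:
  assumes "tab_state r p q t Q"
  shows "finite {ds. length ds = m \<and> word_ok r p q t ds \<and> word_state t ds = Q} \<and>
    card {ds. length ds = m \<and> word_ok r p q t ds \<and> word_state t ds = Q} = vac_count r p q m (shape Q)"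
  using assms
proof (induction m arbitrary: t Q)
  case 0
  have "shape Q = {} \<longleftrightarrow> (\<lambda>_ _. {}) = Q"
  proof
    assume "shape Q = {}"
    then have "card (Q c a) = 0" for c a by (force simp: shape_def)
    moreover have "finite (Q c a)" for c a using 0 tableau_finite by (auto simp: tab_state_def)
    ultimately show "(\<lambda>_ _. {}) = Q" by (auto simp: fun_eq_iff)
  qed (auto simp: shape_def)
  moreover have "{ds. length ds = 0 \<and> word_ok r p q t ds \<and> word_state t ds = Q} =
    (if (\<lambda>_ _. {}) = Q then {[]} else {})" by auto
  ultimately show ?case by auto
next
  case (Suc m)
  define W where "W n t Q = {ds. length ds = n \<and> word_ok r p q t ds \<and> word_state t ds = Q}" for n t Q
  define A where "A = {(d, U). tab_state r p q t U \<and> choice_ok r t d U \<and> insert_choice d U = Q}"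
  define B where "B U = {Q'. tab_state r p q (Suc t) Q' \<and> delete_entry (Suc t) Q' = U}" for U
  have bA: "bij_betw (\<lambda>(d, U). shape U) A {S \<in> young r p q. le_one S (shape Q)}"
    unfolding A_def by (rule bij_insert[OF Suc.prems])
  have bB: "bij_betw shape (B U) {S \<in> young r p q. le_one (shape U) S}" if "(d, U) \<in> A" for d U
    unfolding B_def using that by (intro bij_delete) (simp add: A_def)
  have finA: "finite A" using bij_betw_finite[OF bA] finite_young by simp
  have finB: "finite (B U)" if "(d, U) \<in> A" for d U using bij_betw_finite[OF bB[OF that]] finite_young by simp
  have IH: "finite (W m (Suc t) Q')" "card (W m (Suc t) Q') = vac_count r p q m (shape Q')"
    if "Q' \<in> B U" for Q' U
    using Suc.IH[of "Suc t" Q'] that by (auto simp: W_def B_def)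
  let ?I = "Sigma A (\<lambda>x. B (snd x))"
  have "W (Suc m) t Q = (\<Union>((d, U), Q')\<in>?I. (#) d ` W m (Suc t) Q')"
  proof (intro subset_antisym subsetI)
    fix ds assume ds: "ds \<in> W (Suc m) t Q"
    then obtain d ds' where ds': "ds = d # ds'" "length ds' = m" by (auto simp: W_def length_Suc_conv)
    let ?Q' = "word_state (Suc t) ds'"
    have st: "tab_state r p q (Suc t) ?Q'"
      using ds ds' by (intro word_state_tab_state) (simp add: W_def)
    have "?Q' \<in> B (delete_entry (Suc t) ?Q')" using st by (simp add: B_def)
    moreover have "(d, delete_entry (Suc t) ?Q') \<in> A"
      using ds ds' tab_state_delete[OF st] by (auto simp: W_def A_def choice_ok_def delete_entry_def)
    moreover have "ds' \<in> W m (Suc t) ?Q'" using ds ds' by (simp add: W_def)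
    ultimately show "ds \<in> (\<Union>((d, U), Q')\<in>?I. (#) d ` W m (Suc t) Q')"
      unfolding ds'(1) by force
  next
    fix ds assume "ds \<in> (\<Union>((d, U), Q')\<in>?I. (#) d ` W m (Suc t) Q')"
    then obtain d U Q' ds' where *: "(d, U) \<in> A" "Q' \<in> B U" "ds' \<in> W m (Suc t) Q'" "ds = d # ds'"
      by auto
    have "choice_ok r t d Q'"
    proof -
      have "Q' c a \<subseteq> insert (Suc t) (U c a)" for c a using *(2) by (auto simp: B_def delete_entry_def)
      then show ?thesis using *(1) unfolding choice_ok_def A_def by fastforce
    qed
    moreover have "shape Q \<subseteq> {..<r} \<times> {..<p} \<times> {..<q}" using Suc.prems by (simp add: tab_state_def)
    ultimately show "ds \<in> W (Suc m) t Q" using * by (auto simp: W_def A_def B_def)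
  qed
  then have W: "W (Suc m) t Q = (\<Union>x\<in>?I. (#) (fst (fst x)) ` W m (Suc t) (snd x))"
    by (auto simp: case_prod_beta)
  have finI: "finite ?I" using finA finB by (intro finite_SigmaI) auto
  have finW: "finite ((#) (fst (fst x)) ` W m (Suc t) (snd x))" if "x \<in> ?I" for x
    using that IH(1) by auto
  have "card (W (Suc m) t Q) = (\<Sum>x\<in>?I. card ((#) (fst (fst x)) ` W m (Suc t) (snd x)))"
    unfolding W
  \<comment> \<open>A word determines its index: \<open>d\<close> is its head, \<open>Q'\<close> is
    the state of its tail, and \<open>U\<close> arises from \<open>Q'\<close> by the
    deletion.\<close>
  proof (rule card_UN_disjoint[OF finI])
    show "\<forall>i\<in>?I. \<forall>j\<in>?I. i \<noteq> j \<longrightarrow> (#) (fst (fst i)) ` W m (Suc t) (snd i) \<inter>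
      (#) (fst (fst j)) ` W m (Suc t) (snd j) = {}"
      by (auto simp: W_def B_def)
  qed (use finW in blast)
  also have "\<dots> = (\<Sum>x\<in>?I. vac_count r p q m (shape (snd x)))"
    by (intro sum.cong refl) (auto simp: card_image IH(2))
  also have "\<dots> = (\<Sum>x\<in>A. \<Sum>Q'\<in>B (snd x). vac_count r p q m (shape Q'))"
  proof -
    have "\<forall>x\<in>A. finite (B (snd x))" using finB by auto
    from sum.Sigma[OF finA this, of "\<lambda>x Q'. vac_count r p q m (shape Q')"] show ?thesis
      by (simp add: case_prod_beta)
  qed
  also have "\<dots> = (\<Sum>x\<in>A. \<Sum>S2\<in>{S2 \<in> young r p q. le_one (shape (snd x)) S2}. vac_count r p q m S2)"
    using bB by (intro sum.cong refl sum.reindex_bij_betw) auto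
  also have "\<dots> = vac_count r p q (Suc m) (shape Q)"
    using sum.reindex_bij_betw[OF bA, of "\<lambda>S1. \<Sum>S2\<in>{S2 \<in> young r p q. le_one S1 S2}. vac_count r p q m S2"]
    by (simp add: case_prod_beta)
  finally have "card (W (Suc m) t Q) = vac_count r p q (Suc m) (shape Q)" .
  moreover have "finite (W (Suc m) t Q)" unfolding W using finI finW by blast
  ultimately show ?case unfolding W_def by blast
qed

section \<open>Matrices as families of Young diagrams\<close>

text \<open>The row of A for colour c lists the column heights of the diagram of that colour.\<close>

definition mat_diagram :: "int mat \<Rightarrow> (nat \<times> nat \<times> nat) set" where
  "mat_diagram A = {(c, a, l). c < dim_row A \<and> l < dim_col A \<and> int a < A $$ (c, l)}"

text \<open>Comparing all pairs of columns instead of adjacent ones, with bounds on every entry, is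
  the form that translates directly into downward closed sets of boxes.\<close>

lemma G_verts_iff:
  assumes "j \<ge> 2" "k \<ge> 2"
  shows "A \<in> G_verts j k r \<longleftrightarrow> A \<in> carrier_mat r (k - 1) \<and>
    (\<forall>c<r. \<forall>l<k - 1. 0 \<le> A $$ (c, l) \<and> A $$ (c, l) \<le> int (j - 1) \<and>
      (\<forall>l'\<le>l. A $$ (c, l) \<le> A $$ (c, l')))"
proof
  assume "A \<in> G_verts j k r"
  then have car: "A \<in> carrier_mat r (k - 1)" and
    A: "\<And>c. c < r \<Longrightarrow> int j > A $$ (c, 0)"
      "\<And>c l. c < r \<Longrightarrow> l + 1 < k - 1 \<Longrightarrow> A $$ (c, l) \<ge> A $$ (c, l + 1)"
      "\<And>c. c < r \<Longrightarrow> A $$ (c, k - 2) \<ge> 0"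
    by (auto simp: G_verts_def)
  have mono: "A $$ (c, l) \<le> A $$ (c, l')" if "c < r" "l' \<le> l" "l < k - 1" for c l l'
    using that(2,3)
  proof (induction l)
    case (Suc l)
    show ?case
    proof (cases "l' = Suc l")
      case False
      then show ?thesis using Suc A(2)[OF that(1), of l] by simp
    qed simp
  qed simp
  have "0 \<le> A $$ (c, l) \<and> A $$ (c, l) \<le> int (j - 1) \<and> (\<forall>l'\<le>l. A $$ (c, l) \<le> A $$ (c, l'))"
    if "c < r" "l < k - 1" for c l
    using mono[OF that(1), of l "k - 2"] mono[OF that(1), of 0 l] mono[OF that(1), of _ l]
      A(1)[OF that(1)] A(3)[OF that(1)] that(2) assms by force
  with car show "A \<in> carrier_mat r (k - 1) \<and>
    (\<forall>c<r. \<forall>l<k - 1. 0 \<le> A $$ (c, l) \<and> A $$ (c, l) \<le> int (j - 1) \<and>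
      (\<forall>l'\<le>l. A $$ (c, l) \<le> A $$ (c, l')))" by blast
next
  assume *: "A \<in> carrier_mat r (k - 1) \<and>
    (\<forall>c<r. \<forall>l<k - 1. 0 \<le> A $$ (c, l) \<and> A $$ (c, l) \<le> int (j - 1) \<and>
      (\<forall>l'\<le>l. A $$ (c, l) \<le> A $$ (c, l')))"
  have "A $$ (c, 0) < int j" "0 \<le> A $$ (c, k - 2)" if "c < r" for c
    using *[THEN conjunct2, rule_format, OF that, of 0]
      *[THEN conjunct2, rule_format, OF that, of "k - 2"] assms by auto
  moreover have "A $$ (c, l + 1) \<le> A $$ (c, l)" if "c < r" "l + 1 < k - 1" for c l
    using *[THEN conjunct2, rule_format, OF that] by auto
  ultimately show "A \<in> G_verts j k r" using * by (auto simp: G_verts_def)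
qed

context
  fixes j k r :: nat
  assumes jk: "j \<ge> 2" "k \<ge> 2"
begin

abbreviation (input) "GV \<equiv> G_verts j k r"
abbreviation (input) "YD \<equiv> young r (j - 1) (k - 1)"

lemma G_vertsD:
  assumes "A \<in> GV"
  shows "A \<in> carrier_mat r (k - 1)" "dim_row A = r" "dim_col A = k - 1"
    "\<And>c l. c < r \<Longrightarrow> l < k - 1 \<Longrightarrow> 0 \<le> A $$ (c, l)"
    "\<And>c l. c < r \<Longrightarrow> l < k - 1 \<Longrightarrow> A $$ (c, l) \<le> int (j - 1)"
    "\<And>c l l'. c < r \<Longrightarrow> l < k - 1 \<Longrightarrow> l' \<le> l \<Longrightarrow> A $$ (c, l) \<le> A $$ (c, l')"
  using assms unfolding G_verts_iff[OF jk] by auto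

lemma mat_diagram_iff:
  "A \<in> GV \<Longrightarrow> (c, a, l) \<in> mat_diagram A \<longleftrightarrow> c < r \<and> l < k - 1 \<and> int a < A $$ (c, l)"
  using G_vertsD(2,3)[of A] by (simp add: mat_diagram_def)

lemma mat_diagram_young:
  assumes "A \<in> GV"
  shows "mat_diagram A \<in> YD"
proof -
  have 1: "a < j - 1" if "c < r" "l < k - 1" "int a < A $$ (c, l)" for c a l
    using G_vertsD(5)[OF assms that(1,2)] that(3) by linarith
  have 2: "int a' < A $$ (c, l')"
    if "c < r" "l < k - 1" "int a < A $$ (c, l)" "a' \<le> a" "l' \<le> l" for c a l a' l'
    using G_vertsD(6)[OF assms that(1,2,5)] that(3,4) by linarith
  show ?thesis unfolding young_def
  proof (intro CollectI conjI allI impI)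
    show "mat_diagram A \<subseteq> {..<r} \<times> {..<j - 1} \<times> {..<k - 1}"
    proof
      fix x assume x: "x \<in> mat_diagram A"
      obtain c a l where "x = (c, a, l)" by (cases x) auto
      then show "x \<in> {..<r} \<times> {..<j - 1} \<times> {..<k - 1}"
        using x 1[of c l a] mat_diagram_iff[OF assms, of c a l] by simp
    qed
    fix c a l a' l' assume "(c, a, l) \<in> mat_diagram A" "a' \<le> a" "l' \<le> l"
    then show "(c, a', l') \<in> mat_diagram A"
      using 2[of c l a a' l'] mat_diagram_iff[OF assms, of c a l] mat_diagram_iff[OF assms, of c a' l']
      by simp
  qed
qed

lemma mat_entry:
  assumes "A \<in> GV" "c < r" "l < k - 1"
  shows "A $$ (c, l) = int (card {a. (c, a, l) \<in> mat_diagram A})"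
proof -
  have "{a. (c, a, l) \<in> mat_diagram A} = {..<nat (A $$ (c, l))}"
    using mat_diagram_iff[OF assms(1)] assms(2,3) by auto
  then show ?thesis using G_vertsD(4)[OF assms] by simp
qed

text \<open>Every column of a diagram is an initial segment, so its height describes it
  completely.\<close>

lemma bij_mat_diagram: "bij_betw mat_diagram GV YD"
  unfolding bij_betw_def
proof
  show "inj_on mat_diagram GV"
  proof (rule inj_onI)
    fix A B assume AB: "A \<in> GV" "B \<in> GV" "mat_diagram A = mat_diagram B"
    show "A = B"
      by (rule eq_matI) (use AB G_vertsD(2,3) mat_entry in simp_all)
  qed
  have "S \<in> mat_diagram ` GV" if S: "S \<in> YD" for S
  proof -
    define A where "A = mat r (k - 1) (\<lambda>(c, l). int (card {a. (c, a, l) \<in> S}))"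
    have sub: "S \<subseteq> {..<r} \<times> {..<j - 1} \<times> {..<k - 1}" using S by (simp add: young_def)
    have "{a. (c, a, l) \<in> S} \<subseteq> {..<j - 1}" for c l using sub by auto
    then have fin: "finite {a. (c, a, l) \<in> S}" and cd: "card {a. (c, a, l) \<in> S} \<le> j - 1" for c l
      using finite_subset[of _ "{..<j - 1}"] card_mono[of "{..<j - 1}"] by fastforce+
    have "card {a. (c, a, l) \<in> S} \<le> card {a. (c, a, l') \<in> S}" if "l' \<le> l" for c l l'
      using fin young_down[OF S] that by (intro card_mono) auto
    then have A: "A \<in> GV" unfolding G_verts_iff[OF jk] A_def using cd by auto
    have eq: "{a. (c, a, l) \<in> S} = {..<card {a. (c, a, l) \<in> S}}" for c l
    proof -
      let ?X = "{a. (c, a, l) \<in> S}"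
      have down: "a' \<in> ?X" if "a \<in> ?X" "a' \<le> a" for a a' using young_down[OF S] that by auto
      have "{..a} \<subseteq> ?X" if "a \<in> ?X" for a using down[OF that] by auto
      then have "a < card ?X" if "a \<in> ?X" for a
        using card_mono[OF fin, of "{..a}" c l] that by fastforce
      then show ?thesis using card_subset_eq[of "{..<card ?X}" ?X] by auto
    qed
    then have mem: "(c, a, l) \<in> S \<longleftrightarrow> a < card {a. (c, a, l) \<in> S}" for c a l by blast
    have "mat_diagram A = S"
    proof (intro subset_antisym subsetI)
      fix x assume x: "x \<in> mat_diagram A"
      obtain c a l where "x = (c, a, l)" by (cases x) auto
      then show "x \<in> S" using mem[of c a l] x by (auto simp: mat_diagram_def A_def)
    next
      fix x assume x: "x \<in> S"
      then obtain c a l where "x = (c, a, l)" "c < r" "l < k - 1" using sub by auto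
      then show "x \<in> mat_diagram A" using mem[of c a l] x by (auto simp: mat_diagram_def A_def)
    qed
    then show ?thesis using A by blast
  qed
  then show "mat_diagram ` GV = YD" using mat_diagram_young by blast
qed

lemma finite_G_verts: "finite GV"
  using bij_betw_finite[OF bij_mat_diagram] finite_young by simp

lemma zero_mat_G_verts: "0\<^sub>m r (k - 1) \<in> GV"
  unfolding G_verts_iff[OF jk] by simp

lemma mat_diagram_zero: "mat_diagram (0\<^sub>m r (k - 1)) = {}"
  by (auto simp: mat_diagram_def)

text \<open>A new box must lie at the end of a column, where it raises a single matrix entry by
  one.\<close>

lemma le_one_mat_diagram:
  assumes "A \<in> GV" "B \<in> GV"
  shows "le_one (mat_diagram A) (mat_diagram B) \<longleftrightarrow> B = A \<or>
    (\<exists>c<r. \<exists>l<k - 1. \<forall>c'<r. \<forall>l'<k - 1. B $$ (c', l') = A $$ (c', l') + of_bool ((c', l') = (c, l)))"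
proof
  assume "le_one (mat_diagram A) (mat_diagram B)"
  then consider "mat_diagram B = mat_diagram A"
    | c a l where "(c, a, l) \<notin> mat_diagram A" "mat_diagram B = insert (c, a, l) (mat_diagram A)"
    unfolding le_one_def by auto
  then show "B = A \<or>
    (\<exists>c<r. \<exists>l<k - 1. \<forall>c'<r. \<forall>l'<k - 1. B $$ (c', l') = A $$ (c', l') + of_bool ((c', l') = (c, l)))"
  proof cases
    case 1
    then show ?thesis using bij_mat_diagram assms unfolding bij_betw_def inj_on_def by blast
  next
    case 2
    have cl: "c < r" "l < k - 1" using 2(2) mat_diagram_iff[OF assms(2), of c a l] by auto
    have "B $$ (c', l') = A $$ (c', l') + of_bool ((c', l') = (c, l))" if "c' < r" "l' < k - 1" for c' l'
    proof -
      let ?X = "{a. (c', a, l') \<in> mat_diagram A}"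
      have "finite ?X"
        by (rule finite_subset[of _ "{..<nat (A $$ (c', l'))}"])
          (use mat_diagram_iff[OF assms(1)] in auto)
      moreover have "{a. (c', a, l') \<in> mat_diagram B} = (if (c', l') = (c, l) then insert a ?X else ?X)"
        using 2(2) by auto
      moreover have "a \<notin> ?X" if "(c', l') = (c, l)" using 2(1) that by simp
      ultimately show ?thesis
        using mat_entry[OF assms(1) that] mat_entry[OF assms(2) that] by auto
    qed
    then show ?thesis using cl by blast
  qed
next
  assume "B = A \<or>
    (\<exists>c<r. \<exists>l<k - 1. \<forall>c'<r. \<forall>l'<k - 1. B $$ (c', l') = A $$ (c', l') + of_bool ((c', l') = (c, l)))"
  then consider "B = A" | c l where "c < r" "l < k - 1"
    "\<And>c' l'. c' < r \<Longrightarrow> l' < k - 1 \<Longrightarrow> B $$ (c', l') = A $$ (c', l') + of_bool ((c', l') = (c, l))"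
    by blast
  then show "le_one (mat_diagram A) (mat_diagram B)"
  proof cases
    case 2
    \<comment> \<open>Places in a column are numbered from 0, so the height of the column is the
      index of its first free place.\<close>
    define a where "a = nat (A $$ (c, l))"
    have a: "int a = A $$ (c, l)" using G_vertsD(4)[OF assms(1) 2(1,2)] by (simp add: a_def)
    have "x \<in> mat_diagram B \<longleftrightarrow> x \<in> insert (c, a, l) (mat_diagram A)" for x
    proof -
      obtain c' a' l' where x: "x = (c', a', l')" by (cases x) auto
      show ?thesis
        using mat_diagram_iff[OF assms(1), of c' a' l'] mat_diagram_iff[OF assms(2), of c' a' l']
          2(1,2) 2(3)[of c' l'] a unfolding x by (auto simp: of_bool_def split: if_splits)
    qed
    moreover have "(c, a, l) \<notin> mat_diagram A" using mat_diagram_iff[OF assms(1)] a by auto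
    ultimately show ?thesis unfolding le_one_def by blast
  qed (simp add: le_one_def)
qed

section \<open>Edge multiplicities as numbers of intermediate shapes\<close>

text \<open>An element of \<open>S\<close> outside \<open>X\<close> and \<open>Z\<close> would be
  the one added in both cases, and then \<open>X\<close> and \<open>Z\<close> would
  coincide.\<close>

lemma le_one_both:
  assumes "le_one X S" "le_one Z S" "X \<noteq> Z"
  shows "S = X \<union> Z"
proof -
  have sub: "X \<subseteq> S" "Z \<subseteq> S" using assms by (auto simp: le_one_def)
  have "x \<in> X \<union> Z" if "x \<in> S" for x
  proof (rule ccontr)
    assume "x \<notin> X \<union> Z"
    moreover have "S = insert x W" if "le_one W S" "x \<notin> W" for W
      using that \<open>x \<in> S\<close> unfolding le_one_def by blast
    ultimately have "insert x X = insert x Z" "x \<notin> X" "x \<notin> Z" using assms(1,2) by auto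
    then show False using assms(3) by (metis insert_ident)
  qed
  then show ?thesis using sub by blast
qed

lemma mat_diff_eq_elem:
  assumes "A \<in> GV" "B \<in> GV" "c < r" "l < k - 1"
  shows "A - B = elem_mat r (k - 1) c l \<longleftrightarrow>
      (\<forall>c'<r. \<forall>l'<k - 1. A $$ (c', l') = B $$ (c', l') + of_bool ((c', l') = (c, l)))"
    "A - B = - elem_mat r (k - 1) c l \<longleftrightarrow>
      (\<forall>c'<r. \<forall>l'<k - 1. B $$ (c', l') = A $$ (c', l') + of_bool ((c', l') = (c, l)))"
    "A - B = elem_mat r (k - 1) c l - elem_mat r (k - 1) c2 l2 \<longleftrightarrow>
      (\<forall>c'<r. \<forall>l'<k - 1. A $$ (c', l') + of_bool ((c', l') = (c2, l2)) =
        B $$ (c', l') + of_bool ((c', l') = (c, l)))"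
proof -
  have diff: "A - B = M \<longleftrightarrow>
      (\<forall>c'<r. \<forall>l'<k - 1. A $$ (c', l') - B $$ (c', l') = M $$ (c', l'))"
    if "M \<in> carrier_mat r (k - 1)" for M
    using that G_vertsD(2,3)[OF assms(1)] G_vertsD(2,3)[OF assms(2)] unfolding mat_eq_iff by auto
  have E: "elem_mat r (k - 1) c l \<in> carrier_mat r (k - 1)" for c l by (simp add: elem_mat_def)
  have Ev: "elem_mat r (k - 1) c l $$ (c', l') = of_bool ((c', l') = (c, l))"
    if "c' < r" "l' < k - 1" for c l c' l' using that by (simp add: elem_mat_def)
  have dim: "dim_row (elem_mat r (k - 1) c l) = r" "dim_col (elem_mat r (k - 1) c l) = k - 1" for c l
    by (simp_all add: elem_mat_def)
  have lin: "x - y = z \<longleftrightarrow> x = y + z" "x - y = - z \<longleftrightarrow> y = x + z" "x - y = z - w \<longleftrightarrow> x + w = y + z"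
    for x y z w :: int by linarith+
  show "A - B = elem_mat r (k - 1) c l \<longleftrightarrow>
      (\<forall>c'<r. \<forall>l'<k - 1. A $$ (c', l') = B $$ (c', l') + of_bool ((c', l') = (c, l)))"
    unfolding diff[OF E] lin(1) using Ev[of _ _ c l] by simp
  have "- elem_mat r (k - 1) c l \<in> carrier_mat r (k - 1)" using E by simp
  then show "A - B = - elem_mat r (k - 1) c l \<longleftrightarrow>
      (\<forall>c'<r. \<forall>l'<k - 1. B $$ (c', l') = A $$ (c', l') + of_bool ((c', l') = (c, l)))"
    using diff[of "- elem_mat r (k - 1) c l"] Ev[of _ _ c l] dim by (simp add: lin(2))
  have "elem_mat r (k - 1) c l - elem_mat r (k - 1) c2 l2 \<in> carrier_mat r (k - 1)"
    using E by (intro minus_carrier_mat)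
  then show "A - B = elem_mat r (k - 1) c l - elem_mat r (k - 1) c2 l2 \<longleftrightarrow>
      (\<forall>c'<r. \<forall>l'<k - 1. A $$ (c', l') + of_bool ((c', l') = (c2, l2)) =
        B $$ (c', l') + of_bool ((c', l') = (c, l)))"
    using diff[of "elem_mat r (k - 1) c l - elem_mat r (k - 1) c2 l2"] Ev dim by (simp add: lin(3))
qed

text \<open>The only possible intermediate shape is the union of both diagrams. Adjacency expresses
  that this union exceeds each of them by at most one box.\<close>

lemma G_mult_ne:
  assumes "A \<in> GV" "B \<in> GV" "A \<noteq> B"
  shows "G_mult j k r A B = card {S \<in> YD. le_one (mat_diagram A) S \<and> le_one (mat_diagram B) S}"
proof -
  define E where "E X Z c l \<longleftrightarrow>
    (\<forall>c'<r. \<forall>l'<k - 1. Z $$ (c', l') = X $$ (c', l') + of_bool ((c', l') = (c, l)))"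
    for X Z :: "int mat" and c l
  define F where "F c l c2 l2 \<longleftrightarrow>
    (\<forall>c'<r. \<forall>l'<k - 1. A $$ (c', l') + of_bool ((c', l') = (c2, l2)) =
      B $$ (c', l') + of_bool ((c', l') = (c, l)))" for c l c2 l2
  have ED: "Z $$ (c', l') = X $$ (c', l') + of_bool ((c', l') = (c, l))"
    if "E X Z c l" "c' < r" "l' < k - 1" for X Z c l c' l' using that by (simp add: E_def)
  \<comment> \<open>The union of two diagrams has the maximum of their heights in each
    column.\<close>
  define M where "M = mat r (k - 1) (\<lambda>x. max (A $$ x) (B $$ x))"
  have Mv: "M $$ (c, l) = max (A $$ (c, l)) (B $$ (c, l))" if "c < r" "l < k - 1" for c l
    using that by (simp add: M_def)
  have M: "M \<in> GV" unfolding G_verts_iff[OF jk]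
  proof (intro conjI allI impI)
    fix c l assume cl: "c < r" "l < k - 1"
    show "0 \<le> M $$ (c, l)" "M $$ (c, l) \<le> int (j - 1)"
      using Mv[OF cl] G_vertsD(4,5)[OF assms(1) cl] G_vertsD(4,5)[OF assms(2) cl] by auto
    fix l' assume "l' \<le> l"
    then show "M $$ (c, l) \<le> M $$ (c, l')"
      using Mv[OF cl] Mv[OF cl(1), of l'] G_vertsD(6)[OF assms(1) cl, of l']
        G_vertsD(6)[OF assms(2) cl, of l'] cl by auto
  qed (simp add: M_def)
  have DM: "mat_diagram M = mat_diagram A \<union> mat_diagram B"
    using mat_diagram_iff[OF M] mat_diagram_iff[OF assms(1)] mat_diagram_iff[OF assms(2)] Mv by auto
  have neD: "mat_diagram A \<noteq> mat_diagram B"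
    using bij_mat_diagram assms unfolding bij_betw_def inj_on_def by blast
  have "S = mat_diagram M" if "le_one (mat_diagram A) S" "le_one (mat_diagram B) S" for S
    using le_one_both[OF that neD] DM by simp
  then have sub: "{S \<in> YD. le_one (mat_diagram A) S \<and> le_one (mat_diagram B) S} =
    (if le_one (mat_diagram A) (mat_diagram M) \<and> le_one (mat_diagram B) (mat_diagram M)
     then {mat_diagram M} else {})"
    using mat_diagram_young[OF M] by auto
  have adj: "G_adj k r A B \<longleftrightarrow> (\<exists>c<r. \<exists>l<k - 1. E B A c l \<or> E A B c l) \<or>
    (\<exists>c<r. \<exists>l<k - 1. \<exists>c2<r. \<exists>l2<k - 1. (c, l) \<noteq> (c2, l2) \<and>
      F c l c2 l2)"
    unfolding G_adj_def E_def F_def using mat_diff_eq_elem[OF assms(1,2)] by (simp cong: conj_cong)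
  have eqI: "X = Z" if "X \<in> GV" "Z \<in> GV" "\<And>c l. c < r \<Longrightarrow> l < k - 1 \<Longrightarrow> X $$ (c, l) = Z $$ (c, l)" for X Z
    by (rule eq_matI) (use that G_vertsD(2,3) in auto)
  have "G_adj k r A B \<longleftrightarrow>
    le_one (mat_diagram A) (mat_diagram M) \<and> le_one (mat_diagram B) (mat_diagram M)"
    unfolding le_one_mat_diagram[OF assms(1) M, folded E_def] le_one_mat_diagram[OF assms(2) M, folded E_def]
  proof
    assume "G_adj k r A B"
    then consider c l where "c < r" "l < k - 1" "E B A c l" | c l where "c < r" "l < k - 1" "E A B c l"
      | c l c2 l2 where "c < r" "l < k - 1" "c2 < r" "l2 < k - 1" "(c, l) \<noteq> (c2, l2)" "F c l c2 l2"
      unfolding adj by blast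
    then show "(M = A \<or> (\<exists>c<r. \<exists>l<k - 1. E A M c l)) \<and> (M = B \<or> (\<exists>c<r. \<exists>l<k - 1. E B M c l))"
    proof cases
      case 1
      then have "M = A" using M assms(1) Mv ED[OF 1(3)] by (intro eqI) auto
      then show ?thesis using 1 by blast
    next
      case 2
      then have "M = B" using M assms(2) Mv ED[OF 2(3)] by (intro eqI) auto
      then show ?thesis using 2 by blast
    next
      case 3
      have F3: "A $$ (c', l') + of_bool ((c', l') = (c2, l2)) =
          B $$ (c', l') + of_bool ((c', l') = (c, l))" if "c' < r" "l' < k - 1" for c' l'
        using 3(6) that unfolding F_def by blast
      have "E A M c2 l2" "E B M c l" unfolding E_def
        using Mv F3 3(5) by (force simp: of_bool_def max_def split: if_splits)+
      then show ?thesis using 3(1-4) by blast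
    qed
  next
    assume "(M = A \<or> (\<exists>c<r. \<exists>l<k - 1. E A M c l)) \<and> (M = B \<or> (\<exists>c<r. \<exists>l<k - 1. E B M c l))"
    then consider "M = A" "M = B" | c l where "M = A" "c < r" "l < k - 1" "E B M c l"
      | c l where "M = B" "c < r" "l < k - 1" "E A M c l"
      | c l c2 l2 where "c < r" "l < k - 1" "c2 < r" "l2 < k - 1" "E B M c l" "E A M c2 l2"
      by blast
    then show "G_adj k r A B"
    proof cases
      case 1
      then show ?thesis using assms(3) by simp
    next
      case 2
      then show ?thesis unfolding adj by blast
    next
      case 3
      then show ?thesis unfolding adj by blast
    next
      case 4
      \<comment> \<open>If both were raised at the same place to give \<open>M\<close>, they would
        be equal.\<close>
      have "(c, l) \<noteq> (c2, l2)"
      proof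
        assume "(c, l) = (c2, l2)"
        then have "A = B" using ED[OF 4(5)] ED[OF 4(6)] assms by (intro eqI) auto
        then show False using assms(3) by simp
      qed
      moreover have "F c l c2 l2" unfolding F_def using ED[OF 4(5)] ED[OF 4(6)] by metis
      ultimately show ?thesis unfolding adj using 4(1-4) by blast
    qed
  qed
  then show ?thesis using sub assms(3) by (simp add: G_mult_def)
qed

text \<open>The unchanged shape accounts for the summand 1. A box can be added only to the leftmost
  among the columns of equal height, and only if that height is below j - 1. So for each colour the
  addable boxes correspond to the distinct entries less than j - 1.\<close>

lemma G_mult_loop:
  assumes "A \<in> GV"
  shows "G_mult j k r A A = card {S \<in> YD. le_one (mat_diagram A) S}"
proof -
  let ?D = "mat_diagram A"
  define P where "P = {x. x \<notin> ?D \<and> insert x ?D \<in> YD}"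
  have P_iff: "(c, a, l) \<in> P \<longleftrightarrow> c < r \<and> a < j - 1 \<and> l < k - 1 \<and> int a = A $$ (c, l) \<and>
    (\<forall>l'<l. A $$ (c, l) < A $$ (c, l'))" for c a l
  proof
    assume "(c, a, l) \<in> P"
    then have n: "(c, a, l) \<notin> ?D" and y: "insert (c, a, l) ?D \<in> YD" by (auto simp: P_def)
    have b: "c < r" "a < j - 1" "l < k - 1" using y by (auto simp: young_def)
    have ge: "A $$ (c, l) \<le> int a" using n b mat_diagram_iff[OF assms] by auto
    have "int a \<le> A $$ (c, l)"
    proof (cases a)
      case 0
      then show ?thesis using G_vertsD(4)[OF assms b(1,3)] by simp
    next
      case (Suc a')
      then have "(c, a', l) \<in> ?D" using young_down[OF y, of c a l a' l] by auto
      then show ?thesis using mat_diagram_iff[OF assms] Suc by auto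
    qed
    moreover have "int a < A $$ (c, l')" if "l' < l" for l'
    proof -
      have "(c, a, l') \<in> ?D" using young_down[OF y, of c a l a l'] that by auto
      then show ?thesis using mat_diagram_iff[OF assms] by auto
    qed
    ultimately show "c < r \<and> a < j - 1 \<and> l < k - 1 \<and> int a = A $$ (c, l) \<and>
      (\<forall>l'<l. A $$ (c, l) < A $$ (c, l'))" using b ge by auto
  next
    assume *: "c < r \<and> a < j - 1 \<and> l < k - 1 \<and> int a = A $$ (c, l) \<and>
      (\<forall>l'<l. A $$ (c, l) < A $$ (c, l'))"
    have "(c, a', l') \<in> insert (c, a, l) ?D" if "a' \<le> a" "l' \<le> l" for a' l'
    proof (cases "l' = l")
      case True
      then show ?thesis using * that mat_diagram_iff[OF assms, of c a' l'] by auto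
    next
      case False
      then have "int a' < A $$ (c, l')" using * that by (auto dest!: spec[of _ l'])
      then show ?thesis using * that False mat_diagram_iff[OF assms, of c a' l'] by auto
    qed
    moreover have "?D \<in> YD" using mat_diagram_young[OF assms] .
    ultimately have "insert (c, a, l) ?D \<in> YD" using * unfolding young_def by auto
    moreover have "(c, a, l) \<notin> ?D" using * mat_diagram_iff[OF assms] by auto
    ultimately show "(c, a, l) \<in> P" by (simp add: P_def)
  qed
  have finP: "finite P"
    by (rule finite_subset[of _ "{..<r} \<times> {..<j - 1} \<times> {..<k - 1}"]) (use P_iff in auto)
  have "{S \<in> YD. le_one ?D S} = insert ?D ((\<lambda>x. insert x ?D) ` P)"
    using mat_diagram_young[OF assms] by (auto simp: le_one_def P_def)
  moreover have "?D \<notin> (\<lambda>x. insert x ?D) ` P" by (auto simp: P_def)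
  moreover have "inj_on (\<lambda>x. insert x ?D) P"
  proof (rule inj_onI)
    fix x y assume "x \<in> P" "y \<in> P" "insert x ?D = insert y ?D"
    then have "x \<in> insert y ?D" "x \<notin> ?D" by (auto simp: P_def)
    then show "x = y" by blast
  qed
  ultimately have card: "card {S \<in> YD. le_one ?D S} = Suc (card P)"
    using finP by (simp add: card_image)
  let ?R = "\<lambda>c. {A $$ (c, l) | l. l < k - 1 \<and> A $$ (c, l) < int j - 1}"
  have "bij_betw (\<lambda>(c, a, l). (c, int a)) P (SIGMA c:{..<r}. ?R c)"
    unfolding bij_betw_def
  proof
    show "inj_on (\<lambda>(c, a, l). (c, int a)) P"
    proof (rule inj_onI)
      fix x y assume xy: "x \<in> P" "y \<in> P"
        "(\<lambda>(c, a, l). (c, int a)) x = (\<lambda>(c, a, l). (c, int a)) y"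
      obtain c a l c' a' l' where x: "x = (c, a, l)" and y: "y = (c', a', l')"
        by (cases x; cases y) auto
      have e: "c = c'" "a = a'" using xy(3) by (auto simp: x y)
      have "\<not> l < l'" "\<not> l' < l" using xy(1,2) unfolding x y P_iff e by (metis less_irrefl)+
      then show "x = y" using x y e by simp
    qed
    have ex: "\<exists>a l. (c, a, l) \<in> P \<and> int a = v" if c: "c < r" and v: "v \<in> ?R c" for c v
    proof -
      have exl: "\<exists>l. l < k - 1 \<and> A $$ (c, l) = v" using v by blast
      \<comment> \<open>The leftmost column of height \<open>v\<close>.\<close>
      define l where "l = (LEAST l. l < k - 1 \<and> A $$ (c, l) = v)"
      have l: "l < k - 1" "A $$ (c, l) = v" using LeastI_ex[OF exl] by (auto simp: l_def)
      have "A $$ (c, l) < A $$ (c, l')" if "l' < l" for l'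
      proof -
        have "A $$ (c, l') \<noteq> v" using not_less_Least[OF that[unfolded l_def]] l(1) that by auto
        then show ?thesis using G_vertsD(6)[OF assms c l(1), of l'] that l(2) by simp
      qed
      moreover have "0 \<le> v" using G_vertsD(4)[OF assms c l(1)] l(2) by simp
      moreover have "v < int j - 1" using v by blast
      ultimately have "(c, nat v, l) \<in> P" using l c by (simp add: P_iff; linarith)
      then show ?thesis using \<open>0 \<le> v\<close> by (intro exI[of _ "nat v"] exI[of _ l]) simp
    qed
    have into: "int a \<in> ?R c" if "(c, a, l) \<in> P" for c a l
    proof -
      have "int a < int j - 1" using that P_iff by auto
      then show ?thesis using that P_iff by auto
    qed
    show "(\<lambda>(c, a, l). (c, int a)) ` P = (SIGMA c:{..<r}. ?R c)"
    proof (intro subset_antisym subsetI)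
      fix y assume "y \<in> (\<lambda>(c, a, l). (c, int a)) ` P"
      then obtain c a l where cal: "(c, a, l) \<in> P" "y = (c, int a)" by auto
      have "c < r" using cal(1) P_iff by blast
      then show "y \<in> (SIGMA c:{..<r}. ?R c)" using into[OF cal(1)] cal(2) by blast
    next
      fix y assume y: "y \<in> (SIGMA c:{..<r}. ?R c)"
      then have "fst y < r" "snd y \<in> ?R (fst y)" by auto
      from ex[OF this] obtain a l where "(fst y, a, l) \<in> P" "int a = snd y" by blast
      then show "y \<in> (\<lambda>(c, a, l). (c, int a)) ` P" by (intro image_eqI[of _ _ "(fst y, a, l)"]) auto
    qed
  qed
  then have "card P = card (SIGMA c:{..<r}. ?R c)" by (rule bij_betw_same_card)
  also have "\<dots> = (\<Sum>c<r. card (?R c))" by (intro card_SigmaI) auto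
  finally show ?thesis using card by (simp add: G_mult_def)
qed

lemma G_mult_eq:
  assumes "A \<in> GV" "B \<in> GV"
  shows "G_mult j k r A B = card {S \<in> YD. le_one (mat_diagram A) S \<and> le_one (mat_diagram B) S}"
  using G_mult_ne[OF assms] G_mult_loop[OF assms(1)] by (cases "A = B") auto

section \<open>Walks as sequences of shapes\<close>

definition walks :: "nat \<Rightarrow> int mat \<Rightarrow> (int mat set \<times> nat) list set" where
  "walks m A = {es. walk (G_graph j k r) A es (0\<^sub>m r (k - 1)) \<and> length es = m}"

lemma walks_Suc:
  assumes "A \<in> GV"
  shows "walks (Suc m) A = (\<Union>(B, t)\<in>(SIGMA B:GV. {..<G_mult j k r A B}). (#) ({A, B}, t) ` walks m B)"
proof (intro subset_antisym subsetI)
  fix es assume "es \<in> walks (Suc m) A"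
  then obtain e es' where e: "es = e # es'" "length es' = m" and
    w: "walk (G_graph j k r) A (e # es') (0\<^sub>m r (k - 1))"
    by (auto simp: walks_def length_Suc_conv)
  have "ends (G_graph j k r) = fst" by (simp add: G_graph_def)
  then obtain B where e': "e \<in> edges (G_graph j k r)" "fst e = {A, B}"
    "walk (G_graph j k r) B es' (0\<^sub>m r (k - 1))"
    using w by auto
  obtain A1 A2 t where t: "e = ({A1, A2}, t)" "A1 \<in> GV" "A2 \<in> GV" "t < G_mult j k r A1 A2"
    using e'(1) by (auto simp: G_graph_def)
  have "{A1, A2} = {A, B}" using e'(2) t(1) by simp
  \<comment> \<open>An edge stores an unordered pair and may have been formed with its ends
    exchanged; the symmetry of \<open>G_mult\<close> carries the bound on \<open>t\<close>
    over.\<close>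
  then have "(A1 = A \<and> A2 = B) \<or> (A1 = B \<and> A2 = A)" by (auto simp: doubleton_eq_iff)
  then have "B \<in> GV" "t < G_mult j k r A B" using t G_mult_sym[OF t(2,3)] by auto
  moreover have "e = ({A, B}, t)" using t(1) e'(2) by simp
  ultimately show "es \<in> (\<Union>(B, t)\<in>(SIGMA B:GV. {..<G_mult j k r A B}). (#) ({A, B}, t) ` walks m B)"
    using e e'(3) by (auto simp: walks_def)
next
  fix es assume "es \<in> (\<Union>(B, t)\<in>(SIGMA B:GV. {..<G_mult j k r A B}). (#) ({A, B}, t) ` walks m B)"
  then obtain B t es' where "B \<in> GV" "t < G_mult j k r A B" "es' \<in> walks m B" "es = ({A, B}, t) # es'"
    by auto
  then show "es \<in> walks (Suc m) A" using assms by (auto simp: walks_def G_graph_def)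
qed

text \<open>A step of a walk adds and then removes, whereas a round of \<open>vac_count\<close>
  removes and then adds. The two are out of phase by half a step, which is the sum over the shapes
  \<open>S\<close> that exceed the diagram of \<open>A\<close> by at most one box.\<close>

lemma card_walks:
  assumes "A \<in> GV"
  shows "finite (walks m A) \<and>
    card (walks m A) = (\<Sum>S\<in>{S \<in> YD. le_one (mat_diagram A) S}. vac_count r (j - 1) (k - 1) m S)"
  using assms
proof (induction m arbitrary: A)
  case 0
  have "walks 0 A = (if A = 0\<^sub>m r (k - 1) then {[]} else {})"
    using 0 by (auto simp: walks_def G_graph_def)
  moreover have "mat_diagram A = {} \<longleftrightarrow> A = 0\<^sub>m r (k - 1)"
    using bij_mat_diagram 0 zero_mat_G_verts mat_diagram_zero unfolding bij_betw_def inj_on_def by metis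
  moreover have "(\<Sum>S\<in>{S \<in> YD. le_one (mat_diagram A) S}. of_bool (S = {}) :: nat) = of_bool (mat_diagram A = {})"
  proof -
    have "{S \<in> YD. le_one (mat_diagram A) S} \<inter> {S. S = {}} = (if mat_diagram A = {} then {{}} else {})"
      by (auto simp: le_one_def young_def)
    then show ?thesis using finite_young by (simp add: sum_of_bool_eq)
  qed
  ultimately show ?case by auto
next
  case (Suc m)
  let ?C = "vac_count r (j - 1) (k - 1)"
  let ?H = "\<lambda>m S. \<Sum>S2\<in>{S2 \<in> YD. le_one S S2}. ?C m S2"
  let ?I = "SIGMA B:GV. {..<G_mult j k r A B}"
  let ?f = "\<lambda>x. (#) ({A, fst x}, snd x) ` walks m (fst x)"
  have W: "walks (Suc m) A = (\<Union>x\<in>?I. ?f x)"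
    using walks_Suc[OF Suc.prems] by (auto simp: case_prod_beta)
  have finI: "finite ?I" using finite_G_verts by auto
  have finf: "finite (?f x)" if "x \<in> ?I" for x using that Suc.IH by auto
  have "card (walks (Suc m) A) = (\<Sum>x\<in>?I. card (?f x))"
    unfolding W
    by (rule card_UN_disjoint[OF finI]) (use finf in \<open>auto simp: doubleton_eq_iff\<close>)
  also have "\<dots> = (\<Sum>x\<in>?I. ?H m (mat_diagram (fst x)))"
    using Suc.IH by (intro sum.cong refl) (auto simp: card_image)
  also have "\<dots> = (\<Sum>B\<in>GV. \<Sum>t<G_mult j k r A B. ?H m (mat_diagram B))"
    using sum.Sigma[of GV "\<lambda>B. {..<G_mult j k r A B}" "\<lambda>B t. ?H m (mat_diagram B)"] finite_G_verts
    by (simp add: case_prod_beta)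
  also have "\<dots> = (\<Sum>B\<in>GV. card {S \<in> YD. le_one (mat_diagram A) S \<and> le_one (mat_diagram B) S} * ?H m (mat_diagram B))"
    using G_mult_eq[OF Suc.prems] by (intro sum.cong) auto
  also have "\<dots> = (\<Sum>S1\<in>YD. card {S \<in> YD. le_one (mat_diagram A) S \<and> le_one S1 S} * ?H m S1)"
    by (rule sum.reindex_bij_betw[OF bij_mat_diagram])
  also have "\<dots> = (\<Sum>S1\<in>YD. \<Sum>S\<in>{S \<in> {S \<in> YD. le_one (mat_diagram A) S}. le_one S1 S}. ?H m S1)"
  proof (rule sum.cong[OF refl])
    fix S1
    have "{S \<in> {S \<in> YD. le_one (mat_diagram A) S}. le_one S1 S} =
      {S \<in> YD. le_one (mat_diagram A) S \<and> le_one S1 S}" by blast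
    then show "card {S \<in> YD. le_one (mat_diagram A) S \<and> le_one S1 S} * ?H m S1 =
      (\<Sum>S\<in>{S \<in> {S \<in> YD. le_one (mat_diagram A) S}. le_one S1 S}. ?H m S1)"
      by (simp only: sum_constant of_nat_id)
  qed
  \<comment> \<open>Summing first over the intermediate shape \<open>S\<close> and then over the
    next vertex turns multiplicities into two half steps.\<close>
  also have "\<dots> = (\<Sum>S\<in>{S \<in> YD. le_one (mat_diagram A) S}. \<Sum>S1\<in>{S1 \<in> YD. le_one S1 S}. ?H m S1)"
    using finite_young by (intro sum.swap_restrict) auto
  finally have "card (walks (Suc m) A) = ?H (Suc m) (mat_diagram A)" by simp
  moreover have "finite (walks (Suc m) A)" unfolding W using finI finf by blast
  ultimately show ?case by blast
qed

text \<open>The first half step is forced: nothing can be removed from the empty diagram.\<close>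

lemma card_zero_walks:
  "card (walks m (0\<^sub>m r (k - 1))) = vac_count r (j - 1) (k - 1) (Suc m) {}"
proof -
  have "{S1 \<in> YD. le_one S1 {}} = {{}}" by (auto simp: young_def le_one_def)
  then show ?thesis using card_walks[OF zero_mat_G_verts, of m] mat_diagram_zero by simp
qed

end

section \<open>Set partitions and their arcs\<close>

lemma partition_same_block:
  assumes "partition_on A P" "B \<in> P" "B' \<in> P" "x \<in> B" "x \<in> B'"
  shows "B = B'"
  using assms by (metis disjointD disjoint_iff partition_onD2)

lemma arcs_bounds:
  assumes "partition_on {1..n} P" "(a, b) \<in> arcs P"
  shows "1 \<le> a" "a < b" "b \<le> n"
proof -
  obtain B where B: "B \<in> P" "a \<in> B" "b \<in> B" "a < b" using assms(2) by (auto simp: arcs_def)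
  have "B \<subseteq> {1..n}" using partition_onD1[OF assms(1)] B(1) by blast
  then show "1 \<le> a" "a < b" "b \<le> n" using B by auto
qed

lemma arcs_right_unique:
  assumes "partition_on A P" "(a, b) \<in> arcs P" "(a, b') \<in> arcs P"
  shows "b = b'"
proof -
  obtain B where B: "B \<in> P" "a \<in> B" "b \<in> B" "a < b" "\<forall>m\<in>B. a < m \<longrightarrow> b \<le> m"
    using assms(2) by (auto simp: arcs_def)
  obtain B' where B': "B' \<in> P" "a \<in> B'" "b' \<in> B'" "a < b'" "\<forall>m\<in>B'. a < m \<longrightarrow> b' \<le> m"
    using assms(3) by (auto simp: arcs_def)
  have "B = B'" using partition_same_block[OF assms(1)] B(1,2) B'(1,2) by blast
  then show ?thesis using B B' by (meson le_antisym)
qed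

lemma arcs_left_unique:
  assumes "partition_on A P" "(a, b) \<in> arcs P" "(a', b) \<in> arcs P"
  shows "a = a'"
proof -
  obtain B where B: "B \<in> P" "a \<in> B" "b \<in> B" "a < b" "\<forall>m\<in>B. a < m \<longrightarrow> b \<le> m"
    using assms(2) by (auto simp: arcs_def)
  obtain B' where B': "B' \<in> P" "a' \<in> B'" "b \<in> B'" "a' < b" "\<forall>m\<in>B'. a' < m \<longrightarrow> b \<le> m"
    using assms(3) by (auto simp: arcs_def)
  have "B = B'" using partition_same_block[OF assms(1)] B(1,3) B'(1,3) by blast
  then show ?thesis using B B' by (metis leD linorder_neqE_nat)
qed

lemma arcs_rtrancl_block:
  assumes "partition_on A P" "B \<in> P" "x \<in> B" "(x, y) \<in> (arcs P)\<^sup>*"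
  shows "y \<in> B"
  using assms(4)
proof (induction rule: rtrancl_induct)
  case (step y z)
  then obtain B' where "B' \<in> P" "y \<in> B'" "z \<in> B'" by (auto simp: arcs_def)
  then show ?case using partition_same_block[OF assms(1,2)] step.IH by blast
qed (fact assms(3))

text \<open>The arc from \<open>x\<close> leads to the next element of the block, which does not
  pass beyond \<open>y\<close>; induction on the distance.\<close>

lemma block_arcs_rtrancl:
  assumes "B \<in> P" "x \<in> B" "y \<in> B" "x \<le> y"
  shows "(x, y) \<in> (arcs P)\<^sup>*"
  using assms(2,4)
proof (induction "y - x" arbitrary: x rule: less_induct)
  case less
  show ?case
  proof (cases "x = y")
    case False
    define z where "z = (LEAST m. m \<in> B \<and> x < m)"
    have ex: "y \<in> B \<and> x < y" using False less.prems assms(3) by simp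
    have z: "z \<in> B" "x < z" "\<And>m. m \<in> B \<Longrightarrow> x < m \<Longrightarrow> z \<le> m"
      using LeastI[of "\<lambda>m. m \<in> B \<and> x < m", OF ex] Least_le[of "\<lambda>m. m \<in> B \<and> x < m"]
      by (auto simp: z_def)
    have "(x, z) \<in> arcs P" unfolding arcs_def using assms(1) less.prems(1) z by blast
    moreover have "z \<le> y" using z(3) ex by blast
    then have "(z, y) \<in> (arcs P)\<^sup>*" using less.hyps[of z] z(1,2) ex by simp
    ultimately show ?thesis by (rule converse_rtrancl_into_rtrancl)
  qed simp
qed

text \<open>Two elements share a block precisely if one is reached from the other along arcs, so the
  arcs determine the equivalence relation and thereby its quotient.\<close>

lemma partition_arcs_inj:
  assumes "partition_on A P" "partition_on A P'" "arcs P = arcs P'"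
  shows "P = P'"
proof -
  have rel: "{(x, y). \<exists>p\<in>P. x \<in> p \<and> y \<in> p} =
      {(x, y). x \<in> A \<and> y \<in> A \<and> ((x, y) \<in> (arcs P)\<^sup>* \<or> (y, x) \<in> (arcs P)\<^sup>*)}"
    if P: "partition_on A P" for P :: "nat set set"
  proof -
    have "(x, y) \<in> (arcs P)\<^sup>* \<or> (y, x) \<in> (arcs P)\<^sup>*" if "p \<in> P" "x \<in> p" "y \<in> p" for p x y
      using block_arcs_rtrancl[OF that(1)] that(2,3) by (meson nat_le_linear)
    moreover have "\<exists>p\<in>P. x \<in> p \<and> y \<in> p"
      if "x \<in> A" "y \<in> A" "(x, y) \<in> (arcs P)\<^sup>* \<or> (y, x) \<in> (arcs P)\<^sup>*" for x y
      using that(3)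
    proof
      assume xy: "(x, y) \<in> (arcs P)\<^sup>*"
      obtain p where "p \<in> P" "x \<in> p" using partition_onD1[OF P] \<open>x \<in> A\<close> by blast
      then show ?thesis using arcs_rtrancl_block[OF P _ _ xy] by blast
    next
      assume yx: "(y, x) \<in> (arcs P)\<^sup>*"
      obtain p where "p \<in> P" "y \<in> p" using partition_onD1[OF P] \<open>y \<in> A\<close> by blast
      then show ?thesis using arcs_rtrancl_block[OF P _ _ yx] by blast
    qed
    moreover have "p \<subseteq> A" if "p \<in> P" for p using partition_onD1[OF P] that by blast
    ultimately show ?thesis by blast
  qed
  have "P = A // {(x, y). \<exists>p\<in>P. x \<in> p \<and> y \<in> p}" using partition_on_eq_quotient[OF assms(1)] by simp
  also have "\<dots> = A // {(x, y). \<exists>p\<in>P'. x \<in> p \<and> y \<in> p}"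
    unfolding rel[OF assms(1)] rel[OF assms(2)] assms(3) ..
  also have "\<dots> = P'" by (rule partition_on_eq_quotient[OF assms(2)])
  finally show ?thesis .
qed

text \<open>With at most one arc leaving and at most one entering each element, the graph of
  \<open>X\<close> consists of increasing paths. Being on the same path is an equivalence, and
  neighbours on a path are consecutive in their class.\<close>

lemma partition_arcs_surj:
  assumes bd: "\<And>a b. (a, b) \<in> X \<Longrightarrow> a \<in> A \<and> b \<in> A \<and> a < b"
    and right: "\<And>a b b'. (a, b) \<in> X \<Longrightarrow> (a, b') \<in> X \<Longrightarrow> b = b'"
    and left: "\<And>a a' b. (a, b) \<in> X \<Longrightarrow> (a', b) \<in> X \<Longrightarrow> a = a'"
  shows "\<exists>P. partition_on A P \<and> arcs P = (X :: (nat \<times> nat) set)"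
proof -
  define E where "E = {(x, y). x \<in> A \<and> y \<in> A \<and> ((x, y) \<in> X\<^sup>* \<or> (y, x) \<in> X\<^sup>*)}"
  have sv: "single_valued X" "single_valued (X\<inverse>)"
    using right left by (auto simp: single_valued_def)
  \<comment> \<open>Predecessors are unique, so any two elements that reach \<open>x\<close> lie on
    one path; dually for \<open>conf'\<close>. Together they give transitivity.\<close>
  have conf: "(y, z) \<in> X\<^sup>* \<or> (z, y) \<in> X\<^sup>*" if "(y, x) \<in> X\<^sup>*" "(z, x) \<in> X\<^sup>*" for x y z
    using single_valued_confluent[OF sv(2), of x y z] that by (auto simp: rtrancl_converse)
  have conf': "(y, z) \<in> X\<^sup>* \<or> (z, y) \<in> X\<^sup>*" if "(x, y) \<in> X\<^sup>*" "(x, z) \<in> X\<^sup>*" for x y z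
    using single_valued_confluent[OF sv(1) that] .
  have "equiv A E"
  proof (rule equivI)
    show "E \<subseteq> A \<times> A" by (auto simp: E_def)
    show "refl_on A E" by (auto simp: refl_on_def E_def)
    show "sym E" by (auto simp: sym_def E_def)
    show "trans E"
    proof (rule transI)
      fix x y z assume "(x, y) \<in> E" "(y, z) \<in> E"
      then have A: "x \<in> A" "z \<in> A" and xy: "(x, y) \<in> X\<^sup>* \<or> (y, x) \<in> X\<^sup>*"
        and yz: "(y, z) \<in> X\<^sup>* \<or> (z, y) \<in> X\<^sup>*" by (auto simp: E_def)
      have "(x, z) \<in> X\<^sup>* \<or> (z, x) \<in> X\<^sup>*"
        using xy yz conf[of x y z] conf'[of y x z] by (meson rtrancl_trans)
      then show "(x, z) \<in> E" using A by (simp add: E_def)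
    qed
  qed
  define P where "P = A // E"
  have P: "partition_on A P" unfolding P_def using \<open>equiv A E\<close> by (rule partition_on_quotient)
  have block: "(\<exists>B\<in>P. x \<in> B \<and> y \<in> B) \<longleftrightarrow> (x, y) \<in> E" for x y
  proof
    assume "\<exists>B\<in>P. x \<in> B \<and> y \<in> B"
    then show "(x, y) \<in> E"
      unfolding P_def using in_quotient_imp_in_rel[OF \<open>equiv A E\<close>] by blast
  next
    assume xy: "(x, y) \<in> E"
    then have "x \<in> A" by (simp add: E_def)
    then show "\<exists>B\<in>P. x \<in> B \<and> y \<in> B"
      unfolding P_def using xy quotientI[of x A E] equiv_class_self[OF \<open>equiv A E\<close>] by blast
  qed
  have le: "x \<le> y" if "(x, y) \<in> X\<^sup>*" for x y
    using that
  proof (induction rule: rtrancl_induct)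
    case (step y z)
    then show ?case using bd[of y z] by simp
  qed simp
  have "arcs P = X"
  proof (intro subset_antisym subrelI)
    fix a b assume "(a, b) \<in> arcs P"
    then obtain B where B: "B \<in> P" "a \<in> B" "b \<in> B" "a < b" "\<forall>m\<in>B. a < m \<longrightarrow> b \<le> m"
      by (auto simp: arcs_def)
    have "(a, b) \<in> E" using B block by blast
    then have "(a, b) \<in> X\<^sup>*" using le B(4) by (force simp: E_def)
    \<comment> \<open>The path from \<open>a\<close> to \<open>b\<close> starts with an arc to some
      \<open>z\<close> of the same block; \<open>b\<close> being the next element of the block
      forces z = b.\<close>
    then obtain z where z: "(a, z) \<in> X" "(z, b) \<in> X\<^sup>*" using B(4) by (metis converse_rtranclE less_irrefl)
    have "(a, z) \<in> E" using z(1) bd by (auto simp: E_def)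
    then have "z \<in> B" using block B(1,2) partition_same_block[OF P] by metis
    then have "b \<le> z" using B(5) bd z(1) by blast
    then show "(a, b) \<in> X" using le[OF z(2)] z(1) by simp
  next
    fix a b assume ab: "(a, b) \<in> X"
    then have "(a, b) \<in> E" using bd by (auto simp: E_def)
    then obtain B where B: "B \<in> P" "a \<in> B" "b \<in> B" using block by blast
    have "b \<le> m" if "m \<in> B" "a < m" for m
    proof -
      have "(a, m) \<in> E" using block B that by blast
      then have "(a, m) \<in> X\<^sup>*" using le that(2) by (force simp: E_def)
      then obtain z where z: "(a, z) \<in> X" "(z, m) \<in> X\<^sup>*" using \<open>a < m\<close> by (metis converse_rtranclE less_irrefl)
      then show ?thesis using right[OF ab z(1)] le by blast
    qed
    then show "(a, b) \<in> arcs P" unfolding arcs_def using B bd[OF ab] by blast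
  qed
  with P show ?thesis by blast
qed

text \<open>The arcs open at time t are listed by decreasing closers, so that nestings become
  increasing and crossings decreasing subsequences of their openers.\<close>

definition open_word :: "nat \<Rightarrow> (nat \<Rightarrow> (nat \<times> nat) option) \<Rightarrow> nat \<Rightarrow> nat \<Rightarrow> nat list" where
  "open_word n d t c =
     map (\<lambda>s. snd (the (d s))) (filter (\<lambda>s. \<exists>i\<le>t. d s = Some (c, i)) (rev [Suc t..<Suc n]))"

text \<open>As \<open>d\<close> is a function of the closer, no element closes two arcs. The last
  clause says that none opens two, even of different colours.\<close>

definition arc_fun :: "nat \<Rightarrow> nat \<Rightarrow> nat \<Rightarrow> (nat \<Rightarrow> (nat \<times> nat) option) \<Rightarrow> bool" where
  "arc_fun r t n d \<longleftrightarrow> (\<forall>s\<in>{t<..n}. \<forall>c i. d s = Some (c, i) \<longrightarrow> c < r \<and> 1 \<le> i \<and> i < s \<and>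
     (\<forall>s'\<in>{t<..n}. \<forall>c'. d s' = Some (c', i) \<longrightarrow> s' = s))"

section \<open>Words of open arcs and their tableaux\<close>

lemma set_open_word:
  "set (open_word n d t c) = {i. i \<le> t \<and> (\<exists>s\<in>{t<..n}. d s = Some (c, i))}"
proof (intro subset_antisym subsetI)
  fix i assume "i \<in> set (open_word n d t c)"
  then show "i \<in> {i. i \<le> t \<and> (\<exists>s\<in>{t<..n}. d s = Some (c, i))}"
    by (auto simp: open_word_def simp del: upt_Suc intro!: bexI)
next
  fix i assume "i \<in> {i. i \<le> t \<and> (\<exists>s\<in>{t<..n}. d s = Some (c, i))}"
  then obtain s where "i \<le> t" "t < s" "s \<le> n" "d s = Some (c, i)" by auto
  then show "i \<in> set (open_word n d t c)"
    unfolding open_word_def by (auto simp del: upt_Suc intro!: image_eqI[of _ _ s])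
qed

lemma arc_funD:
  assumes "arc_fun r t n d" "t < s" "s \<le> n" "d s = Some (c, i)"
  shows "c < r" "1 \<le> i" "i < s"
  using assms unfolding arc_fun_def by (meson greaterThanAtMost_iff)+

lemma arc_fun_unique:
  assumes "arc_fun r t n d" "t < s" "s \<le> n" "d s = Some (c, i)" "t < s'" "s' \<le> n" "d s' = Some (c', i)"
  shows "s' = s"
  using assms unfolding arc_fun_def by (meson greaterThanAtMost_iff)

lemma arc_fun_Suc:
  assumes "arc_fun r t n d"
  shows "arc_fun r (Suc t) n d"
  using assms arc_funD[OF assms] arc_fun_unique[OF assms] unfolding arc_fun_def[of r "Suc t"]
  by (meson Suc_lessD greaterThanAtMost_iff)

lemma distinct_open_word:
  assumes "arc_fun r t n d"
  shows "distinct (open_word n d t c)"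
  unfolding open_word_def distinct_map
proof
  show "inj_on (\<lambda>s. snd (the (d s))) (set (filter (\<lambda>s. \<exists>i\<le>t. d s = Some (c, i)) (rev [Suc t..<Suc n])))"
  proof (rule inj_onI)
    fix s s'
    assume s: "s \<in> set (filter (\<lambda>s. \<exists>i\<le>t. d s = Some (c, i)) (rev [Suc t..<Suc n]))"
      and s': "s' \<in> set (filter (\<lambda>s. \<exists>i\<le>t. d s = Some (c, i)) (rev [Suc t..<Suc n]))"
      and eq: "snd (the (d s)) = snd (the (d s'))"
    obtain i i' where i: "d s = Some (c, i)" "d s' = Some (c, i')"
      using s s' by (auto simp del: upt_Suc)
    have "t < s" "s \<le> n" "t < s'" "s' \<le> n" using s s' by (auto simp del: upt_Suc)
    then show "s = s'" using arc_fun_unique[OF assms, of s' c i s c] i eq by simp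
  qed
qed simp

text \<open>Going back from t + 1 to t, an arc opened at t + 1 disappears, and the arc closing at t
  + 1 joins at the end, having the smallest closer of all open arcs.\<close>

lemma open_word_step:
  assumes "arc_fun r t n d" "t < n"
  shows "open_word n d t c = filter (\<lambda>x. x \<noteq> Suc t) (open_word n d (Suc t) c) @
    (case d (Suc t) of None \<Rightarrow> [] | Some (c', i) \<Rightarrow> if c' = c then [i] else [])"
proof -
  have upt: "rev [Suc t..<Suc n] = rev [Suc (Suc t)..<Suc n] @ [Suc t]"
    using assms(2) by (simp add: upt_conv_Cons del: upt_Suc)
  have "filter (\<lambda>s. \<exists>i\<le>t. d s = Some (c, i)) (rev [Suc (Suc t)..<Suc n]) =
    filter (\<lambda>s. snd (the (d s)) \<noteq> Suc t)
      (filter (\<lambda>s. \<exists>i\<le>Suc t. d s = Some (c, i)) (rev [Suc (Suc t)..<Suc n]))"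
    unfolding filter_filter by (rule filter_cong) (auto simp: le_Suc_eq)
  \<comment> \<open>The test \<open>i \<le> t\<close> holds by itself, because an opener precedes
    its closer \<open>Suc t\<close>.\<close>
  moreover have "map (\<lambda>s. snd (the (d s))) (filter (\<lambda>s. \<exists>i\<le>t. d s = Some (c, i)) [Suc t]) =
    (case d (Suc t) of None \<Rightarrow> [] | Some (c', i) \<Rightarrow> if c' = c then [i] else [])"
    using arc_funD(3)[OF assms(1), of "Suc t"] assms(2) by (fastforce split: option.splits)
  ultimately show ?thesis unfolding open_word_def upt by (simp add: filter_map o_def del: upt_Suc)
qed

lemma word_state_open_word:
  assumes "t \<le> n" "arc_fun r t n d"
  shows "word_state t (map d [Suc t..<Suc n]) = (\<lambda>c. insertion_tableau (open_word n d t c))"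
  using assms
proof (induction rule: inc_induct)
  case base
  then show ?case by (simp add: open_word_def insertion_tableau_def)
next
  case (step t)
  have af: "arc_fun r (Suc t) n d" using step.prems by (rule arc_fun_Suc)
  have upt: "map d [Suc t..<Suc n] = d (Suc t) # map d [Suc (Suc t)..<Suc n]"
    using step.hyps by (simp add: upt_conv_Cons del: upt_Suc)
  have del: "delete_entry (Suc t) (word_state (Suc t) (map d [Suc (Suc t)..<Suc n])) =
    (\<lambda>c. insertion_tableau (filter (\<lambda>x. x \<noteq> Suc t) (open_word n d (Suc t) c)))"
    unfolding step.IH[OF af] delete_entry_def
    using insertion_tableau_delete_greatest[OF distinct_open_word[OF af]]
    by (simp add: set_open_word fun_eq_iff)
  show ?case
  proof
    fix c
    show "word_state t (map d [Suc t..<Suc n]) c = insertion_tableau (open_word n d t c)"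
      unfolding upt word_state.simps del open_word_step[OF step.prems step.hyps(2)]
      by (auto simp: insert_choice_def insertion_tableau_snoc split: option.splits)
  qed
qed

lemma word_ok_iff:
  assumes "t \<le> n"
  shows "word_ok r p q t (map d [Suc t..<Suc n]) \<longleftrightarrow> arc_fun r t n d \<and>
    (\<forall>u\<in>{t..<n}. shape (\<lambda>c. insertion_tableau (open_word n d u c)) \<subseteq> {..<r} \<times> {..<p} \<times> {..<q})"
  using assms
proof (induction rule: inc_induct)
  case base
  then show ?case by (simp add: arc_fun_def)
next
  case (step t)
  let ?B = "\<lambda>u. shape (\<lambda>c. insertion_tableau (open_word n d u c)) \<subseteq> {..<r} \<times> {..<p} \<times> {..<q}"
  have upt: "map d [Suc t..<Suc n] = d (Suc t) # map d [Suc (Suc t)..<Suc n]"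
    using step.hyps by (simp add: upt_conv_Cons del: upt_Suc)
  have af: "arc_fun r (Suc t) n d \<and>
      choice_ok r t (d (Suc t)) (word_state (Suc t) (map d [Suc (Suc t)..<Suc n])) \<longleftrightarrow> arc_fun r t n d"
  proof (cases "arc_fun r (Suc t) n d")
    case True
    have ins: "{t<..n} = insert (Suc t) {Suc t<..n}" using step.hyps by auto
    have ent: "(\<exists>a. i \<in> insertion_tableau (open_word n d (Suc t) c) a) \<longleftrightarrow>
        i \<le> Suc t \<and> (\<exists>s\<in>{Suc t<..n}. d s = Some (c, i))" for i c
      using entries_insertion_tableau[OF distinct_open_word[OF True], of c] set_open_word[of n d "Suc t" c]
      by blast
    have "choice_ok r t (d (Suc t)) (word_state (Suc t) (map d [Suc (Suc t)..<Suc n])) \<longleftrightarrow>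
      (\<forall>c i. d (Suc t) = Some (c, i) \<longrightarrow> c < r \<and> 1 \<le> i \<and> i \<le> t \<and>
        (\<forall>s\<in>{Suc t<..n}. \<forall>c'. d s \<noteq> Some (c', i)))"
      unfolding choice_ok_def word_state_open_word[OF Suc_leI[OF step.hyps(2)] True]
      using ent by (meson le_SucI)
    also have "\<dots> \<longleftrightarrow> arc_fun r t n d"
    proof
      assume new: "\<forall>c i. d (Suc t) = Some (c, i) \<longrightarrow> c < r \<and> 1 \<le> i \<and> i \<le> t \<and>
        (\<forall>s\<in>{Suc t<..n}. \<forall>c'. d s \<noteq> Some (c', i))"
      show "arc_fun r t n d" unfolding arc_fun_def
      proof (intro ballI allI impI)
        fix s c i assume s: "s \<in> {t<..n}" "d s = Some (c, i)"
        have "s' = s" if "s' \<in> {t<..n}" "d s' = Some (c', i)" for s' c'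
          using s that new arc_fun_unique[OF True, of s c i s' c'] unfolding ins by auto
        moreover have "c < r \<and> 1 \<le> i \<and> i < s"
          using s new arc_funD[OF True, of s c i] unfolding ins by auto
        ultimately show "c < r \<and> 1 \<le> i \<and> i < s \<and>
          (\<forall>s'\<in>{t<..n}. \<forall>c'. d s' = Some (c', i) \<longrightarrow> s' = s)" by blast
      qed
    next
      assume af: "arc_fun r t n d"
      show "\<forall>c i. d (Suc t) = Some (c, i) \<longrightarrow> c < r \<and> 1 \<le> i \<and> i \<le> t \<and>
        (\<forall>s\<in>{Suc t<..n}. \<forall>c'. d s \<noteq> Some (c', i))"
      proof (intro allI impI)
        fix c i assume d: "d (Suc t) = Some (c, i)"
        have "d s \<noteq> Some (c', i)" if "s \<in> {Suc t<..n}" for s c'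
          using arc_fun_unique[OF af _ _ d, of s c'] step.hyps(2) that by auto
        then show "c < r \<and> 1 \<le> i \<and> i \<le> t \<and> (\<forall>s\<in>{Suc t<..n}. \<forall>c'. d s \<noteq> Some (c', i))"
          using arc_funD[OF af _ _ d] step.hyps(2) by auto
      qed
    qed
    finally show ?thesis using True by simp
  next
    case False
    then show ?thesis using arc_fun_Suc by blast
  qed
  have "word_ok r p q t (map d [Suc t..<Suc n]) \<longleftrightarrow> (\<forall>u\<in>{Suc t..<n}. ?B u) \<and> arc_fun r t n d \<and>
    shape (word_state t (map d [Suc t..<Suc n])) \<subseteq> {..<r} \<times> {..<p} \<times> {..<q}"
    using step.IH af unfolding upt word_ok.simps by blast
  also have "\<dots> \<longleftrightarrow> (\<forall>u\<in>{Suc t..<n}. ?B u) \<and> arc_fun r t n d \<and> ?B t"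
    using word_state_open_word[of t n r d] step.hyps by auto
  also have "\<dots> \<longleftrightarrow> arc_fun r t n d \<and> (\<forall>u\<in>{t..<n}. ?B u)"
  proof -
    have "{t..<n} = insert t {Suc t..<n}" using step.hyps by auto
    then show ?thesis by auto
  qed
  finally show ?case .
qed

text \<open>With numbering from 0, a box in row \<open>p\<close> means a decreasing chain of length
  \<open>Suc p\<close>, and a box in column \<open>q\<close> an increasing chain of length
  \<open>Suc q\<close>. The words of colours from \<open>r\<close> on are empty.\<close>

lemma shape_insertion_tableau:
  assumes "\<And>c. distinct (w c)" "\<And>c. r \<le> c \<Longrightarrow> w c = []"
  shows "shape (\<lambda>c. insertion_tableau (w c)) \<subseteq> {..<r} \<times> {..<p} \<times> {..<q} \<longleftrightarrow>
    (\<forall>c. \<not> has_chain (>) (Suc p) (w c) \<and> \<not> has_chain (<) (Suc q) (w c))"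
proof -
  have T: "tableau (insertion_tableau (w c))" for c using assms(1) tableau_insertion_tableau by blast
  have fin: "finite (insertion_tableau (w c) a)" for c a using T tableau_finite by blast
  show ?thesis unfolding schensted_inc[OF assms(1)] schensted_dec[OF assms(1)]
  proof
    assume sub: "shape (\<lambda>c. insertion_tableau (w c)) \<subseteq> {..<r} \<times> {..<p} \<times> {..<q}"
    show "\<forall>c. \<not> insertion_tableau (w c) p \<noteq> {} \<and> \<not> Suc q \<le> card (insertion_tableau (w c) 0)"
    proof (intro allI conjI notI)
      fix c assume "insertion_tableau (w c) p \<noteq> {}"
      then have "(c, p, 0) \<in> shape (\<lambda>c. insertion_tableau (w c))"
        using fin by (simp add: shape_def card_gt_0_iff)
      then show False using sub by auto
    next
      fix c assume "Suc q \<le> card (insertion_tableau (w c) 0)"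
      then have "(c, 0, q) \<in> shape (\<lambda>c. insertion_tableau (w c))" by (simp add: shape_def)
      then show False using sub by auto
    qed
  next
    assume *: "\<forall>c. \<not> insertion_tableau (w c) p \<noteq> {} \<and> \<not> Suc q \<le> card (insertion_tableau (w c) 0)"
    show "shape (\<lambda>c. insertion_tableau (w c)) \<subseteq> {..<r} \<times> {..<p} \<times> {..<q}"
    proof
      fix x assume "x \<in> shape (\<lambda>c. insertion_tableau (w c))"
      then obtain c a b where x: "x = (c, a, b)" "b < card (insertion_tableau (w c) a)"
        by (auto simp: shape_def)
      have "insertion_tableau (w c) a \<noteq> {}" using x(2) by auto
      moreover from this have "c < r" using assms(2)[of c] by (auto simp: insertion_tableau_def not_less[symmetric])
      moreover have "a < p" using * tableau_nonempty_mono[OF T, of p a c] calculation(1) by (meson not_less)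
      moreover have "b < q" using * tableau_card_mono[OF T, of 0 a c] x(2)
        by (meson le_trans less_le_trans not_less_eq_eq le0)
      ultimately show "x \<in> {..<r} \<times> {..<p} \<times> {..<q}" using x(1) by simp
    qed
  qed
qed

lemma subseq_map_conv: "subseq s (map f xs) \<longleftrightarrow> (\<exists>ys. subseq ys xs \<and> s = map f ys)"
  unfolding subseq_conv_nths by (auto simp: nths_map)

lemma strict_decreasing_subseq:
  fixes xs :: "nat list"
  assumes "set xs \<subseteq> set ys" "sorted_wrt (>) xs" "sorted_wrt (>) ys"
  shows "subseq xs ys"
  using assms
proof (induction xs arbitrary: ys)
  case (Cons x xs)
  then obtain us vs where ys: "ys = us @ x # vs" by (metis list.set_intros(1) split_list subsetD)
  have "set xs \<subseteq> set vs" using Cons.prems by (fastforce simp: ys sorted_wrt_append)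
  then have "subseq xs vs" using Cons by (simp add: ys sorted_wrt_append)
  then show ?case by (simp add: ys subseq_drop_many)
qed simp

lemma subseq_filter_rev_upt:
  "subseq ys (filter Q (rev [a..<b])) \<longleftrightarrow> sorted_wrt (>) ys \<and> (\<forall>y\<in>set ys. a \<le> y \<and> y < b \<and> Q y)"
proof
  assume "subseq ys (filter Q (rev [a..<b]))"
  then show "sorted_wrt (>) ys \<and> (\<forall>y\<in>set ys. a \<le> y \<and> y < b \<and> Q y)"
    using sorted_wrt_subseq[of ys _ "(>)"] subseq_set[of ys]
    by (fastforce simp: sorted_wrt_rev sorted_wrt_filter)
next
  assume ys: "sorted_wrt (>) ys \<and> (\<forall>y\<in>set ys. a \<le> y \<and> y < b \<and> Q y)"
  show "subseq ys (filter Q (rev [a..<b]))"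
    using ys by (intro strict_decreasing_subseq) (auto simp: sorted_wrt_rev sorted_wrt_filter)
qed

text \<open>A chain of openers is described by the decreasing list \<open>ss\<close> of the closers
  of its arcs.\<close>

lemma has_chain_open_word:
  "has_chain R m (open_word n d t c) \<longleftrightarrow> (\<exists>ss. sorted_wrt (>) ss \<and> length ss = m \<and>
    sorted_wrt R (map (\<lambda>s. snd (the (d s))) ss) \<and>
    (\<forall>s\<in>set ss. t < s \<and> s \<le> n \<and> (\<exists>i\<le>t. d s = Some (c, i))))"
  unfolding has_chain_def open_word_def subseq_map_conv subseq_filter_rev_upt
  by (auto simp: Suc_le_eq less_Suc_eq_le)

section \<open>Colored partitions, crossings and nestings in terms of open words\<close>

text \<open>Colours of partitions are 1, ..., r, those of tableaux 0, ..., r - 1; hence the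
  subtraction.\<close>

definition arc_choice :: "nat set set \<times> coloring \<Rightarrow> nat \<Rightarrow> (nat \<times> nat) option" where
  "arc_choice \<Lambda> s = (if \<exists>i. (i, s) \<in> arcs (fst \<Lambda>)
     then let i = (THE i. (i, s) \<in> arcs (fst \<Lambda>)) in Some (snd \<Lambda> (i, s) - 1, i) else None)"

lemma arc_choice_iff:
  assumes "partition_on A P"
  shows "arc_choice (P, \<phi>) s = Some (c, i) \<longleftrightarrow> (i, s) \<in> arcs P \<and> c = \<phi> (i, s) - 1"
proof (cases "\<exists>i. (i, s) \<in> arcs P")
  case True
  then obtain i' where i': "(i', s) \<in> arcs P" by blast
  have "(THE i. (i, s) \<in> arcs P) = i'"
    using i' arcs_left_unique[OF assms] by (intro the_equality) blast+
  then show ?thesis using i' arcs_left_unique[OF assms i', of i]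
    by (auto simp: arc_choice_def Let_def)
qed (auto simp: arc_choice_def)

lemma colored_partitionsD:
  assumes "(P, \<phi>) \<in> colored_partitions n r"
  shows "partition_on {1..n} P" "\<phi> \<in> arcs P \<rightarrow>\<^sub>E {1..r}"
    "\<And>x. x \<in> arcs P \<Longrightarrow> 1 \<le> \<phi> x" "\<And>x. x \<in> arcs P \<Longrightarrow> \<phi> x \<le> r"
proof -
  show "partition_on {1..n} P" and phi: "\<phi> \<in> arcs P \<rightarrow>\<^sub>E {1..r}"
    using assms by (auto simp: colored_partitions_def)
  show "1 \<le> \<phi> x" "\<phi> x \<le> r" if "x \<in> arcs P" for x using PiE_mem[OF phi that] by auto
qed

lemma arc_fun_arc_choice:
  assumes "(P, \<phi>) \<in> colored_partitions n r"
  shows "arc_fun r 0 n (arc_choice (P, \<phi>))"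
  unfolding arc_fun_def
proof (intro ballI allI impI)
  note D = colored_partitionsD[OF assms]
  fix s c i assume "s \<in> {0<..n}" "arc_choice (P, \<phi>) s = Some (c, i)"
  then have a: "(i, s) \<in> arcs P" "c = \<phi> (i, s) - 1" using arc_choice_iff[OF D(1)] by auto
  have "c < r" using D(3,4)[OF a(1)] a(2) by linarith
  moreover have "s' = s" if "arc_choice (P, \<phi>) s' = Some (c', i)" for s' c'
    using that arc_choice_iff[OF D(1)] arcs_right_unique[OF D(1)] a(1) by blast
  ultimately show "c < r \<and> 1 \<le> i \<and> i < s \<and>
    (\<forall>s'\<in>{0<..n}. \<forall>c'. arc_choice (P, \<phi>) s' = Some (c', i) \<longrightarrow> s' = s)"
    using arcs_bounds[OF D(1) a(1)] by blast
qed

lemma arc_list_chain: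
  assumes "(P, \<phi>) \<in> colored_partitions n r" "as \<noteq> []" "set as \<subseteq> arcs P" "monochromatic \<phi> as"
    "sorted_wrt (>) (map snd as)" "sorted_wrt R (map fst as)"
    "\<And>a b. a \<in> set as \<Longrightarrow> b \<in> set as \<Longrightarrow> fst a < snd b"
  shows "\<exists>t<n. \<exists>c. has_chain R (length as) (open_word n (arc_choice (P, \<phi>)) t c)"
proof -
  note D = colored_partitionsD[OF assms(1)]
  let ?d = "arc_choice (P, \<phi>)"
  obtain c where c: "\<And>a. a \<in> set as \<Longrightarrow> \<phi> a = c" using assms(4) by (auto simp: monochromatic_def)
  have d: "?d (snd a) = Some (c - 1, fst a)" if "a \<in> set as" for a
    using that c[OF that] assms(3) arc_choice_iff[OF D(1), of \<phi> "snd a" "c - 1" "fst a"] by auto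
  \<comment> \<open>At the last opener all arcs of the list are open, since every opener precedes
    every closer.\<close>
  define t where "t = Max (fst ` set as)"
  have le: "fst a \<le> t" if "a \<in> set as" for a using that by (simp add: t_def)
  have "t \<in> fst ` set as" unfolding t_def using assms(2) by (intro Max_in) auto
  then obtain a0 where a0: "a0 \<in> set as" "t = fst a0" by blast
  have bd: "t < snd a \<and> snd a \<le> n" if "a \<in> set as" for a
    using assms(7)[OF a0(1) that] a0(2) assms(3) that arcs_bounds(3)[OF D(1), of "fst a" "snd a"] by auto
  have "t < n" using bd[OF a0(1)] by simp
  moreover have "has_chain R (length as) (open_word n ?d t (c - 1))"
    unfolding has_chain_open_word
  proof (intro exI[of _ "map snd as"] conjI)
    have "map (\<lambda>s. snd (the (?d s))) (map snd as) = map fst as" using d by simp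
    then show "sorted_wrt R (map (\<lambda>s. snd (the (?d s))) (map snd as))" using assms(6) by (simp only:)
    show "\<forall>s\<in>set (map snd as). t < s \<and> s \<le> n \<and> (\<exists>i\<le>t. ?d s = Some (c - 1, i))"
      using d le bd by fastforce
  qed (use assms(5) in simp_all)
  ultimately show ?thesis by blast
qed

lemma chain_arc_list:
  assumes "(P, \<phi>) \<in> colored_partitions n r"
    "has_chain R m (open_word n (arc_choice (P, \<phi>)) t c)"
  shows "\<exists>as. length as = m \<and> set as \<subseteq> arcs P \<and> monochromatic \<phi> as \<and> sorted_wrt (>) (map snd as) \<and>
    sorted_wrt R (map fst as) \<and> (\<forall>a\<in>set as. \<forall>b\<in>set as. fst a < snd b)"
proof -
  note D = colored_partitionsD[OF assms(1)]
  let ?d = "arc_choice (P, \<phi>)"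
  obtain ss where ss: "sorted_wrt (>) ss" "length ss = m" "sorted_wrt R (map (\<lambda>s. snd (the (?d s))) ss)"
    "\<And>s. s \<in> set ss \<Longrightarrow> t < s \<and> s \<le> n \<and> (\<exists>i\<le>t. ?d s = Some (c, i))"
    using assms(2) unfolding has_chain_open_word by blast
  define as where "as = map (\<lambda>s. (snd (the (?d s)), s)) ss"
  have as: "fst a \<le> t \<and> t < snd a \<and> a \<in> arcs P \<and> \<phi> a = Suc c" if a: "a \<in> set as" for a
  proof -
    obtain s where s: "s \<in> set ss" "a = (snd (the (?d s)), s)" using a by (auto simp: as_def)
    obtain i where i: "i \<le> t" "?d s = Some (c, i)" "t < s" using ss(4)[OF s(1)] by blast
    have "a = (i, s)" using s(2) i by simp
    moreover have "(i, s) \<in> arcs P" "c = \<phi> (i, s) - 1" using i(2) arc_choice_iff[OF D(1)] by auto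
    ultimately show ?thesis using i D(3)[of "(i, s)"] by simp
  qed
  have "map snd as = ss" "map fst as = map (\<lambda>s. snd (the (?d s))) ss" by (simp_all add: as_def comp_def)
  moreover have "length as = m" using ss(2) by (simp add: as_def)
  moreover have "monochromatic \<phi> as" using as by (auto simp: monochromatic_def)
  moreover have "\<forall>a\<in>set as. \<forall>b\<in>set as. fst a < snd b" using as by (meson le_less_trans)
  moreover have "set as \<subseteq> arcs P" using as by blast
  ultimately show ?thesis using ss(1,3) by (intro exI[of _ as]) simp
qed

text \<open>The openers are distinct elements of {1..n}. Finiteness is what gives the maxima in
  \<open>cr\<close> and \<open>ne\<close> their meaning.\<close>

lemma finite_lengths:
  assumes "(P, \<phi>) \<in> colored_partitions n r"
    "\<And>as. Q as \<Longrightarrow> set as \<subseteq> arcs P \<and> sorted_wrt (<) (map fst as)"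
  shows "finite {length as | as. Q as}"
proof (rule finite_subset)
  show "{length as | as. Q as} \<subseteq> {..n}"
  proof
    fix m assume "m \<in> {length as | as. Q as}"
    then obtain as where m: "m = length as" and Q: "Q as" by blast
    have "set (map fst as) \<subseteq> {1..n}"
    proof
      fix x assume "x \<in> set (map fst as)"
      then obtain y where "(x, y) \<in> arcs P" using assms(2)[OF Q] by auto
      then show "x \<in> {1..n}" using arcs_bounds[OF colored_partitionsD(1)[OF assms(1)], of x y] by simp
    qed
    then have "card (set (map fst as)) \<le> n" using card_mono[of "{1..n}"] by fastforce
    moreover have "distinct (map fst as)" using assms(2)[OF Q] strict_sorted_iff by blast
    ultimately show "m \<in> {..n}" using distinct_card[of "map fst as"] m by simp
  qed
qed simp

lemma cr_less_iff:
  assumes "(P, \<phi>) \<in> colored_partitions n r" "1 \<le> j"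
  shows "cr (P, \<phi>) < j \<longleftrightarrow> (\<forall>t<n. \<forall>c. \<not> has_chain (>) j (open_word n (arc_choice (P, \<phi>)) t c))"
proof -
  let ?L = "{length as | as. is_crossing P as \<and> monochromatic \<phi> as}"
  have "finite ?L"
    using assms(1) by (rule finite_lengths) (auto simp: is_crossing_def sorted_wrt_append)
  moreover have "0 \<in> ?L"
    by (auto simp: is_crossing_def monochromatic_def intro!: exI[of _ "[]"])
  ultimately have "cr (P, \<phi>) < j \<longleftrightarrow> (\<forall>m\<in>?L. m < j)"
    unfolding cr_def fst_conv snd_conv by (subst Max_less_iff) auto
  also have "\<dots> \<longleftrightarrow> (\<forall>t<n. \<forall>c. \<not> has_chain (>) j (open_word n (arc_choice (P, \<phi>)) t c))"
  proof
    assume L: "\<forall>m\<in>?L. m < j"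
    show "\<forall>t<n. \<forall>c. \<not> has_chain (>) j (open_word n (arc_choice (P, \<phi>)) t c)"
    proof (intro allI impI notI)
      fix t c assume "has_chain (>) j (open_word n (arc_choice (P, \<phi>)) t c)"
      from chain_arc_list[OF assms(1) this] obtain as where as: "length as = j" "set as \<subseteq> arcs P"
        "monochromatic \<phi> as" "sorted_wrt (>) (map snd as)" "sorted_wrt (>) (map fst as)"
        "\<forall>a\<in>set as. \<forall>b\<in>set as. fst a < snd b" by blast
      \<comment> \<open>In a crossing openers and closers both increase. Open words list closers
        decreasingly, so the crossing is read in reverse; a nesting, listed by increasing openers,
        already has decreasing closers.\<close>
      have "is_crossing P (rev as)" unfolding is_crossing_def rev_map[symmetric]
        using as by (auto simp: sorted_wrt_append sorted_wrt_rev)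
      then have "j \<in> ?L" using as(1,3)
        by (auto simp: monochromatic_def intro!: exI[of _ "rev as"])
      then show False using L by blast
    qed
  next
    assume R: "\<forall>t<n. \<forall>c. \<not> has_chain (>) j (open_word n (arc_choice (P, \<phi>)) t c)"
    show "\<forall>m\<in>?L. m < j"
    proof (rule ballI, rule ccontr)
      fix m assume "m \<in> ?L" "\<not> m < j"
      then obtain as where as: "is_crossing P as" "monochromatic \<phi> as" "j \<le> length as" by auto
      have "\<exists>t<n. \<exists>c. has_chain (>) (length (rev as)) (open_word n (arc_choice (P, \<phi>)) t c)"
        using as assms(2) unfolding is_crossing_def
        by (intro arc_list_chain[OF assms(1)])
          (auto simp: sorted_wrt_append rev_map[symmetric] sorted_wrt_rev monochromatic_def)
      then show False using R has_chain_mono as(3) by (metis length_rev)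
    qed
  qed
  finally show ?thesis .
qed

lemma ne_less_iff:
  assumes "(P, \<phi>) \<in> colored_partitions n r" "1 \<le> k"
  shows "ne (P, \<phi>) < k \<longleftrightarrow> (\<forall>t<n. \<forall>c. \<not> has_chain (<) k (open_word n (arc_choice (P, \<phi>)) t c))"
proof -
  let ?L = "{length as | as. is_nesting P as \<and> monochromatic \<phi> as}"
  have "finite ?L"
    using assms(1) by (rule finite_lengths) (auto simp: is_nesting_def sorted_wrt_append)
  moreover have "0 \<in> ?L"
    by (auto simp: is_nesting_def monochromatic_def intro!: exI[of _ "[]"])
  ultimately have "ne (P, \<phi>) < k \<longleftrightarrow> (\<forall>m\<in>?L. m < k)"
    unfolding ne_def fst_conv snd_conv by (subst Max_less_iff) auto
  also have "\<dots> \<longleftrightarrow> (\<forall>t<n. \<forall>c. \<not> has_chain (<) k (open_word n (arc_choice (P, \<phi>)) t c))"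
  proof
    assume L: "\<forall>m\<in>?L. m < k"
    show "\<forall>t<n. \<forall>c. \<not> has_chain (<) k (open_word n (arc_choice (P, \<phi>)) t c)"
    proof (intro allI impI notI)
      fix t c assume "has_chain (<) k (open_word n (arc_choice (P, \<phi>)) t c)"
      from chain_arc_list[OF assms(1) this] obtain as where as: "length as = k" "set as \<subseteq> arcs P"
        "monochromatic \<phi> as" "sorted_wrt (>) (map snd as)" "sorted_wrt (<) (map fst as)"
        "\<forall>a\<in>set as. \<forall>b\<in>set as. fst a < snd b" by blast
      have "is_nesting P as" unfolding is_nesting_def
        using as by (auto simp: sorted_wrt_append sorted_wrt_rev)
      then have "k \<in> ?L" using as(1,3) by blast
      then show False using L by blast
    qed
  next
    assume R: "\<forall>t<n. \<forall>c. \<not> has_chain (<) k (open_word n (arc_choice (P, \<phi>)) t c)"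
    show "\<forall>m\<in>?L. m < k"
    proof (rule ballI, rule ccontr)
      fix m assume "m \<in> ?L" "\<not> m < k"
      then obtain as where as: "is_nesting P as" "monochromatic \<phi> as" "k \<le> length as" by auto
      have "\<exists>t<n. \<exists>c. has_chain (<) (length as) (open_word n (arc_choice (P, \<phi>)) t c)"
        using as assms(2) unfolding is_nesting_def
        by (intro arc_list_chain[OF assms(1)]) (auto simp: sorted_wrt_append sorted_wrt_rev)
      then show False using R has_chain_mono as(3) by metis
    qed
  qed
  finally show ?thesis .
qed

lemma word_ok_arc_choice:
  assumes "(P, \<phi>) \<in> colored_partitions n r" "1 \<le> j" "1 \<le> k"
  shows "word_ok r (j - 1) (k - 1) 0 (map (arc_choice (P, \<phi>)) [Suc 0..<Suc n]) \<longleftrightarrow>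
    cr (P, \<phi>) < j \<and> ne (P, \<phi>) < k"
proof -
  let ?d = "arc_choice (P, \<phi>)"
  have af0: "arc_fun r 0 n ?d" using assms(1) by (rule arc_fun_arc_choice)
  have af: "arc_fun r t n ?d" for t by (induction t) (use af0 arc_fun_Suc in auto)
  have nil: "open_word n ?d t c = []" if "r \<le> c" for t c
  proof -
    have "i \<notin> set (open_word n ?d t c)" for i
      using arc_funD(1)[OF af[of t], of _ c i] that unfolding set_open_word by auto
    then show ?thesis by (metis list.set_intros(1) neq_Nil_conv)
  qed
  have "shape (\<lambda>c. insertion_tableau (open_word n ?d t c)) \<subseteq> {..<r} \<times> {..<j - 1} \<times> {..<k - 1} \<longleftrightarrow>
      (\<forall>c. \<not> has_chain (>) j (open_word n ?d t c) \<and> \<not> has_chain (<) k (open_word n ?d t c))" for t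
    using shape_insertion_tableau[of "open_word n ?d t" r "j - 1" "k - 1"]
      distinct_open_word[OF af] nil assms(2,3) by simp
  then have "word_ok r (j - 1) (k - 1) 0 (map ?d [Suc 0..<Suc n]) \<longleftrightarrow> (\<forall>t<n.
    \<forall>c. \<not> has_chain (>) j (open_word n ?d t c) \<and> \<not> has_chain (<) k (open_word n ?d t c))"
    using word_ok_iff[of 0 n r "j - 1" "k - 1" ?d] af0 by auto
  then show ?thesis using cr_less_iff[OF assms(1,2)] ne_less_iff[OF assms(1,3)] by blast
qed

section \<open>Colored partitions correspond to admissible words\<close>

lemma arc_choice_inj:
  "inj_on (\<lambda>\<Lambda>. map (arc_choice \<Lambda>) [Suc 0..<Suc n]) (colored_partitions n r)"
proof (rule inj_onI)
  fix \<Lambda> \<Lambda>' assume mem: "\<Lambda> \<in> colored_partitions n r" "\<Lambda>' \<in> colored_partitions n r"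
    and eq: "map (arc_choice \<Lambda>) [Suc 0..<Suc n] = map (arc_choice \<Lambda>') [Suc 0..<Suc n]"
  obtain P \<phi> P' \<phi>' where L: "\<Lambda> = (P, \<phi>)" "\<Lambda>' = (P', \<phi>')" by (cases \<Lambda>; cases \<Lambda>') auto
  note D = colored_partitionsD[OF mem(1)[unfolded L]] and D' = colored_partitionsD[OF mem(2)[unfolded L]]
  have same: "arc_choice (P, \<phi>) s = arc_choice (P', \<phi>') s" if "1 \<le> s" "s \<le> n" for s
    using eq that unfolding L by (simp add: map_eq_conv del: upt_Suc)
  have "(i, s) \<in> arcs P \<longleftrightarrow> (i, s) \<in> arcs P'" for i s
  proof (cases "1 \<le> s \<and> s \<le> n")
    case True
    then show ?thesis using same[of s] arc_choice_iff[OF D(1), of \<phi> s _ i]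
      arc_choice_iff[OF D'(1), of \<phi>' s _ i] by metis
  next
    case False
    then show ?thesis using arcs_bounds[OF D(1), of i s] arcs_bounds[OF D'(1), of i s] by linarith
  qed
  then have arcs: "arcs P = arcs P'" by auto
  then have P: "P = P'" by (rule partition_arcs_inj[OF D(1) D'(1)])
  have "\<phi> = \<phi>'"
  proof (rule PiE_ext[OF D(2)])
    show "\<phi>' \<in> arcs P \<rightarrow>\<^sub>E {1..r}" using D'(2) arcs by simp
    fix x assume x: "x \<in> arcs P"
    obtain i s where xs: "x = (i, s)" by (cases x) auto
    have "1 \<le> s" "s \<le> n" using arcs_bounds[OF D(1), of i s] x xs by auto
    from same[OF this] have "\<phi> x - 1 = \<phi>' x - 1"
      using arc_choice_iff[OF D(1), of \<phi> s _ i] arc_choice_iff[OF D'(1), of \<phi>' s _ i] x xs arcs by metis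
    \<comment> \<open>Colours are at least 1, so the truncated subtraction loses nothing.\<close>
    then show "\<phi> x = \<phi>' x" using D(3)[OF x] D'(3)[of x] x arcs by simp
  qed
  then show "\<Lambda> = \<Lambda>'" using P L by simp
qed

lemma arc_choice_surj:
  assumes "length ds = n" "word_ok r p q 0 ds"
  shows "\<exists>\<Lambda>\<in>colored_partitions n r. ds = map (arc_choice \<Lambda>) [Suc 0..<Suc n]"
proof -
  \<comment> \<open>List positions start at 0 and closers at 1. The value \<open>None\<close>
    elsewhere keeps arcs within {1..n}.\<close>
  define d where "d s = (if 1 \<le> s \<and> s \<le> n then ds ! (s - 1) else None)" for s
  have ds: "map d [Suc 0..<Suc n] = ds"
    by (rule nth_equalityI) (use assms(1) in \<open>auto simp: d_def simp del: upt_Suc\<close>)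
  have af: "arc_fun r 0 n d" using word_ok_iff[of 0 n r p q d] assms(2) ds by simp
  have rng: "0 < s" "s \<le> n" if "d s = Some x" for s x using that by (auto simp: d_def split: if_splits)
  have dD: "c < r" "1 \<le> i" "i < s" if "d s = Some (c, i)" for s c i
    using arc_funD[OF af rng[OF that] that] by auto
  have du: "s' = s" if "d s = Some (c, i)" "d s' = Some (c', i)" for s s' c c' i
    using arc_fun_unique[OF af rng[OF that(1)] that(1) rng[OF that(2)] that(2)] .
  define X where "X = {(i, s). \<exists>c. d s = Some (c, i)}"
  have "\<exists>P. partition_on {1..n} P \<and> arcs P = X"
  proof (rule partition_arcs_surj)
    fix a b assume "(a, b) \<in> X"
    then obtain c where "d b = Some (c, a)" by (auto simp: X_def)
    then show "a \<in> {1..n} \<and> b \<in> {1..n} \<and> a < b" using dD[of b c a] rng[of b] by auto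
  qed (auto simp: X_def dest: du)
  then obtain P where P: "partition_on {1..n} P" "arcs P = X" by blast
  \<comment> \<open>\<open>Suc\<close> undoes the shift of colours, and the restriction makes the
    colouring extensional, as \<open>colored_partitions\<close> requires.\<close>
  define \<phi> where "\<phi> = restrict (\<lambda>x. Suc (fst (the (d (snd x))))) X"
  have "\<phi> \<in> arcs P \<rightarrow>\<^sub>E {1..r}"
    unfolding \<phi>_def P(2) by (rule restrict_PiE_iff[THEN iffD2]) (auto simp: X_def Suc_le_eq dest: dD)
  then have mem: "(P, \<phi>) \<in> colored_partitions n r" using P(1) by (simp add: colored_partitions_def)
  have "arc_choice (P, \<phi>) s = d s" for s
  proof (cases "d s")
    case None
    then have "\<nexists>i. (i, s) \<in> arcs P" by (simp add: P(2) X_def)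
    then show ?thesis using None by (simp add: arc_choice_def)
  next
    case (Some x)
    obtain c i where x: "x = (c, i)" by (cases x) auto
    have "(i, s) \<in> X" using Some x by (auto simp: X_def)
    moreover have "\<phi> (i, s) = Suc c" using \<open>(i, s) \<in> X\<close> Some x by (simp add: \<phi>_def)
    ultimately show ?thesis using arc_choice_iff[OF P(1), of \<phi> s c i] Some x P(2) by simp
  qed
  then have "map (arc_choice (P, \<phi>)) [Suc 0..<Suc n] = map d [Suc 0..<Suc n]" by simp
  with mem ds show ?thesis by (intro bexI[of _ "(P, \<phi>)"]) simp_all
qed

lemma NCN_eq_vac_count:
  assumes "1 \<le> j" "1 \<le> k"
  shows "NCN j k n r = vac_count r (j - 1) (k - 1) n {}"
proof -
  let ?f = "\<lambda>\<Lambda>. map (arc_choice \<Lambda>) [Suc 0..<Suc n]"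
  let ?W = "{ds. length ds = n \<and> word_ok r (j - 1) (k - 1) 0 ds \<and> word_state 0 ds = (\<lambda>_ _. {})}"
  have ok: "word_ok r (j - 1) (k - 1) 0 (?f \<Lambda>) \<longleftrightarrow> cr \<Lambda> < j \<and> ne \<Lambda> < k"
    if "\<Lambda> \<in> colored_partitions n r" for \<Lambda>
    using word_ok_arc_choice[of "fst \<Lambda>" "snd \<Lambda>"] that assms by simp
  \<comment> \<open>At time 0 all entries lie in the empty interval {1..0}, so the final state is
    empty and all admissible words belong to one fibre of \<open>card_words\<close>.\<close>
  have empty: "word_state 0 ds = (\<lambda>_ _. {})" if "word_ok r (j - 1) (k - 1) 0 ds" for ds
    using word_state_tab_state[OF that] by (auto simp: tab_state_def fun_eq_iff)
  have "bij_betw ?f {\<Lambda> \<in> colored_partitions n r. cr \<Lambda> < j \<and> ne \<Lambda> < k} ?W"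
    unfolding bij_betw_def
  proof
    show "inj_on ?f {\<Lambda> \<in> colored_partitions n r. cr \<Lambda> < j \<and> ne \<Lambda> < k}"
      by (rule inj_on_subset[OF arc_choice_inj[of n r]]) auto
    show "?f ` {\<Lambda> \<in> colored_partitions n r. cr \<Lambda> < j \<and> ne \<Lambda> < k} = ?W"
    proof (intro subset_antisym subsetI)
      fix ds assume "ds \<in> ?f ` {\<Lambda> \<in> colored_partitions n r. cr \<Lambda> < j \<and> ne \<Lambda> < k}"
      then obtain \<Lambda> where L: "\<Lambda> \<in> colored_partitions n r" "cr \<Lambda> < j \<and> ne \<Lambda> < k" "ds = ?f \<Lambda>" by blast
      have "word_ok r (j - 1) (k - 1) 0 ds" using L ok by blast
      moreover have "length ds = n" using L(3) by simp
      ultimately show "ds \<in> ?W" using empty by blast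
    next
      fix ds assume ds: "ds \<in> ?W"
      then obtain \<Lambda> where L: "\<Lambda> \<in> colored_partitions n r" "ds = ?f \<Lambda>" using arc_choice_surj by blast
      then have "cr \<Lambda> < j \<and> ne \<Lambda> < k" using ok[OF L(1)] ds by blast
      then show "ds \<in> ?f ` {\<Lambda> \<in> colored_partitions n r. cr \<Lambda> < j \<and> ne \<Lambda> < k}" using L by blast
    qed
  qed
  then have "NCN j k n r = card ?W" unfolding NCN_def by (rule bij_betw_same_card)
  moreover have sh: "shape (\<lambda>_ _. {}) = {}" by (simp add: shape_def)
  moreover have "tab_state r (j - 1) (k - 1) 0 (\<lambda>_ _. {})"
    by (simp add: tab_state_def tableau_empty sh)
  ultimately show ?thesis using card_words[of r "j - 1" "k - 1" 0 "\<lambda>_ _. {}" n] by simp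
qed

theorem theorem3p5:
  fixes j k r n :: nat
  assumes "j \<ge> 2" and "k \<ge> 2" and "r \<ge> 1" and "n \<ge> 1"
  shows "NCN j k n r =
    card {es. walk (G_graph j k r) (0\<^sub>m r (k - 1)) es (0\<^sub>m r (k - 1)) \<and> length es = n - 1}"
proof -
  have "NCN j k n r = vac_count r (j - 1) (k - 1) (Suc (n - 1)) {}"
    using NCN_eq_vac_count[of j k n r] assms by simp
  also have "\<dots> = card (walks j k r (n - 1) (0\<^sub>m r (k - 1)))"
    using card_zero_walks[OF assms(1,2)] by simp
  finally show ?thesis by (simp only: walks_def[OF assms(1,2)])
qed

end
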